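(* Let $\mathfrak g,\mathfrak n$ be topological Lie algebras over $\mathbb K$, $S:\mathfrak g\to\mathrm{der}\,\mathfrak n$ a continuous outer action and $\omega\in C^2(\mathfrak g,\mathfrak n)$ with $R_S=\mathrm{ad}\circ\omega$. Assume that the ideal $\mathfrak z(\mathfrak n)$ of $\mathfrak n$ is topologically split, write $\mathfrak n=\mathfrak z(\mathfrak n)\oplus_f\mathfrak n_{\mathrm{ad}}$ with $f\in Z^2(\mathfrak n_{\mathrm{ad}},\mathfrak z(\mathfrak n))$, and let $\theta:\mathfrak g^S\times\mathfrak n_{\mathrm{ad}}\to\mathfrak z(\mathfrak n)$ be the continuous bilinear map describing the $\mathfrak g^S$-action on $\mathfrak n$. Then: (1) The cohomology class $\chi([S])=[d_S\omega]\in H^3(\mathfrak g,\mathfrak z(\mathfrak n))_S$ vanishes if and only if $\mathrm{Ext}(\mathfrak g,\mathfrak n)_{[S]}\neq\emptyset$. (2) If $[d_S\omega]=0$, then each topologically split $\mathfrak n$-extension of $\mathfrak g$ corresponding to $[S]$ is equivalent to an extension of the form $$q:\mathfrak z(\mathfrak n)\oplus_{\tilde f}\mathfrak g^S\to\mathfrak g,\quad (z,x)\mapsto q_S(x),\qquad \tilde f\in Z^2(\mathfrak g^S,\mathfrak z(\mathfrak n))_\theta.$$ The set $Z^2(\mathfrak g^S,\mathfrak z(\mathfrak n))_\theta$ is an affine space on which the vector space $Z^2(\mathfrak g,\mathfrak z(\mathfrak n))_S$ acts simply transitively by $\eta.\tilde f:=\tilde f+q_S^*\eta$. Two $\mathfrak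 n$-extensions of $\mathfrak g$ corresponding to $\tilde f_1,\tilde f_2\in Z^2(\mathfrak g^S,\mathfrak z(\mathfrak n))_\theta$ are equivalent if and only if $\tilde f_2-\tilde f_1\in q_S^*B^2(\mathfrak g,\mathfrak z(\mathfrak n))_S$.
   Context: $\mathbb K$ is a topological field of characteristic $0$ (discrete topology allowed); topological vector spaces are Hausdorff. $C^p(\mathfrak g,V)$ denotes continuous alternating $p$-linear maps. $\mathrm{der}\,\mathfrak n$: continuous derivations; $\mathfrak z(\mathfrak n)$: center. A continuous outer action is a linear map $S:\mathfrak g\to\mathrm{der}\,\mathfrak n$ with $(x,n)\mapsto S(x)n$ continuous and such that $R_S(x,y):=[S(x),S(y)]-S([x,y])$ equals $\mathrm{ad}(\omega(x,y))$ for some $\omega\in C^2(\mathfrak g,\mathfrak n)$. $S\sim S'$ if $S=S'+\mathrm{ad}\circ\gamma$ for some continuous linear $\gamma:\mathfrak g\to\mathfrak n$; the class $[S]$ is called a continuous $\mathfrak g$-kernel. Via $S$, $\mathfrak z(\mathfrak n)$ is a topological $\mathfrak g$-module; $Z^p,B^p,H^p(\mathfrak g,\mathfrak z(\mathfrak n))_S$ denote continuous cocycles, coboundaries, cohomology. For $\alpha\in C^p(\mathfrak g,\mathfrak n)$, $$(d_S\alpha)(x_0,\dots,x_p)=\sum_j(-1)^jS(x_j).\alpha(\dots,\widehat{x_j},\dots)+\sum_{i<j}(-1)^{i+j}\alpha([x_i,x_j],\dots,\widehat{x_i},\dots,\widehat{x_j},\dots).$$ If $R_S=\mathrm{ad}\circ\omega$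 then $d_S\omega\in Z^3(\mathfrak g,\mathfrak z(\mathfrak n))_S$, and its class $\chi([S])$ depends only on $[S]$. A subspace $W\subseteq V$ is topologically split if it is closed and $V\to V/W$ has a continuous linear section $\sigma$ with $W\times V/W\to V$, $(w,x)\mapsto w+\sigma(x)$ a topological isomorphism. A (topologically split) extension of $\mathfrak g$ by $\mathfrak n$ is a topological Lie algebra $\hat{\mathfrak g}$ containing $\mathfrak n$ as a topologically split ideal with a quotient morphism $q:\hat{\mathfrak g}\to\mathfrak g$ with kernel $\mathfrak n$; equivalence means a topological Lie algebra isomorphism inducing the identity on $\mathfrak n$ and on $\mathfrak g$. It corresponds to $[S]$ if $[x\mapsto\mathrm{ad}(\sigma(x))|_{\mathfrak n}]=[S]$ for a continuous linear section $\sigma$ of $q$. $\mathrm{Ext}(\mathfrak g,\mathfrak n)_{[S]}$ is the set of equivalence classes of extensions corresponding to $[S]$. $\mathfrak n_{\mathrm{ad}}:=\mathfrak n/\mathfrak z(\mathfrak n)\cong\mathrm{ad}\,\mathfrak n$ with the quotient topology. $\mathfrak g^S:=\mathfrak n_{\mathrm{ad}}\times\mathfrak g$ with the Lie bracket $$[(\mathrm{ad}\,n,x),(\mathrm{ad}\,n',x')]=(\mathrm{ad}([n,n']+S(x)n'-S(x')n+\omega(x,x')),[x,x'])$$ (independent of the choice of $\omega$), and $q_S:\mathfrak g^S\to\mathfrak g$, $(\mathrm{ad}\,n,x)\mapsto x$. $\mathfrak g^S$ acts continuously on $\mathfrak n$ by $(\mathrm{ad}\,n,x).n'=[n,n']+S(x)n'$;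 on $\mathfrak z(\mathfrak n)$ this action factors through $q_S$ and the $\mathfrak g$-action. For a Lie algebra $\mathfrak l$, an $\mathfrak l$-module $\mathfrak a$ and $f\in Z^2(\mathfrak l,\mathfrak a)$, $\mathfrak a\oplus_f\mathfrak l$ is $\mathfrak a\times\mathfrak l$ with bracket $[(a,x),(a',x')]=(x.a'-x'.a+f(x,x'),[x,x'])$. As $\mathfrak z(\mathfrak n)$ is split, one may fix $f\in Z^2(\mathfrak n_{\mathrm{ad}},\mathfrak z(\mathfrak n))$ and identify $\mathfrak n$ with $\mathfrak z(\mathfrak n)\oplus_f\mathfrak n_{\mathrm{ad}}$ (as central extensions of $\mathfrak n_{\mathrm{ad}}$). Then the $\mathfrak g^S$-action on $\mathfrak n$ takes the form $$(\mathrm{ad}\,n,x).(z,\mathrm{ad}\,n')=(x.z+\theta((\mathrm{ad}\,n,x),\mathrm{ad}\,n'),[\mathrm{ad}\,n+S(x),\mathrm{ad}\,n']).$$ $Z^2(\mathfrak g^S,\mathfrak z(\mathfrak n))_\theta:=\{\tilde f\in Z^2(\mathfrak g^S,\mathfrak z(\mathfrak n)):\tilde f|_{\mathfrak g^S\times\mathfrak n_{\mathrm{ad}}}=\theta\}$. For such $\tilde f$, $\mathfrak z(\mathfrak n)\oplus_{\tilde f}\mathfrak g^S$ is an extension of $\mathfrak g$ by $\mathfrak n=\mathfrak z(\mathfrak n)\oplus_f\mathfrak n_{\mathrm{ad}}\subseteq\mathfrak z(\mathfrak n)\oplus_{\tilde f}\mathfrak g^S$. *)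

theory Defs
  imports "HOL-Analysis.Analysis" "HOL-Library.Function_Algebras"
begin

section \<open>Topological fields, vector spaces and Lie algebras\<close>

class topological_field = field + topological_ab_group_add + topological_semigroup_mult +
  assumes tendsto_inverse_field: "a \<noteq> 0 \<Longrightarrow> (inverse \<longlongrightarrow> inverse a) (at a)"

text \<open>
  The underlying set of a topological vector space is the topspace of its topology, so that centers,
  quotients and products are available as objects. Addition is that of the ambient type; elements
  of the ambient type outside the carrier play no role.
\<close>

record ('k, 'a) tvs =
  vtop :: "'a topology"
  vscale :: "'k \<Rightarrow> 'a \<Rightarrow> 'a"

record ('k, 'a) tla = "('k, 'a) tvs" +
  lbr :: "'a \<Rightarrow> 'a \<Rightarrow> 'a"

abbreviation carr :: "('k, 'a, 'm) tvs_scheme \<Rightarrow> 'a set" where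
  "carr V \<equiv> topspace (vtop V)"

locale topological_vector_space =
  fixes V :: "('k :: topological_field, 'a :: ab_group_add, 'm) tvs_scheme"
  assumes zero_closed: "0 \<in> carr V"
    and add_closed: "\<lbrakk>x \<in> carr V; y \<in> carr V\<rbrakk> \<Longrightarrow> x + y \<in> carr V"
    and scale_closed: "x \<in> carr V \<Longrightarrow> vscale V c x \<in> carr V"
    and scale_add_right: "\<lbrakk>x \<in> carr V; y \<in> carr V\<rbrakk> \<Longrightarrow> vscale V c (x + y) = vscale V c x + vscale V c y"
    and scale_add_left: "x \<in> carr V \<Longrightarrow> vscale V (c + d) x = vscale V c x + vscale V d x"
    and scale_scale: "x \<in> carr V \<Longrightarrow> vscale V c (vscale V d x) = vscale V (c * d) x"
    and scale_one: "x \<in> carr V \<Longrightarrow> vscale V 1 x = x"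
    and continuous_add: "continuous_map (prod_topology (vtop V) (vtop V)) (vtop V) (\<lambda>(x, y). x + y)"
    and continuous_scale: "continuous_map (prod_topology euclidean (vtop V)) (vtop V) (\<lambda>(c, x). vscale V c x)"
    and Hausdorff: "Hausdorff_space (vtop V)"

locale topological_lie_algebra = topological_vector_space L
  for L :: "('k :: topological_field, 'a :: ab_group_add) tla" +
  assumes bracket_closed: "\<lbrakk>x \<in> carr L; y \<in> carr L\<rbrakk> \<Longrightarrow> lbr L x y \<in> carr L"
    and bracket_add_left: "\<lbrakk>x \<in> carr L; y \<in> carr L; z \<in> carr L\<rbrakk> \<Longrightarrow> lbr L (x + y) z = lbr L x z + lbr L y z"
    and bracket_add_right: "\<lbrakk>x \<in> carr L; y \<in> carr L; z \<in> carr L\<rbrakk> \<Longrightarrow> lbr L x (y + z) = lbr L x y + lbr L x z"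
    and bracket_scale_left: "\<lbrakk>x \<in> carr L; y \<in> carr L\<rbrakk> \<Longrightarrow> lbr L (vscale L c x) y = vscale L c (lbr L x y)"
    and bracket_scale_right: "\<lbrakk>x \<in> carr L; y \<in> carr L\<rbrakk> \<Longrightarrow> lbr L x (vscale L c y) = vscale L c (lbr L x y)"
    and bracket_self: "x \<in> carr L \<Longrightarrow> lbr L x x = 0"
    and jacobi: "\<lbrakk>x \<in> carr L; y \<in> carr L; z \<in> carr L\<rbrakk> \<Longrightarrow>
           lbr L x (lbr L y z) + lbr L y (lbr L z x) + lbr L z (lbr L x y) = 0"
    and continuous_bracket: "continuous_map (prod_topology (vtop L) (vtop L)) (vtop L) (\<lambda>(x, y). lbr L x y)"

definition continuous_linear ::
  "('k, 'a :: ab_group_add, 'm) tvs_scheme \<Rightarrow> ('k, 'b :: ab_group_add, 'n) tvs_scheme \<Rightarrow> ('a \<Rightarrow> 'b) \<Rightarrow> bool" where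
  "continuous_linear V W \<phi> \<longleftrightarrow>
     continuous_map (vtop V) (vtop W) \<phi> \<and>
     (\<forall>x\<in>carr V. \<forall>y\<in>carr V. \<phi> (x + y) = \<phi> x + \<phi> y) \<and>
     (\<forall>c. \<forall>x\<in>carr V. \<phi> (vscale V c x) = vscale W c (\<phi> x))"

definition continuous_bilinear ::
  "('k, 'a :: ab_group_add, 'm) tvs_scheme \<Rightarrow> ('k, 'b :: ab_group_add, 'n) tvs_scheme \<Rightarrow>
   ('k, 'c :: ab_group_add, 'o) tvs_scheme \<Rightarrow> ('a \<Rightarrow> 'b \<Rightarrow> 'c) \<Rightarrow> bool" where
  "continuous_bilinear U V W \<beta> \<longleftrightarrow>
     continuous_map (prod_topology (vtop U) (vtop V)) (vtop W) (\<lambda>(u, v). \<beta> u v) \<and>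
     (\<forall>u\<in>carr U. \<forall>u'\<in>carr U. \<forall>v\<in>carr V. \<beta> (u + u') v = \<beta> u v + \<beta> u' v) \<and>
     (\<forall>u\<in>carr U. \<forall>v\<in>carr V. \<forall>v'\<in>carr V. \<beta> u (v + v') = \<beta> u v + \<beta> u v') \<and>
     (\<forall>c. \<forall>u\<in>carr U. \<forall>v\<in>carr V. \<beta> (vscale U c u) v = vscale W c (\<beta> u v)) \<and>
     (\<forall>c. \<forall>u\<in>carr U. \<forall>v\<in>carr V. \<beta> u (vscale V c v) = vscale W c (\<beta> u v))"

definition lie_hom ::
  "('k, 'a :: ab_group_add) tla \<Rightarrow> ('k, 'b :: ab_group_add) tla \<Rightarrow> ('a \<Rightarrow> 'b) \<Rightarrow> bool" where
  "lie_hom L M \<phi> \<longleftrightarrow> continuous_linear L M \<phi> \<and>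
     (\<forall>x\<in>carr L. \<forall>y\<in>carr L. \<phi> (lbr L x y) = lbr M (\<phi> x) (\<phi> y))"

definition lie_iso ::
  "('k, 'a :: ab_group_add) tla \<Rightarrow> ('k, 'b :: ab_group_add) tla \<Rightarrow> ('a \<Rightarrow> 'b) \<Rightarrow> bool" where
  "lie_iso L M \<phi> \<longleftrightarrow> lie_hom L M \<phi> \<and> homeomorphic_map (vtop L) (vtop M) \<phi>"

definition quot_topology :: "'a topology \<Rightarrow> ('a \<Rightarrow> 'b) \<Rightarrow> 'b topology" where
  "quot_topology X f =
     topology (\<lambda>U. U \<subseteq> f ` topspace X \<and> openin X {x \<in> topspace X. f x \<in> U})"

subsection \<open>Topologically split subspaces\<close>

definition linear_subspace :: "('k, 'a :: ab_group_add, 'm) tvs_scheme \<Rightarrow> 'a set \<Rightarrow> bool" where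
  "linear_subspace V W \<longleftrightarrow> W \<subseteq> carr V \<and> 0 \<in> W \<and> (\<forall>x\<in>W. \<forall>y\<in>W. x + y \<in> W) \<and>
     (\<forall>c. \<forall>x\<in>W. vscale V c x \<in> W)"

definition coset :: "'a :: ab_group_add set \<Rightarrow> 'a \<Rightarrow> 'a set" where
  "coset W x = (\<lambda>w. x + w) ` W"

text \<open>The elements of \<open>V / W\<close> are the cosets of \<open>W\<close>; linearity of \<open>\<sigma>\<close> is stated on representatives.\<close>

definition topologically_split :: "('k, 'a :: ab_group_add, 'm) tvs_scheme \<Rightarrow> 'a set \<Rightarrow> bool" where
  "topologically_split V W \<longleftrightarrow> linear_subspace V W \<and> closedin (vtop V) W \<and>
     (\<exists>\<sigma>. continuous_map (quot_topology (vtop V) (coset W)) (vtop V) \<sigma> \<and>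
          (\<forall>x\<in>carr V. coset W (\<sigma> (coset W x)) = coset W x) \<and>
          (\<forall>x\<in>carr V. \<forall>y\<in>carr V. \<sigma> (coset W (x + y)) = \<sigma> (coset W x) + \<sigma> (coset W y)) \<and>
          (\<forall>c. \<forall>x\<in>carr V. \<sigma> (coset W (vscale V c x)) = vscale V c (\<sigma> (coset W x))) \<and>
          homeomorphic_map
            (prod_topology (subtopology (vtop V) W) (quot_topology (vtop V) (coset W))) (vtop V)
            (\<lambda>(w, X). w + \<sigma> X))"

section \<open>Continuous cochains and cohomology\<close>

text \<open>
  A \<open>p\<close>-cochain takes the list of its \<open>p\<close> arguments and vanishes on all lists that are not
  \<open>p\<close>-tuples of carrier elements. Hence cochains are equal iff they agree on the carrier, and the
  cochains form a subgroup of the pointwise additive group of functions.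
\<close>

definition tuples :: "nat \<Rightarrow> ('k, 'a, 'm) tvs_scheme \<Rightarrow> 'a list set" where
  "tuples p L = {xs. length xs = p \<and> set xs \<subseteq> carr L}"

definition cochains ::
  "nat \<Rightarrow> ('k, 'l :: ab_group_add, 'm) tvs_scheme \<Rightarrow> ('k, 'v :: ab_group_add, 'n) tvs_scheme \<Rightarrow>
   ('l list \<Rightarrow> 'v) set" where
  "cochains p L V = {\<alpha>.
     (\<forall>xs. xs \<notin> tuples p L \<longrightarrow> \<alpha> xs = 0) \<and>
     continuous_map (product_topology (\<lambda>_. vtop L) {..<p}) (vtop V) (\<lambda>x. \<alpha> (map x [0..<p])) \<and>
     (\<forall>xs\<in>tuples p L. \<forall>i<p. \<forall>x\<in>carr L. \<forall>y\<in>carr L.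
        \<alpha> (xs[i := x + y]) = \<alpha> (xs[i := x]) + \<alpha> (xs[i := y])) \<and>
     (\<forall>xs\<in>tuples p L. \<forall>i<p. \<forall>c. \<forall>x\<in>carr L.
        \<alpha> (xs[i := vscale L c x]) = vscale V c (\<alpha> (xs[i := x]))) \<and>
     (\<forall>xs\<in>tuples p L. \<forall>i j. i < j \<and> j < p \<and> xs ! i = xs ! j \<longrightarrow> \<alpha> xs = 0)}"

definition signed :: "nat \<Rightarrow> 'v :: ab_group_add \<Rightarrow> 'v" where
  "signed j v = (if even j then v else - v)"

text \<open>Here \<open>nths xs (- J)\<close> is \<open>xs\<close> with the entries at the positions in \<open>J\<close> omitted.\<close>

definition ce_diff ::
  "nat \<Rightarrow> ('k, 'l :: ab_group_add) tla \<Rightarrow> ('l \<Rightarrow> 'v \<Rightarrow> 'v) \<Rightarrow> ('l list \<Rightarrow> 'v :: ab_group_add) \<Rightarrow>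
   'l list \<Rightarrow> 'v" where
  "ce_diff p L \<rho> \<alpha> = (\<lambda>xs. if xs \<in> tuples (Suc p) L then
       (\<Sum>j\<le>p. signed j (\<rho> (xs ! j) (\<alpha> (nths xs (- {j}))))) +
       (\<Sum>(i, j) \<in> {(i, j). i < j \<and> j \<le> p}.
          signed (i + j) (\<alpha> (lbr L (xs ! i) (xs ! j) # nths xs (- {i, j}))))
     else 0)"

definition cocycles ::
  "nat \<Rightarrow> ('k, 'l :: ab_group_add) tla \<Rightarrow> ('k, 'v :: ab_group_add, 'n) tvs_scheme \<Rightarrow>
   ('l \<Rightarrow> 'v \<Rightarrow> 'v) \<Rightarrow> ('l list \<Rightarrow> 'v) set" where
  "cocycles p L V \<rho> = {\<alpha> \<in> cochains p L V. ce_diff p L \<rho> \<alpha> = 0}"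

definition coboundaries ::
  "nat \<Rightarrow> ('k, 'l :: ab_group_add) tla \<Rightarrow> ('k, 'v :: ab_group_add, 'n) tvs_scheme \<Rightarrow>
   ('l \<Rightarrow> 'v \<Rightarrow> 'v) \<Rightarrow> ('l list \<Rightarrow> 'v) set" where
  "coboundaries p L V \<rho> = (if p = 0 then {0} else ce_diff (p - 1) L \<rho> ` cochains (p - 1) L V)"

definition cohom_class ::
  "nat \<Rightarrow> ('k, 'l :: ab_group_add) tla \<Rightarrow> ('k, 'v :: ab_group_add, 'n) tvs_scheme \<Rightarrow>
   ('l \<Rightarrow> 'v \<Rightarrow> 'v) \<Rightarrow> ('l list \<Rightarrow> 'v) \<Rightarrow> ('l list \<Rightarrow> 'v) set" where
  "cohom_class p L V \<rho> \<alpha> = {\<beta> \<in> cocycles p L V \<rho>. \<beta> - \<alpha> \<in> coboundaries p L V \<rho>}"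

definition pullback ::
  "('k, 'l, 'm) tvs_scheme \<Rightarrow> ('l \<Rightarrow> 'g) \<Rightarrow> ('g list \<Rightarrow> 'v :: zero) \<Rightarrow> 'l list \<Rightarrow> 'v" where
  "pullback L \<phi> \<eta> = (\<lambda>xs. if set xs \<subseteq> carr L then \<eta> (map \<phi> xs) else 0)"

text \<open>The Lie algebra \<open>\<aa> \<oplus>\<^sub>f \<ll>\<close>.\<close>

definition twisted_sum ::
  "('k, 'v :: ab_group_add) tvs \<Rightarrow> ('k, 'l :: ab_group_add) tla \<Rightarrow> ('l \<Rightarrow> 'v \<Rightarrow> 'v) \<Rightarrow>
   ('l list \<Rightarrow> 'v) \<Rightarrow> ('k, 'v \<times> 'l) tla" where
  "twisted_sum A L \<rho> f =
     \<lparr>vtop = prod_topology (vtop A) (vtop L),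
      vscale = (\<lambda>c (a, x). (vscale A c a, vscale L c x)),
      lbr = (\<lambda>(a, x) (a', x'). (\<rho> x a' - \<rho> x' a + f [x, x'], lbr L x x'))\<rparr>"

section \<open>Derivations, center and outer actions\<close>

definition derivations :: "('k, 'n :: ab_group_add) tla \<Rightarrow> ('n \<Rightarrow> 'n) set" where
  "derivations n = {D. continuous_linear n n D \<and>
     (\<forall>x\<in>carr n. \<forall>y\<in>carr n. D (lbr n x y) = lbr n (D x) y + lbr n x (D y))}"

definition commutator :: "('k, 'n :: ab_group_add) tla \<Rightarrow> ('n \<Rightarrow> 'n) \<Rightarrow> ('n \<Rightarrow> 'n) \<Rightarrow> 'n \<Rightarrow> 'n" where
  "commutator n D E = (\<lambda>y. if y \<in> carr n then D (E y) - E (D y) else 0)"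

definition ad :: "('k, 'n :: ab_group_add) tla \<Rightarrow> 'n \<Rightarrow> 'n \<Rightarrow> 'n" where
  "ad n x = (\<lambda>y. if y \<in> carr n then lbr n x y else 0)"

definition center :: "('k, 'n :: ab_group_add) tla \<Rightarrow> 'n set" where
  "center n = {z \<in> carr n. \<forall>x\<in>carr n. lbr n z x = 0}"

definition center_tvs :: "('k, 'n :: ab_group_add) tla \<Rightarrow> ('k, 'n) tvs" where
  "center_tvs n = \<lparr>vtop = subtopology (vtop n) (center n), vscale = vscale n\<rparr>"

definition curvature ::
  "('k, 'g) tla \<Rightarrow> ('k, 'n :: ab_group_add) tla \<Rightarrow> ('g \<Rightarrow> 'n \<Rightarrow> 'n) \<Rightarrow> 'g \<Rightarrow> 'g \<Rightarrow> 'n \<Rightarrow> 'n" where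
  "curvature g n S x y =
     (\<lambda>m. if m \<in> carr n then commutator n (S x) (S y) m - S (lbr g x y) m else 0)"

definition curvature_form ::
  "('k, 'g :: ab_group_add) tla \<Rightarrow> ('k, 'n :: ab_group_add) tla \<Rightarrow> ('g \<Rightarrow> 'n \<Rightarrow> 'n) \<Rightarrow>
   ('g list \<Rightarrow> 'n) \<Rightarrow> bool" where
  "curvature_form g n S \<omega> \<longleftrightarrow> \<omega> \<in> cochains 2 g n \<and>
     (\<forall>x\<in>carr g. \<forall>y\<in>carr g. curvature g n S x y = ad n (\<omega> [x, y]))"

definition continuous_outer_action ::
  "('k, 'g :: ab_group_add) tla \<Rightarrow> ('k, 'n :: ab_group_add) tla \<Rightarrow> ('g \<Rightarrow> 'n \<Rightarrow> 'n) \<Rightarrow> bool" where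
  "continuous_outer_action g n S \<longleftrightarrow>
     (\<forall>x\<in>carr g. S x \<in> derivations n) \<and>
     (\<forall>x\<in>carr g. \<forall>y\<in>carr g. \<forall>m\<in>carr n. S (x + y) m = S x m + S y m) \<and>
     (\<forall>c. \<forall>x\<in>carr g. \<forall>m\<in>carr n. S (vscale g c x) m = vscale n c (S x m)) \<and>
     continuous_map (prod_topology (vtop g) (vtop n)) (vtop n) (\<lambda>(x, m). S x m) \<and>
     (\<exists>\<omega>. curvature_form g n S \<omega>)"

definition outer_equiv ::
  "('k, 'g :: ab_group_add) tla \<Rightarrow> ('k, 'n :: ab_group_add) tla \<Rightarrow>
   ('g \<Rightarrow> 'n \<Rightarrow> 'n) \<Rightarrow> ('g \<Rightarrow> 'n \<Rightarrow> 'n) \<Rightarrow> bool" where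
  "outer_equiv g n S S' \<longleftrightarrow> (\<exists>\<gamma>. continuous_linear g n \<gamma> \<and>
     (\<forall>x\<in>carr g. \<forall>m\<in>carr n. S x m = S' x m + ad n (\<gamma> x) m))"

definition kernel_class ::
  "('k, 'g :: ab_group_add) tla \<Rightarrow> ('k, 'n :: ab_group_add) tla \<Rightarrow>
   ('g \<Rightarrow> 'n \<Rightarrow> 'n) \<Rightarrow> ('g \<Rightarrow> 'n \<Rightarrow> 'n) set" where
  "kernel_class g n S = {S'. continuous_outer_action g n S' \<and> outer_equiv g n S' S}"

text \<open>The class \<open>\<chi>([S]) = [d\<^sub>S \<omega>]\<close> in \<open>H\<^sup>3(\<gg>, \<zz>(\<nn>))\<^sub>S\<close>, for \<open>\<omega>\<close> with \<open>R\<^sub>S = ad \<circ> \<omega>\<close>.\<close>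

definition obstruction_class ::
  "('k, 'g :: ab_group_add) tla \<Rightarrow> ('k, 'n :: ab_group_add) tla \<Rightarrow> ('g \<Rightarrow> 'n \<Rightarrow> 'n) \<Rightarrow>
   ('g list \<Rightarrow> 'n) \<Rightarrow> ('g list \<Rightarrow> 'n) set" where
  "obstruction_class g n S \<omega> = cohom_class 3 g (center_tvs n) S (ce_diff 2 g S \<omega>)"

section \<open>Extensions\<close>

text \<open>
  An extension of \<open>g\<close> by \<open>n\<close> is a triple \<open>(E, \<iota>, q)\<close>, where \<open>\<iota>\<close> is the inclusion of \<open>n\<close> into \<open>E\<close>.
\<close>

type_synonym ('k, 'g, 'n, 'e) extension = "('k, 'e) tla \<times> ('n \<Rightarrow> 'e) \<times> ('e \<Rightarrow> 'g)"

definition split_extension ::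
  "('k :: topological_field, 'g :: ab_group_add) tla \<Rightarrow> ('k, 'n :: ab_group_add) tla \<Rightarrow>
   ('k, 'g, 'n, 'e :: ab_group_add) extension \<Rightarrow> bool" where
  "split_extension g n = (\<lambda>(E, \<iota>, q).
     topological_lie_algebra E \<and>
     lie_hom n E \<iota> \<and> embedding_map (vtop n) (vtop E) \<iota> \<and>
     lie_hom E g q \<and> quotient_map (vtop E) (vtop g) q \<and>
     {e \<in> carr E. q e = 0} = \<iota> ` carr n \<and>
     topologically_split E (\<iota> ` carr n))"

definition induced_outer_action ::
  "('k, 'n) tla \<Rightarrow> ('k, 'g, 'n, 'e) extension \<Rightarrow> ('g \<Rightarrow> 'e) \<Rightarrow> 'g \<Rightarrow> 'n \<Rightarrow> 'n" where
  "induced_outer_action n = (\<lambda>(E, \<iota>, q) \<sigma> x m. inv_into (carr n) \<iota> (lbr E (\<sigma> x) (\<iota> m)))"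

definition corresponds_to ::
  "('k, 'g :: ab_group_add) tla \<Rightarrow> ('k, 'n :: ab_group_add) tla \<Rightarrow> ('g \<Rightarrow> 'n \<Rightarrow> 'n) \<Rightarrow>
   ('k, 'g, 'n, 'e :: ab_group_add) extension \<Rightarrow> bool" where
  "corresponds_to g n S = (\<lambda>(E, \<iota>, q). \<exists>\<sigma>. continuous_linear g E \<sigma> \<and> (\<forall>x\<in>carr g. q (\<sigma> x) = x) \<and>
     kernel_class g n (induced_outer_action n (E, \<iota>, q) \<sigma>) = kernel_class g n S)"

definition extensions ::
  "('k :: topological_field, 'g :: ab_group_add) tla \<Rightarrow> ('k, 'n :: ab_group_add) tla \<Rightarrow>
   ('g \<Rightarrow> 'n \<Rightarrow> 'n) \<Rightarrow> ('k, 'g, 'n, 'e :: ab_group_add) extension set" where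
  "extensions g n S = {X. split_extension g n X \<and> corresponds_to g n S X}"

definition ext_equivalent ::
  "('k, 'n) tla \<Rightarrow> ('k, 'g, 'n, 'e :: ab_group_add) extension \<Rightarrow>
   ('k, 'g, 'n, 'f :: ab_group_add) extension \<Rightarrow> bool" where
  "ext_equivalent n = (\<lambda>(E, \<iota>, q) (E', \<iota>', q'). \<exists>\<Phi>. lie_iso E E' \<Phi> \<and>
     (\<forall>m\<in>carr n. \<Phi> (\<iota> m) = \<iota>' m) \<and> (\<forall>e\<in>carr E. q' (\<Phi> e) = q e))"

text \<open>
  \<open>Ext(\<gg>, \<nn>)\<^bsub>[S]\<^esub>\<close>, formed from the extensions whose carrier is contained in the type \<open>'e\<close>. As a
  topological vector space every split extension is isomorphic to \<open>\<nn> \<times> \<gg>\<close>, so the type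
  \<open>'n \<times> 'g\<close> is large enough to represent all equivalence classes.
\<close>

definition Ext ::
  "('k :: topological_field, 'g :: ab_group_add) tla \<Rightarrow> ('k, 'n :: ab_group_add) tla \<Rightarrow>
   ('g \<Rightarrow> 'n \<Rightarrow> 'n) \<Rightarrow> ('k, 'g, 'n, 'e :: ab_group_add) extension set set" where
  "Ext g n S = extensions g n S //
     {(X, Y). X \<in> extensions g n S \<and> Y \<in> extensions g n S \<and> ext_equivalent n X Y}"

section \<open>The Lie algebra \<open>\<gg>\<^sup>S\<close>\<close>

text \<open>
  Elements of \<open>\<nn>\<^sub>a\<^sub>d = \<nn>/\<zz>(\<nn>)\<close> are represented by the maps \<open>ad n\<close>; the topology is the quotient
  topology, not a topology of maps.
\<close>

definition n_ad :: "('k, 'n :: ab_group_add) tla \<Rightarrow> ('k, 'n \<Rightarrow> 'n) tla" where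
  "n_ad n = \<lparr>vtop = quot_topology (vtop n) (ad n),
      vscale = (\<lambda>c a y. vscale n c (a y)),
      lbr = commutator n\<rparr>"

text \<open>Any representative \<open>m\<close> of \<open>ad m\<close> gives the same bracket, since \<open>S(x)\<close> preserves the center.\<close>

definition g_S ::
  "('k, 'g :: ab_group_add) tla \<Rightarrow> ('k, 'n :: ab_group_add) tla \<Rightarrow> ('g \<Rightarrow> 'n \<Rightarrow> 'n) \<Rightarrow>
   ('g list \<Rightarrow> 'n) \<Rightarrow> ('k, ('n \<Rightarrow> 'n) \<times> 'g) tla" where
  "g_S g n S \<omega> =
     \<lparr>vtop = prod_topology (vtop (n_ad n)) (vtop g),
      vscale = (\<lambda>c (a, x). (vscale (n_ad n) c a, vscale g c x)),
      lbr = (\<lambda>(a, x) (a', x').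
        let m = inv_into (carr n) (ad n) a; m' = inv_into (carr n) (ad n) a'
        in (ad n (lbr n m m' + S x m' - S x' m + \<omega> [x, x']), lbr g x x'))\<rparr>"

definition g_S_action :: "('g \<Rightarrow> 'n \<Rightarrow> 'n) \<Rightarrow> ('n \<Rightarrow> 'n) \<times> 'g \<Rightarrow> 'n :: ab_group_add \<Rightarrow> 'n" where
  "g_S_action S = (\<lambda>(a, x) m. a m + S x m)"

text \<open>
  \<open>\<Psi>\<close> identifies \<open>\<zz>(\<nn>) \<oplus>\<^sub>f \<nn>\<^sub>a\<^sub>d\<close> with \<open>\<nn>\<close> as a central extension of \<open>\<nn>\<^sub>a\<^sub>d\<close> by \<open>\<zz>(\<nn>)\<close>.
\<close>

definition central_identification ::
  "('k, 'n :: ab_group_add) tla \<Rightarrow> (('n \<Rightarrow> 'n) list \<Rightarrow> 'n) \<Rightarrow> ('n \<times> ('n \<Rightarrow> 'n) \<Rightarrow> 'n) \<Rightarrow> bool" where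
  "central_identification n f \<Psi> \<longleftrightarrow>
     f \<in> cocycles 2 (n_ad n) (center_tvs n) (\<lambda>_ _. 0) \<and>
     lie_iso (twisted_sum (center_tvs n) (n_ad n) (\<lambda>_ _. 0) f) n \<Psi> \<and>
     (\<forall>z\<in>center n. \<Psi> (z, 0) = z) \<and>
     (\<forall>z\<in>center n. \<forall>a\<in>carr (n_ad n). ad n (\<Psi> (z, a)) = a)"

definition describes_action ::
  "('k, 'g :: ab_group_add) tla \<Rightarrow> ('k, 'n :: ab_group_add) tla \<Rightarrow> ('g \<Rightarrow> 'n \<Rightarrow> 'n) \<Rightarrow>
   ('g list \<Rightarrow> 'n) \<Rightarrow> ('n \<times> ('n \<Rightarrow> 'n) \<Rightarrow> 'n) \<Rightarrow>
   (('n \<Rightarrow> 'n) \<times> 'g \<Rightarrow> ('n \<Rightarrow> 'n) \<Rightarrow> 'n) \<Rightarrow> bool" where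
  "describes_action g n S \<omega> \<Psi> \<theta> \<longleftrightarrow>
     continuous_bilinear (g_S g n S \<omega>) (n_ad n) (center_tvs n) \<theta> \<and>
     (\<forall>(a, x)\<in>carr (g_S g n S \<omega>). \<forall>z\<in>center n. \<forall>b\<in>carr (n_ad n).
        g_S_action S (a, x) (\<Psi> (z, b)) =
        \<Psi> (S x z + \<theta> (a, x) b, commutator n (g_S_action S (a, x)) b))"

definition cocycles_theta ::
  "('k, 'g :: ab_group_add) tla \<Rightarrow> ('k, 'n :: ab_group_add) tla \<Rightarrow> ('g \<Rightarrow> 'n \<Rightarrow> 'n) \<Rightarrow>
   ('g list \<Rightarrow> 'n) \<Rightarrow> (('n \<Rightarrow> 'n) \<times> 'g \<Rightarrow> ('n \<Rightarrow> 'n) \<Rightarrow> 'n) \<Rightarrow>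
   ((('n \<Rightarrow> 'n) \<times> 'g) list \<Rightarrow> 'n) set" where
  "cocycles_theta g n S \<omega> \<theta> =
     {h \<in> cocycles 2 (g_S g n S \<omega>) (center_tvs n) (g_S_action S).
        \<forall>u\<in>carr (g_S g n S \<omega>). \<forall>b\<in>carr (n_ad n). h [u, (b, 0)] = \<theta> u b}"

text \<open>The extension \<open>\<zz>(\<nn>) \<oplus>\<^sub>h \<gg>\<^sup>S\<close>, with \<open>\<nn> = \<zz>(\<nn>) \<oplus>\<^sub>f \<nn>\<^sub>a\<^sub>d\<close> included through \<open>\<Psi>\<close>.\<close>

definition cocycle_extension ::
  "('k, 'g :: ab_group_add) tla \<Rightarrow> ('k, 'n :: ab_group_add) tla \<Rightarrow> ('g \<Rightarrow> 'n \<Rightarrow> 'n) \<Rightarrow>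
   ('g list \<Rightarrow> 'n) \<Rightarrow> ('n \<times> ('n \<Rightarrow> 'n) \<Rightarrow> 'n) \<Rightarrow> ((('n \<Rightarrow> 'n) \<times> 'g) list \<Rightarrow> 'n) \<Rightarrow>
   ('k, 'g, 'n, 'n \<times> (('n \<Rightarrow> 'n) \<times> 'g)) extension" where
  "cocycle_extension g n S \<omega> \<Psi> h =
     (twisted_sum (center_tvs n) (g_S g n S \<omega>) (g_S_action S) h,
      (\<lambda>m. let (z, a) = inv_into (center n \<times> carr (n_ad n)) \<Psi> m in (z, (a, 0))),
      (\<lambda>(z, u). snd u))"

section \<open>Simply transitive actions of vector spaces\<close>

definition simply_transitive_action ::
  "('k \<Rightarrow> 'z \<Rightarrow> 'z) \<Rightarrow> 'z :: ab_group_add set \<Rightarrow> 'x set \<Rightarrow> ('z \<Rightarrow> 'x \<Rightarrow> 'x) \<Rightarrow> bool" where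
  "simply_transitive_action sc Z X act \<longleftrightarrow>
     0 \<in> Z \<and> (\<forall>\<eta>\<in>Z. \<forall>\<zeta>\<in>Z. \<eta> + \<zeta> \<in> Z) \<and> (\<forall>c. \<forall>\<eta>\<in>Z. sc c \<eta> \<in> Z) \<and>
     (\<forall>\<eta>\<in>Z. \<forall>x\<in>X. act \<eta> x \<in> X) \<and>
     (\<forall>x\<in>X. act 0 x = x) \<and>
     (\<forall>\<eta>\<in>Z. \<forall>\<zeta>\<in>Z. \<forall>x\<in>X. act (\<eta> + \<zeta>) x = act \<eta> (act \<zeta> x)) \<and>
     (\<forall>x\<in>X. \<forall>y\<in>X. \<exists>!\<eta>. \<eta> \<in> Z \<and> act \<eta> x = y)"

end

theory Submission
  imports Defs
begin

text \<open>
  A continuous linear section \<open>s\<close> of an extension of \<open>\<gg>\<close> by \<open>\<nn>\<close>, normalised so that \<open>ad \<circ> s\<close> induces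
  \<open>S\<close>, turns the Jacobi identity of the extension into \<open>R\<^sub>S = ad \<circ> \<omega>'\<close> and \<open>d\<^sub>S \<omega>' = 0\<close> for
  \<open>\<omega>'(x, y) = [s x, s y] - s [x, y]\<close>; conversely every such \<open>\<omega>'\<close> defines an extension on
  \<open>\<nn> \<times> \<gg>\<close>. As \<open>\<omega>'\<close> and \<open>\<omega>\<close> differ by a cochain with central values, such an \<open>\<omega>'\<close> exists iff
  \<open>d\<^sub>S \<omega>\<close> is a coboundary. The same argument, applied to the extension on \<open>\<nn> \<times> \<gg>\<close> regarded as an
  abelian extension of \<open>\<gg>\<^sup>S\<close> by \<open>\<zz>(\<nn>)\<close> with the section \<open>(a, x) \<mapsto> (\<Psi>(0, a), x)\<close>, yields the cocycle
  in \<open>Z\<^sup>2(\<gg>\<^sup>S, \<zz>(\<nn>))\<^sub>\<theta>\<close>. An equivalence between two such extensions fixes \<open>\<nn>\<close> and commutes with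
  the action on it, hence is a shear by a map \<open>\<gg> \<rightarrow> \<zz>(\<nn>)\<close>.
\<close>

section \<open>Topological vector spaces\<close>

text \<open>One construction serves at two levels. \<open>twisted_sum\<close> is
  \<open>crossed_sum\<close> over an abelian kernel with a genuine representation, where every
  2-cochain is a curvature form; so the results on factor sets apply both to \<open>n\<close> inside
  an extension of \<open>g\<close> and to its center inside an extension of g^S. Three facts link
  the levels. The map \<open>\<lambda>a. \<Psi> (0, a)\<close> is a continuous linear section of
  \<open>ad\<close>; it supplies the continuity that a mere choice of representatives cannot give.
  An element of g^S is determined by its component in \<open>g\<close> and its action on
  \<open>n\<close>, so the Jacobi identity in g^S becomes an identity between operators, in which
  the central values of d_S \<omega> do not show. The \<theta>-condition prescribes a cocycle on
  every pair with an argument from \<open>n_ad\<close>, so the difference of two such cocycles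
  depends only on the components in \<open>g\<close>.\<close>

lemma openin_quot_topology:
  "openin (quot_topology X f) U \<longleftrightarrow> U \<subseteq> f ` topspace X \<and> openin X {x \<in> topspace X. f x \<in> U}"
proof -
  have "istopology (\<lambda>U. U \<subseteq> f ` topspace X \<and> openin X {x \<in> topspace X. f x \<in> U})"
    unfolding istopology_def
  proof (intro conjI allI impI)
    fix U V
    assume U: "U \<subseteq> f ` topspace X \<and> openin X {x \<in> topspace X. f x \<in> U}"
      and V: "V \<subseteq> f ` topspace X \<and> openin X {x \<in> topspace X. f x \<in> V}"
    have "{x \<in> topspace X. f x \<in> U \<inter> V} = {x \<in> topspace X. f x \<in> U} \<inter> {x \<in> topspace X. f x \<in> V}"
      by auto
    then show "openin X {x \<in> topspace X. f x \<in> U \<inter> V}"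
      using openin_Int[OF conjunct2[OF U] conjunct2[OF V]] by (simp only:)
    show "U \<inter> V \<subseteq> f ` topspace X"
      using U by blast
  next
    fix K
    assume K: "\<forall>U\<in>K. U \<subseteq> f ` topspace X \<and> openin X {x \<in> topspace X. f x \<in> U}"
    have "{x \<in> topspace X. f x \<in> \<Union>K} = (\<Union>U\<in>K. {x \<in> topspace X. f x \<in> U})"
      by auto
    moreover have "openin X (\<Union>U\<in>K. {x \<in> topspace X. f x \<in> U})"
      by (rule openin_Union) (use K in blast)
    ultimately show "openin X {x \<in> topspace X. f x \<in> \<Union>K}"
      by (simp only:)
    show "\<Union>K \<subseteq> f ` topspace X"
      using K by blast
  qed
  then show ?thesis
    by (simp add: quot_topology_def)
qed

lemma topspace_quot_topology [simp]: "topspace (quot_topology X f) = f ` topspace X"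
proof (rule antisym)
  show "topspace (quot_topology X f) \<subseteq> f ` topspace X"
    using openin_topspace[of "quot_topology X f"] unfolding openin_quot_topology by blast
  have "{x \<in> topspace X. f x \<in> f ` topspace X} = topspace X"
    by blast
  then have "openin (quot_topology X f) (f ` topspace X)"
    by (simp add: openin_quot_topology)
  then show "f ` topspace X \<subseteq> topspace (quot_topology X f)"
    by (rule openin_subset)
qed

lemma continuous_map_to_quot_topology: "continuous_map X (quot_topology X f) f"
  by (auto simp: continuous_map_def openin_quot_topology)

lemma continuous_map_from_quot_topology:
  assumes "continuous_map X Y (\<lambda>x. h (f x))"
  shows "continuous_map (quot_topology X f) Y h"
proof -
  have "{x \<in> topspace X. f x \<in> f ` topspace X \<and> h (f x) \<in> U} = {x \<in> topspace X. h (f x) \<in> U}" for U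
    by auto
  then show ?thesis
    using assms by (auto simp: continuous_map_def openin_quot_topology)
qed

lemma continuous_map_compose_pair:
  assumes "continuous_map (prod_topology X Y) Z (\<lambda>(x, y). \<beta> x y)"
    and "continuous_map T X \<phi>" and "continuous_map T Y \<psi>"
  shows "continuous_map T Z (\<lambda>t. \<beta> (\<phi> t) (\<psi> t))"
  using continuous_map_compose[OF continuous_map_pairedI[OF assms(2,3)] assms(1)] by (simp add: o_def)

lemma continuous_map_compose_fun:
  "continuous_map Y Z h \<Longrightarrow> continuous_map X Y f \<Longrightarrow> continuous_map X Z (\<lambda>x. h (f x))"
  using continuous_map_compose[of X Y f Z h] by (simp add: o_def)

text \<open>On the image, \<open>inv_into\<close> is the inverse of the homeomorphism onto it.
  Factor sets owe their continuity to this fact, as their values are pulled back from the extension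
  to its kernel.\<close>

lemma embedding_map_inv_into_continuous:
  assumes "embedding_map X Y \<iota>" and "continuous_map T Y \<phi>" and "\<phi> ` topspace T \<subseteq> \<iota> ` topspace X"
  shows "continuous_map T X (\<lambda>t. inv_into (topspace X) \<iota> (\<phi> t))"
proof -
  let ?Z = "subtopology Y (\<iota> ` topspace X)"
  obtain r where r: "homeomorphic_maps X ?Z \<iota> r"
    using assms(1) unfolding embedding_map_def homeomorphic_map_maps by blast
  have inj: "inj_on \<iota> (topspace X)"
    using assms(1) by (simp add: embedding_map_def homeomorphic_map_def)
  have "continuous_map T ?Z \<phi>"
    using assms(2,3) by (auto simp: continuous_map_in_subtopology)
  then have "continuous_map T X (\<lambda>t. r (\<phi> t))"
    using r by (intro continuous_map_compose_fun[of ?Z X r T \<phi>]) (simp_all add: homeomorphic_maps_def)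
  moreover have "r (\<phi> t) = inv_into (topspace X) \<iota> (\<phi> t)" if "t \<in> topspace T" for t
  proof -
    obtain x where "x \<in> topspace X" "\<phi> t = \<iota> x"
      using assms(3) \<open>t \<in> topspace T\<close> by blast
    then show ?thesis
      using r inj by (simp add: homeomorphic_maps_def)
  qed
  ultimately show ?thesis
    by (rule continuous_map_eq)
qed

lemma lie_iso_inv_into_continuous:
  assumes "lie_iso L M \<Phi>"
  shows "continuous_map (vtop M) (vtop L) (inv_into (carr L) \<Phi>)"
proof -
  have "embedding_map (vtop L) (vtop M) \<Phi>" and "\<Phi> ` carr L = carr M"
    using assms
    by (auto simp: lie_iso_def homeomorphic_map_def embedding_map_def quotient_map_def)
  then show ?thesis
    using embedding_map_inv_into_continuous[of "vtop L" "vtop M" \<Phi> "vtop M" id]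
    by (simp add: id_def)
qed

section \<open>Consequences of the axioms on the carrier\<close>

context topological_vector_space
begin

lemma scale_zero_left: "x \<in> carr V \<Longrightarrow> vscale V 0 x = 0"
  using scale_add_left[of x 0 0] by simp

lemma scale_zero_right: "vscale V c 0 = 0"
  using scale_add_right[OF zero_closed zero_closed, of c] by simp

lemma uminus_eq_scale: "x \<in> carr V \<Longrightarrow> - x = vscale V (- 1) x"
  using scale_add_left[of x 1 "- 1"] by (intro minus_unique) (simp add: scale_zero_left scale_one)

lemma uminus_closed: "x \<in> carr V \<Longrightarrow> - x \<in> carr V"
  by (simp add: uminus_eq_scale scale_closed)

lemma diff_closed: "\<lbrakk>x \<in> carr V; y \<in> carr V\<rbrakk> \<Longrightarrow> x - y \<in> carr V"
  using add_closed[of x "- y"] by (simp add: uminus_closed)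

lemma scale_minus_right: "x \<in> carr V \<Longrightarrow> vscale V c (- x) = - vscale V c x"
  using scale_add_right[of x "- x" c] by (simp add: uminus_closed scale_zero_right eq_neg_iff_add_eq_0 add.commute)

lemma scale_diff_right:
  "\<lbrakk>x \<in> carr V; y \<in> carr V\<rbrakk> \<Longrightarrow> vscale V c (x - y) = vscale V c x - vscale V c y"
  using scale_add_right[of x "- y" c] by (simp add: uminus_closed scale_minus_right)

lemmas closed = zero_closed add_closed scale_closed uminus_closed diff_closed

lemma continuous_map_plus:
  "\<lbrakk>continuous_map X (vtop V) \<phi>; continuous_map X (vtop V) \<psi>\<rbrakk> \<Longrightarrow> continuous_map X (vtop V) (\<lambda>t. \<phi> t + \<psi> t)"
  by (rule continuous_map_compose_pair[OF continuous_add])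

lemma continuous_map_vscale:
  "\<lbrakk>continuous_map X euclidean c; continuous_map X (vtop V) \<phi>\<rbrakk> \<Longrightarrow> continuous_map X (vtop V) (\<lambda>t. vscale V (c t) (\<phi> t))"
  by (rule continuous_map_compose_pair[OF continuous_scale])

text \<open>Negation is scaling by -1, so its continuity is part of that of the scalar action. The
  equation holds on the carrier only, hence the detour through
  \<open>continuous_map_eq\<close>.\<close>

lemma continuous_map_uminus:
  assumes "continuous_map X (vtop V) \<phi>"
  shows "continuous_map X (vtop V) (\<lambda>t. - \<phi> t)"
proof -
  have "\<phi> t \<in> carr V" if "t \<in> topspace X" for t
    using assms that by (auto simp: continuous_map_def)
  then show ?thesis
    using continuous_map_eq[OF continuous_map_vscale[of X "\<lambda>_. - 1", OF _ assms]]
    by (simp add: uminus_eq_scale)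
qed

lemma continuous_map_minus:
  "\<lbrakk>continuous_map X (vtop V) \<phi>; continuous_map X (vtop V) \<psi>\<rbrakk> \<Longrightarrow> continuous_map X (vtop V) (\<lambda>t. \<phi> t - \<psi> t)"
  using continuous_map_plus[OF _ continuous_map_uminus] by simp

end

lemma continuous_linearD:
  assumes "continuous_linear V W \<phi>"
  shows continuous_linear_continuous: "continuous_map (vtop V) (vtop W) \<phi>"
    and continuous_linear_closed: "x \<in> carr V \<Longrightarrow> \<phi> x \<in> carr W"
    and continuous_linear_add: "\<lbrakk>x \<in> carr V; y \<in> carr V\<rbrakk> \<Longrightarrow> \<phi> (x + y) = \<phi> x + \<phi> y"
    and continuous_linear_scale: "x \<in> carr V \<Longrightarrow> \<phi> (vscale V c x) = vscale W c (\<phi> x)"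
  using assms by (auto simp: continuous_linear_def continuous_map_def)

context topological_vector_space
begin

lemma continuous_linear_zero: "continuous_linear V W \<phi> \<Longrightarrow> \<phi> 0 = 0"
  using continuous_linear_add[of V W \<phi> 0 0] by (simp add: zero_closed)

lemma continuous_linear_minus: "\<lbrakk>continuous_linear V W \<phi>; x \<in> carr V\<rbrakk> \<Longrightarrow> \<phi> (- x) = - \<phi> x"
  using continuous_linear_add[of V W \<phi> x "- x"]
  by (simp add: uminus_closed continuous_linear_zero eq_neg_iff_add_eq_0 add.commute)

lemma continuous_linear_diff:
  "\<lbrakk>continuous_linear V W \<phi>; x \<in> carr V; y \<in> carr V\<rbrakk> \<Longrightarrow> \<phi> (x - y) = \<phi> x - \<phi> y"
  using continuous_linear_add[of V W \<phi> x "- y"] by (simp add: uminus_closed continuous_linear_minus)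

end

lemma continuous_linear_compose:
  assumes "continuous_linear V W \<psi>" and "continuous_linear U V \<phi>"
  shows "continuous_linear U W (\<lambda>x. \<psi> (\<phi> x))"
proof -
  have "continuous_map (vtop U) (vtop W) (\<lambda>x. \<psi> (\<phi> x))"
    using assms continuous_map_compose_fun[of "vtop V" "vtop W" \<psi> "vtop U" \<phi>]
    by (simp add: continuous_linear_def)
  moreover have "\<phi> x \<in> carr V" if "x \<in> carr U" for x
    using assms(2) that by (rule continuous_linear_closed)
  ultimately show ?thesis
    using assms by (auto simp: continuous_linear_def)
qed

lemma continuous_bilinearD:
  assumes "continuous_bilinear U V W \<beta>"
  shows continuous_bilinear_continuous: "continuous_map (prod_topology (vtop U) (vtop V)) (vtop W) (\<lambda>(u, v). \<beta> u v)"
    and continuous_bilinear_closed: "\<lbrakk>u \<in> carr U; v \<in> carr V\<rbrakk> \<Longrightarrow> \<beta> u v \<in> carr W"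
    and continuous_bilinear_add_left: "\<lbrakk>u \<in> carr U; u' \<in> carr U; v \<in> carr V\<rbrakk> \<Longrightarrow> \<beta> (u + u') v = \<beta> u v + \<beta> u' v"
    and continuous_bilinear_add_right: "\<lbrakk>u \<in> carr U; v \<in> carr V; v' \<in> carr V\<rbrakk> \<Longrightarrow> \<beta> u (v + v') = \<beta> u v + \<beta> u v'"
    and continuous_bilinear_scale_left: "\<lbrakk>u \<in> carr U; v \<in> carr V\<rbrakk> \<Longrightarrow> \<beta> (vscale U c u) v = vscale W c (\<beta> u v)"
    and continuous_bilinear_scale_right: "\<lbrakk>u \<in> carr U; v \<in> carr V\<rbrakk> \<Longrightarrow> \<beta> u (vscale V c v) = vscale W c (\<beta> u v)"
  using assms by (auto simp: continuous_bilinear_def continuous_map_def Pi_iff)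

context topological_lie_algebra
begin

lemma bracket_zero_left: "y \<in> carr L \<Longrightarrow> lbr L 0 y = 0"
  using bracket_add_left[of 0 0 y] by (simp add: zero_closed)

lemma bracket_zero_right: "y \<in> carr L \<Longrightarrow> lbr L y 0 = 0"
  using bracket_add_right[of y 0 0] by (simp add: zero_closed)

lemma bracket_minus_left: "\<lbrakk>x \<in> carr L; y \<in> carr L\<rbrakk> \<Longrightarrow> lbr L (- x) y = - lbr L x y"
  using bracket_add_left[of x "- x" y]
  by (simp add: uminus_closed bracket_zero_left eq_neg_iff_add_eq_0 add.commute)

lemma bracket_minus_right: "\<lbrakk>x \<in> carr L; y \<in> carr L\<rbrakk> \<Longrightarrow> lbr L x (- y) = - lbr L x y"
  using bracket_add_right[of x y "- y"]
  by (simp add: uminus_closed bracket_zero_right eq_neg_iff_add_eq_0 add.commute)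

lemma bracket_diff_left:
  "\<lbrakk>x \<in> carr L; y \<in> carr L; z \<in> carr L\<rbrakk> \<Longrightarrow> lbr L (x - y) z = lbr L x z - lbr L y z"
  using bracket_add_left[of x "- y" z] by (simp add: uminus_closed bracket_minus_left)

lemma bracket_diff_right:
  "\<lbrakk>x \<in> carr L; y \<in> carr L; z \<in> carr L\<rbrakk> \<Longrightarrow> lbr L x (y - z) = lbr L x y - lbr L x z"
  using bracket_add_right[of x y "- z"] by (simp add: uminus_closed bracket_minus_right)

lemma bracket_swap: "\<lbrakk>x \<in> carr L; y \<in> carr L\<rbrakk> \<Longrightarrow> lbr L y x = - lbr L x y"
proof -
  assume xy: "x \<in> carr L" "y \<in> carr L"
  then have "0 = lbr L (x + y) (x + y)"
    by (simp add: bracket_self add_closed)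
  also have "\<dots> = lbr L x y + lbr L y x"
    by (simp only: bracket_add_left bracket_add_right bracket_self[OF xy(1)] bracket_self[OF xy(2)]
        xy add_closed add_0_left add_0_right add.commute)
  finally show ?thesis
    by (metis minus_unique)
qed

lemmas bracket_linear = bracket_add_left bracket_add_right bracket_diff_left bracket_diff_right
  bracket_minus_left bracket_minus_right bracket_zero_left bracket_zero_right

lemma continuous_map_bracket:
  "\<lbrakk>continuous_map X (vtop L) \<phi>; continuous_map X (vtop L) \<psi>\<rbrakk> \<Longrightarrow> continuous_map X (vtop L) (\<lambda>t. lbr L (\<phi> t) (\<psi> t))"
  by (rule continuous_map_compose_pair[OF continuous_bracket])

end

text \<open>Stated for any record with the product topology and componentwise scaling, so that it
  covers \<open>crossed_sum\<close> and \<open>g_S\<close> alike.\<close>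

lemma topological_vector_space_prod:
  assumes V: "topological_vector_space V" and W: "topological_vector_space W"
    and top: "vtop P = prod_topology (vtop V) (vtop W)"
    and scale: "vscale P = (\<lambda>c (x, y). (vscale V c x, vscale W c y))"
  shows "topological_vector_space P"
proof -
  interpret V: topological_vector_space V by (rule V)
  interpret W: topological_vector_space W by (rule W)
  let ?P = "prod_topology (vtop V) (vtop W)"
  have c1: "continuous_map (prod_topology T ?P) (vtop V) (\<lambda>t. fst (snd t))" 
    "continuous_map (prod_topology T ?P) (vtop W) (\<lambda>t. snd (snd t))" for T :: "'x topology"
    by (rule continuous_map_compose_fun[OF continuous_map_fst continuous_map_snd]
             continuous_map_compose_fun[OF continuous_map_snd continuous_map_snd])+
  have c2: "continuous_map (prod_topology ?P T) (vtop V) (\<lambda>t. fst (fst t))" 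
    "continuous_map (prod_topology ?P T) (vtop W) (\<lambda>t. snd (fst t))" for T :: "'x topology"
    by (rule continuous_map_compose_fun[OF continuous_map_fst continuous_map_fst]
             continuous_map_compose_fun[OF continuous_map_snd continuous_map_fst])+
  have "continuous_map (prod_topology ?P ?P) ?P (\<lambda>t. (fst (fst t) + fst (snd t), snd (fst t) + snd (snd t)))"
    by (intro continuous_map_pairedI V.continuous_map_plus W.continuous_map_plus c1 c2)
  then have cadd: "continuous_map (prod_topology (vtop P) (vtop P)) (vtop P) (\<lambda>(x, y). x + y)"
    by (simp add: top case_prod_unfold plus_prod_def)
  have "continuous_map (prod_topology euclidean ?P) ?P (\<lambda>t. (vscale V (fst t) (fst (snd t)), vscale W (fst t) (snd (snd t))))"
    by (intro continuous_map_pairedI V.continuous_map_vscale W.continuous_map_vscale c1 continuous_map_fst)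
  then have cscale: "continuous_map (prod_topology euclidean (vtop P)) (vtop P) (\<lambda>(c, x). vscale P c x)"
    by (simp add: top scale case_prod_unfold)
  show ?thesis
    by unfold_locales
      (use cadd cscale V.Hausdorff W.Hausdorff in \<open>auto simp: top scale zero_prod_def V.closed W.closed
         V.scale_add_right V.scale_add_left V.scale_scale V.scale_one
         W.scale_add_right W.scale_add_left W.scale_scale W.scale_one Hausdorff_space_prod_topology\<close>)
qed

subsection \<open>Topologically split kernels\<close>

text \<open>The cosets of the kernel are the fibres of \<open>q\<close>, so
  \<open>\<lambda>e. s (q e)\<close> factors through the quotient and is the required section; the
  splitting map has the inverse e \<mapsto> (e - s (q e), e + W).\<close>

lemma topologically_split_kernel:
  assumes E: "topological_vector_space E" and G: "topological_vector_space G"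
    and q: "continuous_linear E G q" and s: "continuous_linear G E s"
    and qs: "\<And>x. x \<in> carr G \<Longrightarrow> q (s x) = x"
  shows "topologically_split E {e \<in> carr E. q e = 0}"
proof -
  interpret E: topological_vector_space E by (rule E)
  interpret G: topological_vector_space G by (rule G)
  define W where "W = {e \<in> carr E. q e = 0}"
  have q_closed: "q e \<in> carr G" if "e \<in> carr E" for e
    using q that by (rule continuous_linear_closed)
  have s_closed: "s x \<in> carr E" if "x \<in> carr G" for x
    using s that by (rule continuous_linear_closed)
  have subspace: "linear_subspace E W"
    by (auto simp: linear_subspace_def W_def E.closed E.continuous_linear_zero[OF q] continuous_linear_add[OF q]
          continuous_linear_scale[OF q] G.scale_zero_right)
  have "closedin (vtop G) {0}"
    by (simp add: G.Hausdorff Hausdorff_imp_t1_space closedin_t1_singleton G.zero_closed)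
  then have "closedin (vtop E) {e \<in> carr E. q e \<in> {0}}"
    by (rule closedin_continuous_map_preimage[OF continuous_linear_continuous[OF q]])
  then have closed: "closedin (vtop E) W"
    by (simp add: W_def)
  \<comment> \<open>Any representative will do, since \<open>q\<close> is constant on a coset;
    \<open>\<sigma>_coset\<close> removes the choice.\<close>
  define \<sigma> where "\<sigma> X = s (q (SOME v. v \<in> X))" for X
  have \<sigma>_coset: "\<sigma> (coset W e) = s (q e)" if e: "e \<in> carr E" for e
  proof -
    have "e \<in> coset W e"
      using subspace by (auto simp: coset_def linear_subspace_def image_iff intro: bexI[of _ 0])
    then have "(SOME v. v \<in> coset W e) \<in> coset W e"
      by (rule someI)
    then obtain w where "w \<in> W" "(SOME v. v \<in> coset W e) = e + w"
      by (auto simp: coset_def)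
    then show ?thesis
      using e by (simp add: \<sigma>_def W_def continuous_linear_add[OF q])
  qed
  have coset_eq: "coset W x = coset W y" if xy: "x \<in> carr E" "y \<in> carr E" "q x = q y" for x y
  proof -
    have "coset W x \<subseteq> coset W y" if "x \<in> carr E" "y \<in> carr E" "q x = q y" for x y
    proof
      fix v assume "v \<in> coset W x"
      then obtain w where "w \<in> W" "v = x + w"
        by (auto simp: coset_def)
      then have "v = y + (x - y + w)" "x - y + w \<in> W"
        using that by (auto simp: W_def E.closed continuous_linear_add[OF q] E.continuous_linear_diff[OF q])
      then show "v \<in> coset W y"
        unfolding coset_def by blast
    qed
    then show ?thesis
      using xy by (metis subset_antisym)
  qed
  let ?Q = "quot_topology (vtop E) (coset W)"
  have c\<sigma>: "continuous_map ?Q (vtop E) \<sigma>"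
  proof (rule continuous_map_from_quot_topology)
    have "continuous_map (vtop E) (vtop E) (\<lambda>e. s (q e))"
      by (rule continuous_linear_continuous[OF continuous_linear_compose[OF s q]])
    then show "continuous_map (vtop E) (vtop E) (\<lambda>e. \<sigma> (coset W e))"
      by (rule continuous_map_eq) (simp add: \<sigma>_coset)
  qed
  have homeo: "homeomorphic_maps (prod_topology (subtopology (vtop E) W) ?Q) (vtop E)
      (\<lambda>(w, X). w + \<sigma> X) (\<lambda>e. (e - s (q e), coset W e))"
    unfolding homeomorphic_maps_def
  proof (intro conjI)
    let ?P = "prod_topology (subtopology (vtop E) W) ?Q"
    have "continuous_map ?P (vtop E) (\<lambda>t. fst t + \<sigma> (snd t))"
      by (intro E.continuous_map_plus continuous_map_compose_fun[OF c\<sigma>] continuous_map_snd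
          continuous_map_into_fulltopology[OF continuous_map_fst])
    then show "continuous_map ?P (vtop E) (\<lambda>(w, X). w + \<sigma> X)"
      by (simp add: case_prod_unfold)
    have "continuous_map (vtop E) (vtop E) (\<lambda>e. e - s (q e))"
      by (intro E.continuous_map_minus continuous_linear_continuous[OF continuous_linear_compose[OF s q]])
         (auto simp: id_def[symmetric])
    moreover have "e - s (q e) \<in> W" if "e \<in> carr E" for e
      using that by (simp add: W_def E.closed q_closed s_closed qs E.continuous_linear_diff[OF q])
    ultimately show "continuous_map (vtop E) ?P (\<lambda>e. (e - s (q e), coset W e))"
      by (auto intro!: continuous_map_pairedI continuous_map_to_quot_topology simp: continuous_map_in_subtopology)
    show "\<forall>x\<in>topspace ?P. (\<lambda>e. (e - s (q e), coset W e)) ((\<lambda>(w, X). w + \<sigma> X) x) = x"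
    proof
      fix t assume "t \<in> topspace ?P"
      then obtain w e where w: "w \<in> carr E" "w \<in> W" and e: "e \<in> carr E" and t: "t = (w, coset W e)"
        by auto
      have [simp]: "q w = 0" using w by (simp add: W_def)
      have qe: "q (w + s (q e)) = q e"
        using w e by (simp add: continuous_linear_add[OF q] q_closed s_closed qs)
      have "coset W (w + s (q e)) = coset W e"
        by (rule coset_eq) (use w e qe in \<open>simp_all add: q_closed s_closed E.closed\<close>)
      with qe show "(\<lambda>e. (e - s (q e), coset W e)) ((\<lambda>(w, X). w + \<sigma> X) t) = t"
        using w e by (simp add: t \<sigma>_coset)
    qed
    show "\<forall>y\<in>carr E. (\<lambda>(w, X). w + \<sigma> X) (y - s (q y), coset W y) = y"
      by (simp add: \<sigma>_coset)
  qed
  have "coset W (\<sigma> (coset W x)) = coset W x" if "x \<in> carr E" for x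
    using that coset_eq[of "s (q x)" x] by (simp add: \<sigma>_coset q_closed s_closed qs)
  moreover have "\<sigma> (coset W (x + y)) = \<sigma> (coset W x) + \<sigma> (coset W y)" if "x \<in> carr E" "y \<in> carr E" for x y
    using that by (simp add: \<sigma>_coset E.closed continuous_linear_add[OF q] continuous_linear_add[OF s] q_closed)
  moreover have "\<sigma> (coset W (vscale E c x)) = vscale E c (\<sigma> (coset W x))" if "x \<in> carr E" for c x
    using that by (simp add: \<sigma>_coset E.closed continuous_linear_scale[OF q] continuous_linear_scale[OF s] q_closed)
  moreover have "homeomorphic_map (prod_topology (subtopology (vtop E) W) ?Q) (vtop E) (\<lambda>(w, X). w + \<sigma> X)"
    using homeo homeomorphic_map_maps by blast
  ultimately show ?thesis
    using subspace closed c\<sigma> unfolding topologically_split_def W_def[symmetric] by blast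
qed

section \<open>Cochains of low degree\<close>

lemma tuples_1: "xs \<in> tuples 1 L \<longleftrightarrow> (\<exists>x\<in>carr L. xs = [x])"
  by (auto simp: tuples_def length_Suc_conv)

lemma tuples_2: "xs \<in> tuples 2 L \<longleftrightarrow> (\<exists>x\<in>carr L. \<exists>y\<in>carr L. xs = [x, y])"
  by (auto simp: tuples_def length_Suc_conv numeral_2_eq_2)

lemma tuples_3: "xs \<in> tuples 3 L \<longleftrightarrow> (\<exists>x\<in>carr L. \<exists>y\<in>carr L. \<exists>z\<in>carr L. xs = [x, y, z])"
  by (auto simp: tuples_def length_Suc_conv numeral_3_eq_3)

lemma cochains_1_iff:
  "\<alpha> \<in> cochains 1 L V \<longleftrightarrow>
     (\<forall>xs. xs \<notin> tuples 1 L \<longrightarrow> \<alpha> xs = 0) \<and> continuous_linear L V (\<lambda>x. \<alpha> [x])"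
proof -
  let ?P = "product_topology (\<lambda>_. vtop L) {..<1::nat}"
  have "continuous_map ?P (vtop V) (\<lambda>x. \<alpha> (map x [0..<1])) \<longleftrightarrow>
        continuous_map (vtop L) (vtop V) (\<lambda>x. \<alpha> [x])" (is "?A \<longleftrightarrow> ?B")
  proof
    assume ?A
    \<comment> \<open>Points of \<open>product_topology\<close> are extensional functions, hence the
      restricted abstraction.\<close>
    moreover have "continuous_map (vtop L) ?P (\<lambda>x. \<lambda>i\<in>{..<1}. x)"
      by (auto simp: continuous_map_componentwise id_def[symmetric])
    ultimately have "continuous_map (vtop L) (vtop V) (\<lambda>x. \<alpha> (map (\<lambda>i\<in>{..<1::nat}. x) [0..<1]))"
      by (rule continuous_map_compose_fun)
    then show ?B
      by simp
  next
    assume ?B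
    moreover have "continuous_map ?P (vtop L) (\<lambda>x. x 0)"
      by (rule continuous_map_product_projection) simp
    ultimately have "continuous_map ?P (vtop V) (\<lambda>x. \<alpha> [x 0])"
      by (rule continuous_map_compose_fun)
    then show ?A
      by simp
  qed
  moreover have "(\<forall>xs\<in>tuples 1 L. P xs) \<longleftrightarrow> (\<forall>x\<in>carr L. P [x])" for P
    unfolding Ball_def tuples_1 by blast
  ultimately show ?thesis
    unfolding cochains_def continuous_linear_def mem_Collect_eq by auto
qed

text \<open>The continuity clause of \<open>cochains\<close> concerns tuples indexed by
  \<open>{..<2}\<close>, that of a bilinear map concerns pairs; explicit continuous maps carry
  either space into the other. The clauses over positions reduce to the positions 0 and 1.\<close>

lemma cochains_2_iff:
  "\<alpha> \<in> cochains 2 L V \<longleftrightarrow>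
     (\<forall>xs. xs \<notin> tuples 2 L \<longrightarrow> \<alpha> xs = 0) \<and> continuous_bilinear L L V (\<lambda>x y. \<alpha> [x, y]) \<and>
     (\<forall>x\<in>carr L. \<alpha> [x, x] = 0)"
proof -
  let ?P = "product_topology (\<lambda>_. vtop L) {..<2::nat}"
  have upt: "[0..<2] = [0, Suc 0]"
    by (simp add: numeral_2_eq_2)
  have "continuous_map ?P (vtop V) (\<lambda>x. \<alpha> (map x [0..<2])) \<longleftrightarrow>
        continuous_map (prod_topology (vtop L) (vtop L)) (vtop V) (\<lambda>(x, y). \<alpha> [x, y])" (is "?A \<longleftrightarrow> ?B")
  proof
    assume ?A
    moreover have "continuous_map (prod_topology (vtop L) (vtop L)) ?P
        (\<lambda>t. \<lambda>i\<in>{..<2}. if i = 0 then fst t else snd t)"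
      by (auto simp: continuous_map_componentwise continuous_map_fst continuous_map_snd
          split: if_splits)
    ultimately have "continuous_map (prod_topology (vtop L) (vtop L)) (vtop V)
        (\<lambda>t. \<alpha> (map (\<lambda>i\<in>{..<2::nat}. if i = 0 then fst t else snd t) [0..<2]))"
      by (rule continuous_map_compose_fun)
    then show ?B
      by (simp add: upt case_prod_unfold)
  next
    assume ?B
    moreover have "continuous_map ?P (vtop L) (\<lambda>x. x 0)" "continuous_map ?P (vtop L) (\<lambda>x. x (Suc 0))"
      by (rule continuous_map_product_projection; simp)+
    ultimately have "continuous_map ?P (vtop V) (\<lambda>x. \<alpha> [x 0, x (Suc 0)])"
      by (rule continuous_map_compose_pair)
    then show ?A
      by (simp add: upt)
  qed
  moreover have "(\<forall>xs\<in>tuples 2 L. P xs) \<longleftrightarrow> (\<forall>x\<in>carr L. \<forall>y\<in>carr L. P [x, y])" for P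
    unfolding Ball_def tuples_2 by blast
  moreover have "(\<forall>i<2. P i) \<longleftrightarrow> P 0 \<and> P (Suc 0)" for P :: "nat \<Rightarrow> bool"
    by (auto simp: less_2_cases_iff)
  moreover have "i < j \<and> j < 2 \<longleftrightarrow> i = 0 \<and> j = Suc 0" for i j :: nat
    by auto
  ultimately show ?thesis
    unfolding cochains_def continuous_bilinear_def mem_Collect_eq
    apply (simp only: conj_assoc[symmetric])
    apply simp
    apply blast
    done
qed

lemma ce_diff_1:
  assumes "x \<in> carr L" and "y \<in> carr L"
  shows "ce_diff 1 L \<rho> \<alpha> [x, y] = \<rho> x (\<alpha> [y]) - \<rho> y (\<alpha> [x]) - \<alpha> [lbr L x y]"
proof -
  have "{(i, j). i < j \<and> j \<le> (1::nat)} = {(0, 1)}"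
    by auto
  then show ?thesis
    using assms by (simp add: ce_diff_def tuples_def signed_def nths_Cons)
qed

lemma ce_diff_2:
  assumes "x \<in> carr L" and "y \<in> carr L" and "z \<in> carr L"
  shows "ce_diff 2 L \<rho> \<alpha> [x, y, z] =
    \<rho> x (\<alpha> [y, z]) - \<rho> y (\<alpha> [x, z]) + \<rho> z (\<alpha> [x, y])
    - \<alpha> [lbr L x y, z] + \<alpha> [lbr L x z, y] - \<alpha> [lbr L y z, x]"
proof -
  have "{(i, j). i < j \<and> j \<le> (2::nat)} = {(0, 1), (0, 2), (1, 2)}"
    by auto
  moreover have "{..2::nat} = {0, 1, 2}"
    by auto
  ultimately show ?thesis
    using assms by (simp add: ce_diff_def tuples_def signed_def nths_Cons)
qed

lemma ce_diff_outside: "xs \<notin> tuples (Suc p) L \<Longrightarrow> ce_diff p L \<rho> \<alpha> xs = 0"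
  by (simp add: ce_diff_def)

lemma cochains_2_outside: "\<lbrakk>\<eta> \<in> cochains 2 L V; xs \<notin> tuples 2 L\<rbrakk> \<Longrightarrow> \<eta> xs = 0"
  by (simp add: cochains_2_iff)

lemma ce_diff_2_outside: "xs \<notin> tuples 3 L \<Longrightarrow> ce_diff 2 L \<rho> \<alpha> xs = 0"
  using ce_diff_outside[of xs 2 L] by simp

lemma ce_diff_2_eq_0_iff:
  "ce_diff 2 L \<rho> \<alpha> = 0 \<longleftrightarrow>
    (\<forall>x\<in>carr L. \<forall>y\<in>carr L. \<forall>z\<in>carr L. ce_diff 2 L \<rho> \<alpha> [x, y, z] = 0)"
proof
  assume R: "\<forall>x\<in>carr L. \<forall>y\<in>carr L. \<forall>z\<in>carr L. ce_diff 2 L \<rho> \<alpha> [x, y, z] = 0"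
  show "ce_diff 2 L \<rho> \<alpha> = 0"
  proof
    fix xs show "ce_diff 2 L \<rho> \<alpha> xs = 0 xs"
      using R tuples_3[of xs L] ce_diff_outside[of xs 2 L \<rho> \<alpha>]
      by (cases "xs \<in> tuples 3 L") auto
  qed
qed simp

section \<open>Crossed sums\<close>

text \<open>The bracket is the one that (m, x) \<mapsto> \<iota> m + s x pulls back from an
  extension whose section s induces \<open>S\<close> and has factor set \<omega>.\<close>

definition crossed_sum ::
  "('k, 'n :: ab_group_add) tla \<Rightarrow> ('k, 'g :: ab_group_add) tla \<Rightarrow> ('g \<Rightarrow> 'n \<Rightarrow> 'n) \<Rightarrow>
   ('g list \<Rightarrow> 'n) \<Rightarrow> ('k, 'n \<times> 'g) tla" where
  "crossed_sum n g S \<omega> =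
     \<lparr>vtop = prod_topology (vtop n) (vtop g),
      vscale = (\<lambda>c (m, x). (vscale n c m, vscale g c x)),
      lbr = (\<lambda>(m, x) (m', x'). (lbr n m m' + S x m' - S x' m + \<omega> [x, x'], lbr g x x'))\<rparr>"

lemma crossed_sum_simps [simp]:
  "vtop (crossed_sum n g S \<omega>) = prod_topology (vtop n) (vtop g)"
  "vscale (crossed_sum n g S \<omega>) c (m, x) = (vscale n c m, vscale g c x)"
  "lbr (crossed_sum n g S \<omega>) (m, x) (m', x') = (lbr n m m' + S x m' - S x' m + \<omega> [x, x'], lbr g x x')"
  by (simp_all add: crossed_sum_def)

text \<open>\<omega> is a parameter because the locale is interpreted several times over: with other
  curvature forms of the same \<open>S\<close>, and with the center as kernel over g^S.\<close>

locale outer_action = N: topological_lie_algebra n + G: topological_lie_algebra g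
  for n :: "('k :: topological_field, 'n :: ab_group_add) tla" and g :: "('k, 'g :: ab_group_add) tla" +
  fixes S :: "'g \<Rightarrow> 'n \<Rightarrow> 'n" and \<omega> :: "'g list \<Rightarrow> 'n"
  assumes outer: "continuous_outer_action g n S"
    and curvature_form: "curvature_form g n S \<omega>"
begin

lemma S_derivation: "x \<in> carr g \<Longrightarrow> S x \<in> derivations n"
  using outer by (simp add: continuous_outer_action_def)

lemma S_linear: "x \<in> carr g \<Longrightarrow> continuous_linear n n (S x)"
  using S_derivation by (simp add: derivations_def)

lemma S_bracket:
  "\<lbrakk>x \<in> carr g; a \<in> carr n; b \<in> carr n\<rbrakk> \<Longrightarrow> S x (lbr n a b) = lbr n (S x a) b + lbr n a (S x b)"
  using S_derivation by (simp add: derivations_def)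

lemma S_bilinear: "continuous_bilinear g n n S"
  using outer continuous_linear_add[OF S_linear] continuous_linear_scale[OF S_linear]
  by (simp add: continuous_outer_action_def continuous_bilinear_def)

lemmas S_closed = continuous_bilinear_closed[OF S_bilinear]
  and S_add_left = continuous_bilinear_add_left[OF S_bilinear]
  and S_add_right = continuous_bilinear_add_right[OF S_bilinear]
  and S_scale_left = continuous_bilinear_scale_left[OF S_bilinear]
  and S_scale_right = continuous_bilinear_scale_right[OF S_bilinear]

lemma S_zero_left: "m \<in> carr n \<Longrightarrow> S 0 m = 0"
  using S_add_left[of 0 0 m] by (simp add: G.closed)

lemma S_zero_right: "x \<in> carr g \<Longrightarrow> S x 0 = 0"
  using N.continuous_linear_zero[OF S_linear] .

lemma S_minus_right: "\<lbrakk>x \<in> carr g; m \<in> carr n\<rbrakk> \<Longrightarrow> S x (- m) = - S x m"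
  using N.continuous_linear_minus[OF S_linear] .

lemma S_diff_right: "\<lbrakk>x \<in> carr g; a \<in> carr n; b \<in> carr n\<rbrakk> \<Longrightarrow> S x (a - b) = S x a - S x b"
  using N.continuous_linear_diff[OF S_linear] .

lemma \<omega>_cochain: "\<omega> \<in> cochains 2 g n"
  using curvature_form by (simp add: curvature_form_def)

lemma \<omega>_bilinear: "continuous_bilinear g g n (\<lambda>x y. \<omega> [x, y])"
  using \<omega>_cochain by (simp add: cochains_2_iff)

lemmas \<omega>_closed = continuous_bilinear_closed[OF \<omega>_bilinear]
  and \<omega>_add_left = continuous_bilinear_add_left[OF \<omega>_bilinear]
  and \<omega>_add_right = continuous_bilinear_add_right[OF \<omega>_bilinear]
  and \<omega>_scale_left = continuous_bilinear_scale_left[OF \<omega>_bilinear]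
  and \<omega>_scale_right = continuous_bilinear_scale_right[OF \<omega>_bilinear]

lemma \<omega>_self: "x \<in> carr g \<Longrightarrow> \<omega> [x, x] = 0"
  using \<omega>_cochain by (simp add: cochains_2_iff)

lemma \<omega>_swap: "\<lbrakk>x \<in> carr g; y \<in> carr g\<rbrakk> \<Longrightarrow> \<omega> [y, x] = - \<omega> [x, y]"
proof -
  assume xy: "x \<in> carr g" "y \<in> carr g"
  then have "\<omega> [x + y, x + y] = \<omega> [x, y] + \<omega> [y, x]"
    by (simp only: \<omega>_add_left \<omega>_add_right G.add_closed \<omega>_self[of x] \<omega>_self[of y] add_0_left add_0_right add.commute)
  then show ?thesis
    using xy by (metis \<omega>_self G.add_closed minus_unique)
qed

lemma \<omega>_zero_right: "x \<in> carr g \<Longrightarrow> \<omega> [x, 0] = 0"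
  using \<omega>_add_right[of x 0 0] by (simp add: G.closed)

lemma \<omega>_minus_right: "\<lbrakk>x \<in> carr g; y \<in> carr g\<rbrakk> \<Longrightarrow> \<omega> [x, - y] = - \<omega> [x, y]"
  using \<omega>_add_right[of x y "- y"] by (simp add: G.closed \<omega>_zero_right eq_neg_iff_add_eq_0 add.commute)

lemma S_curvature:
  assumes "x \<in> carr g" and "y \<in> carr g" and "m \<in> carr n"
  shows "S (lbr g x y) m = S x (S y m) - S y (S x m) - lbr n (\<omega> [x, y]) m"
proof -
  have "curvature g n S x y m = ad n (\<omega> [x, y]) m"
    using curvature_form assms by (simp add: curvature_form_def)
  then show ?thesis
    using assms by (simp add: curvature_def commutator_def ad_def algebra_simps)
qed

lemma crossed_sum_tvs: "topological_vector_space (crossed_sum n g S \<omega>)"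
  by (rule topological_vector_space_prod[OF N.topological_vector_space_axioms G.topological_vector_space_axioms])
     (simp_all add: crossed_sum_def)

text \<open>This is the \<open>n\<close>-component of the Jacobi sum. It splits into the Jacobi sum
  of \<open>n\<close>, mixed terms that cancel cyclically because each \<open>S x\<close> is a
  derivation, and a remainder equal to d_S \<omega>.\<close>

lemma crossed_sum_jacobi:
  assumes flat: "ce_diff 2 g S \<omega> = 0"
    and m: "m1 \<in> carr n" "m2 \<in> carr n" "m3 \<in> carr n" and x: "x1 \<in> carr g" "x2 \<in> carr g" "x3 \<in> carr g"
  shows "lbr n m1 (lbr n m2 m3 + S x2 m3 - S x3 m2 + \<omega> [x2, x3])
           + S x1 (lbr n m2 m3 + S x2 m3 - S x3 m2 + \<omega> [x2, x3]) - S (lbr g x2 x3) m1 + \<omega> [x1, lbr g x2 x3]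
       + (lbr n m2 (lbr n m3 m1 + S x3 m1 - S x1 m3 + \<omega> [x3, x1])
           + S x2 (lbr n m3 m1 + S x3 m1 - S x1 m3 + \<omega> [x3, x1]) - S (lbr g x3 x1) m2 + \<omega> [x2, lbr g x3 x1])
       + (lbr n m3 (lbr n m1 m2 + S x1 m2 - S x2 m1 + \<omega> [x1, x2])
           + S x3 (lbr n m1 m2 + S x1 m2 - S x2 m1 + \<omega> [x1, x2]) - S (lbr g x1 x2) m3 + \<omega> [x3, lbr g x1 x2]) = 0"
proof -
  \<comment> \<open>The curvature term hidden in \<open>S (lbr g y z) a\<close> cancels the bracket
    of \<open>a\<close> with \<omega>(y, z), so \<omega> survives only in the last summand, whose
    cyclic sum is d_S \<omega>.\<close>
  have expand: "lbr n a (lbr n b c + S y c - S z b + \<omega> [y, z])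
           + S x (lbr n b c + S y c - S z b + \<omega> [y, z]) - S (lbr g y z) a + \<omega> [x, lbr g y z]
      = lbr n a (lbr n b c) + lbr n a (S y c) - lbr n a (S z b) - lbr n c (S x b) + lbr n b (S x c)
        + S x (S y c) - S x (S z b) - S y (S z a) + S z (S y a) + (S x (\<omega> [y, z]) + \<omega> [x, lbr g y z])"
    if "a \<in> carr n" "b \<in> carr n" "c \<in> carr n" "x \<in> carr g" "y \<in> carr g" "z \<in> carr g" for a b c x y z
    using that N.bracket_swap[of a "\<omega> [y, z]"] N.bracket_swap[of "c" "S x b"]
    by (simp add: N.bracket_linear N.closed N.bracket_closed S_closed \<omega>_closed S_bracket S_add_right S_diff_right
        S_curvature algebra_simps)
  have "ce_diff 2 g S \<omega> [x1, x2, x3] = 0"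
    using flat by simp
  then have "S x1 (\<omega> [x2, x3]) + \<omega> [x1, lbr g x2 x3] + (S x2 (\<omega> [x3, x1]) + \<omega> [x2, lbr g x3 x1])
        + (S x3 (\<omega> [x1, x2]) + \<omega> [x3, lbr g x1 x2]) = 0"
    using x \<omega>_swap[of x1 x3] \<omega>_swap[of "lbr g x2 x3" x1] \<omega>_swap[of "lbr g x1 x2" x3]
      \<omega>_swap[of "lbr g x1 x3" x2] G.bracket_swap[of x1 x3]
    by (simp add: ce_diff_2 G.bracket_closed S_minus_right \<omega>_closed \<omega>_minus_right algebra_simps)
  moreover have "lbr n m1 (lbr n m2 m3) + lbr n m2 (lbr n m3 m1) + lbr n m3 (lbr n m1 m2) = 0"
    using m by (rule N.jacobi)
  ultimately show ?thesis
    unfolding expand[OF m x] expand[OF m(2,3,1) x(2,3,1)] expand[OF m(3,1,2) x(3,1,2)]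
    by (simp add: algebra_simps add_eq_0_iff)
qed

lemma crossed_sum_tla:
  assumes "ce_diff 2 g S \<omega> = 0"
  shows "topological_lie_algebra (crossed_sum n g S \<omega>)"
proof -
  interpret C: topological_vector_space "crossed_sum n g S \<omega>"
    by (rule crossed_sum_tvs)
  let ?P = "prod_topology (vtop n) (vtop g)"
  have p: "continuous_map (prod_topology ?P ?P) (vtop n) (\<lambda>t. fst (fst t))"
    "continuous_map (prod_topology ?P ?P) (vtop g) (\<lambda>t. snd (fst t))"
    "continuous_map (prod_topology ?P ?P) (vtop n) (\<lambda>t. fst (snd t))"
    "continuous_map (prod_topology ?P ?P) (vtop g) (\<lambda>t. snd (snd t))"
    by (rule continuous_map_compose_fun[OF continuous_map_fst continuous_map_fst]
        continuous_map_compose_fun[OF continuous_map_snd continuous_map_fst]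
        continuous_map_compose_fun[OF continuous_map_fst continuous_map_snd]
        continuous_map_compose_fun[OF continuous_map_snd continuous_map_snd])+
  have cont: "continuous_map (prod_topology ?P ?P) ?P
      (\<lambda>t. (lbr n (fst (fst t)) (fst (snd t)) + S (snd (fst t)) (fst (snd t)) - S (snd (snd t)) (fst (fst t))
        + \<omega> [snd (fst t), snd (snd t)], lbr g (snd (fst t)) (snd (snd t))))"
    by (intro continuous_map_pairedI N.continuous_map_plus N.continuous_map_minus N.continuous_map_bracket
        G.continuous_map_bracket p continuous_map_compose_pair[OF continuous_bilinear_continuous[OF S_bilinear]]
        continuous_map_compose_pair[OF continuous_bilinear_continuous[OF \<omega>_bilinear]])
  show ?thesis
  proof
    let ?C = "crossed_sum n g S \<omega>"
    fix u v w :: "'n \<times> 'g" and c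
    obtain a x b y d z where uvw: "u = (a, x)" "v = (b, y)" "w = (d, z)"
      by (metis surj_pair)
    {
      assume uv: "u \<in> carr ?C" "v \<in> carr ?C"
      show "lbr ?C u v \<in> carr ?C"
        using uv by (simp add: uvw N.closed N.bracket_closed G.bracket_closed S_closed \<omega>_closed)
      show "lbr ?C (vscale ?C c u) v = vscale ?C c (lbr ?C u v)"
        using uv by (simp add: uvw N.closed N.bracket_closed S_closed \<omega>_closed N.bracket_scale_left G.bracket_scale_left
            S_scale_left S_scale_right \<omega>_scale_left N.scale_add_right N.scale_diff_right)
      show "lbr ?C u (vscale ?C c v) = vscale ?C c (lbr ?C u v)"
        using uv by (simp add: uvw N.closed N.bracket_closed S_closed \<omega>_closed N.bracket_scale_right G.bracket_scale_right
            S_scale_left S_scale_right \<omega>_scale_right N.scale_add_right N.scale_diff_right)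
    }
    {
      assume uvw': "u \<in> carr ?C" "v \<in> carr ?C" "w \<in> carr ?C"
      show "lbr ?C (u + v) w = lbr ?C u w + lbr ?C v w"
        using uvw' by (simp add: uvw N.bracket_add_left G.bracket_add_left S_add_left S_add_right \<omega>_add_left algebra_simps)
      show "lbr ?C u (v + w) = lbr ?C u v + lbr ?C u w"
        using uvw' by (simp add: uvw N.bracket_add_right G.bracket_add_right S_add_left S_add_right \<omega>_add_right algebra_simps)
      show "lbr ?C u (lbr ?C v w) + lbr ?C v (lbr ?C w u) + lbr ?C w (lbr ?C u v) = 0"
        using uvw' crossed_sum_jacobi[OF assms, of a b d x y z] by (simp add: uvw G.jacobi zero_prod_def)
    }
    show "lbr ?C u u = 0" if "u \<in> carr ?C"
      using that by (simp add: uvw N.bracket_self G.bracket_self \<omega>_self zero_prod_def)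
    show "continuous_map (prod_topology (vtop ?C) (vtop ?C)) (vtop ?C) (\<lambda>(x, y). lbr ?C x y)"
      using cont by (simp add: crossed_sum_def case_prod_unfold)
  qed
qed

end

section \<open>Extensions with a continuous linear section\<close>

lemma lie_homD:
  assumes "lie_hom L M \<phi>"
  shows lie_hom_linear: "continuous_linear L M \<phi>"
    and lie_hom_bracket: "\<lbrakk>x \<in> carr L; y \<in> carr L\<rbrakk> \<Longrightarrow> \<phi> (lbr L x y) = lbr M (\<phi> x) (\<phi> y)"
  using assms by (auto simp: lie_hom_def)

lemma lie_isoI:
  assumes "lie_hom L M \<Phi>" and "continuous_map (vtop M) (vtop L) \<Psi>"
    and "\<And>x. x \<in> carr L \<Longrightarrow> \<Psi> (\<Phi> x) = x" and "\<And>y. y \<in> carr M \<Longrightarrow> \<Phi> (\<Psi> y) = y"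
  shows "lie_iso L M \<Phi>"
proof -
  have "homeomorphic_maps (vtop L) (vtop M) \<Phi> \<Psi>"
    using assms by (auto simp: homeomorphic_maps_def lie_hom_def continuous_linear_def)
  then show ?thesis
    using assms(1) unfolding lie_iso_def homeomorphic_map_maps by blast
qed

text \<open>Brackets are easy to check for a parametrisation such as (m, x) \<mapsto> \<iota> m + s
  x but awkward for its inverse, which contains \<open>inv_into\<close>. This transfers the
  homomorphism property: \<Phi> sends both sides of each identity to the same element.\<close>

lemma lie_iso_inverse:
  assumes \<Phi>: "lie_hom L M \<Phi>" and \<Psi>: "continuous_map (vtop M) (vtop L) \<Psi>"
    and \<Psi>\<Phi>: "\<And>x. x \<in> carr L \<Longrightarrow> \<Psi> (\<Phi> x) = x" and \<Phi>\<Psi>: "\<And>y. y \<in> carr M \<Longrightarrow> \<Phi> (\<Psi> y) = y"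
    and closed: "\<And>x y. \<lbrakk>x \<in> carr L; y \<in> carr L\<rbrakk> \<Longrightarrow> x + y \<in> carr L"
      "\<And>c x. x \<in> carr L \<Longrightarrow> vscale L c x \<in> carr L"
      "\<And>x y. \<lbrakk>x \<in> carr L; y \<in> carr L\<rbrakk> \<Longrightarrow> lbr L x y \<in> carr L"
  shows "lie_iso M L \<Psi>"
proof (rule lie_isoI)
  note hom = lie_hom_bracket[OF \<Phi>] continuous_linear_add[OF lie_hom_linear[OF \<Phi>]]
    continuous_linear_scale[OF lie_hom_linear[OF \<Phi>]]
  have \<Psi>_closed: "\<Psi> y \<in> carr L" if "y \<in> carr M" for y
    using \<Psi> that by (auto simp: continuous_map_def)
  have "\<Psi> (x + y) = \<Psi> x + \<Psi> y" if "x \<in> carr M" "y \<in> carr M" for x y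
    using that \<Psi>\<Phi>[of "\<Psi> x + \<Psi> y"] by (simp add: hom \<Phi>\<Psi> \<Psi>_closed closed)
  moreover have "\<Psi> (vscale M c x) = vscale L c (\<Psi> x)" if "x \<in> carr M" for c x
    using that \<Psi>\<Phi>[of "vscale L c (\<Psi> x)"] by (simp add: hom \<Phi>\<Psi> \<Psi>_closed closed)
  moreover have "\<Psi> (lbr M x y) = lbr L (\<Psi> x) (\<Psi> y)" if "x \<in> carr M" "y \<in> carr M" for x y
    using that \<Psi>\<Phi>[of "lbr L (\<Psi> x) (\<Psi> y)"] by (simp add: hom \<Phi>\<Psi> \<Psi>_closed closed)
  ultimately show "lie_hom M L \<Psi>"
    using \<Psi> by (simp add: lie_hom_def continuous_linear_def)
  show "continuous_map (vtop L) (vtop M) \<Phi>"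
    by (rule continuous_linear_continuous[OF lie_hom_linear[OF \<Phi>]])
qed (use \<Psi>\<Phi> \<Phi>\<Psi> in auto)

lemma ext_equivalent_trans:
  assumes "ext_equivalent n X Y" and "ext_equivalent n Y Z"
  shows "ext_equivalent n X Z"
proof -
  obtain E \<iota> q E' \<iota>' q' E'' \<iota>'' q'' where X: "X = (E, \<iota>, q)" and Y: "Y = (E', \<iota>', q')" and Z: "Z = (E'', \<iota>'', q'')"
    by (metis surj_pair)
  obtain \<Phi> where \<Phi>: "lie_iso E E' \<Phi>" "\<forall>m\<in>carr n. \<Phi> (\<iota> m) = \<iota>' m" "\<forall>e\<in>carr E. q' (\<Phi> e) = q e"
    using assms(1) by (auto simp: ext_equivalent_def X Y)
  obtain \<Psi> where \<Psi>: "lie_iso E' E'' \<Psi>" "\<forall>m\<in>carr n. \<Psi> (\<iota>' m) = \<iota>'' m" "\<forall>e\<in>carr E'. q'' (\<Psi> e) = q' e"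
    using assms(2) by (auto simp: ext_equivalent_def Y Z)
  have \<Phi>_closed: "\<Phi> e \<in> carr E'" if "e \<in> carr E" for e
    using \<Phi>(1) that by (auto simp: lie_iso_def lie_hom_def intro: continuous_linear_closed)
  have "lie_iso E E'' (\<lambda>e. \<Psi> (\<Phi> e))"
    unfolding lie_iso_def lie_hom_def
  proof (intro conjI ballI)
    show "continuous_linear E E'' (\<lambda>e. \<Psi> (\<Phi> e))"
      using \<Phi>(1) \<Psi>(1) by (auto simp: lie_iso_def lie_hom_def intro: continuous_linear_compose)
    show "\<Psi> (\<Phi> (lbr E x y)) = lbr E'' (\<Psi> (\<Phi> x)) (\<Psi> (\<Phi> y))" if "x \<in> carr E" "y \<in> carr E" for x y
      using \<Phi>(1) \<Psi>(1) that by (simp add: lie_iso_def lie_hom_def \<Phi>_closed)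
    show "homeomorphic_map (vtop E) (vtop E'') (\<lambda>e. \<Psi> (\<Phi> e))"
      using \<Phi>(1) \<Psi>(1) homeomorphic_map_compose[of "vtop E" "vtop E'" \<Phi> "vtop E''" \<Psi>]
      by (simp add: lie_iso_def o_def)
  qed
  then show ?thesis
    using \<Phi>(2,3) \<Psi>(2,3) \<Phi>_closed by (auto simp: ext_equivalent_def X Z)
qed

lemma kernel_class_cong:
  assumes "\<And>x m. \<lbrakk>x \<in> carr g; m \<in> carr n\<rbrakk> \<Longrightarrow> S x m = S' x m"
  shows "kernel_class g n S = kernel_class g n S'"
  using assms by (simp add: kernel_class_def outer_equiv_def)

text \<open>A continuous left inverse \<open>r\<close> makes \<iota> an embedding, and a continuous
  section \<open>s\<close> makes \<open>q\<close> a quotient map and splits the kernel; the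
  topological clauses of \<open>split_extension\<close> thus reduce to exhibiting two maps. Since
  \<open>s\<close> induces \<open>S\<close> exactly, the kernel classes agree as well.\<close>

lemma sectioned_extension_in_extensions:
  assumes n: "topological_lie_algebra n" and g: "topological_lie_algebra g" and E: "topological_lie_algebra E"
    and \<iota>: "lie_hom n E \<iota>" and r: "continuous_map (vtop E) (vtop n) r" and r\<iota>: "\<And>m. m \<in> carr n \<Longrightarrow> r (\<iota> m) = m"
    and q: "lie_hom E g q" and s: "continuous_linear g E s" and qs: "\<And>x. x \<in> carr g \<Longrightarrow> q (s x) = x"
    and ker: "{e \<in> carr E. q e = 0} = \<iota> ` carr n"
    and act: "\<And>x m. \<lbrakk>x \<in> carr g; m \<in> carr n\<rbrakk> \<Longrightarrow> S x m \<in> carr n"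
      "\<And>x m. \<lbrakk>x \<in> carr g; m \<in> carr n\<rbrakk> \<Longrightarrow> lbr E (s x) (\<iota> m) = \<iota> (S x m)"
  shows "(E, \<iota>, q) \<in> extensions g n S"
proof -
  interpret n: topological_lie_algebra n by (rule n)
  interpret g: topological_lie_algebra g by (rule g)
  interpret E: topological_lie_algebra E by (rule E)
  have "retraction_maps (vtop E) (vtop n) r \<iota>"
    using \<iota> r r\<iota> by (simp add: retraction_maps_def lie_hom_def continuous_linear_def)
  then have "embedding_map (vtop n) (vtop E) \<iota>"
    using section_imp_embedding_map unfolding section_map_def by blast
  moreover have "retraction_maps (vtop E) (vtop g) q s"
    using q s qs by (simp add: retraction_maps_def lie_hom_def continuous_linear_def)
  then have "quotient_map (vtop E) (vtop g) q"
    using retraction_imp_quotient_map unfolding retraction_map_def by blast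
  moreover have "topologically_split E (\<iota> ` carr n)"
    unfolding ker[symmetric]
    by (rule topologically_split_kernel[OF E.topological_vector_space_axioms g.topological_vector_space_axioms
          lie_hom_linear[OF q] s qs])
  ultimately have "split_extension g n (E, \<iota>, q)"
    using E \<iota> q ker by (simp add: split_extension_def)
  moreover have "inj_on \<iota> (carr n)"
    by (metis inj_onI r\<iota>)
  then have "induced_outer_action n (E, \<iota>, q) s x m = S x m" if "x \<in> carr g" "m \<in> carr n" for x m
    using that act by (simp add: induced_outer_action_def)
  then have "kernel_class g n (induced_outer_action n (E, \<iota>, q) s) = kernel_class g n S"
    by (rule kernel_class_cong)
  then have "corresponds_to g n S (E, \<iota>, q)"
    using s qs by (auto simp: corresponds_to_def)
  ultimately show ?thesis
    by (simp add: extensions_def)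
qed

lemma (in outer_action) crossed_sum_extension:
  assumes "ce_diff 2 g S \<omega> = 0"
  shows "(crossed_sum n g S \<omega>, \<lambda>m. (m, 0), snd) \<in> extensions g n S"
proof (rule sectioned_extension_in_extensions)
  let ?C = "crossed_sum n g S \<omega>"
  show "topological_lie_algebra ?C"
    by (rule crossed_sum_tla[OF assms])
  show "lie_hom n ?C (\<lambda>m. (m, 0))"
    by (auto simp: lie_hom_def continuous_linear_def continuous_map_paired G.closed G.scale_zero_right
        S_zero_left \<omega>_self G.bracket_self id_def[symmetric])
  show "continuous_map (vtop ?C) (vtop n) fst"
    by (simp add: continuous_map_fst)
  show "lie_hom ?C g snd"
    by (auto simp: lie_hom_def continuous_linear_def continuous_map_snd)
  show "continuous_linear g ?C (\<lambda>x. (0, x))"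
    by (auto simp: continuous_linear_def continuous_map_paired N.closed N.scale_zero_right id_def[symmetric])
  show "{e \<in> carr ?C. snd e = 0} = (\<lambda>m. (m, 0)) ` carr n"
    by (auto simp: G.closed)
  show "lbr ?C (0, x) (m, 0) = (S x m, 0)" if "x \<in> carr g" "m \<in> carr n" for x m
    using that by (simp add: N.bracket_zero_left S_zero_left N.closed \<omega>_zero_right G.bracket_zero_right)
qed (use N.topological_lie_algebra_axioms G.topological_lie_algebra_axioms S_closed in auto)

text \<open>The section induces \<open>S\<close> on the nose, not just modulo inner derivations; the
  curvature formula for \<open>S\<close> is then read off from the bracket of \<open>E\<close>. The
  locale is applied to extensions of \<open>g\<close> by \<open>n\<close> and to a crossed sum
  viewed as an extension of g^S by the center.\<close>

locale sectioned_extension = N: topological_lie_algebra n + G: topological_lie_algebra g + E: topological_lie_algebra E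
  for n :: "('k :: topological_field, 'n :: ab_group_add) tla" and g :: "('k, 'g :: ab_group_add) tla"
    and E :: "('k, 'e :: ab_group_add) tla" +
  fixes S :: "'g \<Rightarrow> 'n \<Rightarrow> 'n" and \<iota> :: "'n \<Rightarrow> 'e" and q :: "'e \<Rightarrow> 'g" and s :: "'g \<Rightarrow> 'e"
  assumes \<iota>_hom: "lie_hom n E \<iota>" and embedding: "embedding_map (vtop n) (vtop E) \<iota>"
    and q_hom: "lie_hom E g q" and kernel: "{e \<in> carr E. q e = 0} = \<iota> ` carr n"
    and s_linear: "continuous_linear g E s" and q_s: "x \<in> carr g \<Longrightarrow> q (s x) = x"
    and S_closed: "\<lbrakk>x \<in> carr g; m \<in> carr n\<rbrakk> \<Longrightarrow> S x m \<in> carr n"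
    and s_action: "\<lbrakk>x \<in> carr g; m \<in> carr n\<rbrakk> \<Longrightarrow> lbr E (s x) (\<iota> m) = \<iota> (S x m)"
begin

lemmas \<iota>_linear = lie_hom_linear[OF \<iota>_hom]
  and q_linear = lie_hom_linear[OF q_hom]

lemmas \<iota>_simps = continuous_linear_closed[OF \<iota>_linear] continuous_linear_add[OF \<iota>_linear]
  continuous_linear_scale[OF \<iota>_linear] N.continuous_linear_minus[OF \<iota>_linear] N.continuous_linear_diff[OF \<iota>_linear]
  N.continuous_linear_zero[OF \<iota>_linear] lie_hom_bracket[OF \<iota>_hom]

lemmas q_simps = continuous_linear_closed[OF q_linear] continuous_linear_add[OF q_linear]
  continuous_linear_scale[OF q_linear] E.continuous_linear_minus[OF q_linear] E.continuous_linear_diff[OF q_linear]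
  E.continuous_linear_zero[OF q_linear] lie_hom_bracket[OF q_hom] q_s

lemmas s_simps = continuous_linear_closed[OF s_linear] continuous_linear_add[OF s_linear]
  continuous_linear_scale[OF s_linear] G.continuous_linear_minus[OF s_linear] G.continuous_linear_diff[OF s_linear]
  G.continuous_linear_zero[OF s_linear]

lemma \<iota>_inj: "\<lbrakk>\<iota> a = \<iota> b; a \<in> carr n; b \<in> carr n\<rbrakk> \<Longrightarrow> a = b"
  using embedding by (auto simp: embedding_map_def homeomorphic_map_def inj_on_def)

lemma q_\<iota>: "m \<in> carr n \<Longrightarrow> q (\<iota> m) = 0"
  using kernel by blast

abbreviation \<iota>_inv :: "'e \<Rightarrow> 'n" where
  "\<iota>_inv \<equiv> inv_into (carr n) \<iota>"

lemma \<iota>_inv_\<iota>: "m \<in> carr n \<Longrightarrow> \<iota>_inv (\<iota> m) = m"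
  by (intro inv_into_f_f inj_onI \<iota>_inj)

lemma \<iota>_\<iota>_inv: "\<lbrakk>e \<in> carr E; q e = 0\<rbrakk> \<Longrightarrow> \<iota> (\<iota>_inv e) = e"
  using kernel f_inv_into_f[of e \<iota> "carr n"] by auto

lemma \<iota>_inv_closed: "\<lbrakk>e \<in> carr E; q e = 0\<rbrakk> \<Longrightarrow> \<iota>_inv e \<in> carr n"
  using kernel inv_into_into[of e \<iota> "carr n"] by auto

lemma continuous_map_\<iota>_inv:
  assumes "continuous_map X (vtop E) \<phi>" and "\<And>t. t \<in> topspace X \<Longrightarrow> q (\<phi> t) = 0"
  shows "continuous_map X (vtop n) (\<lambda>t. \<iota>_inv (\<phi> t))"
proof -
  have "\<phi> ` topspace X \<subseteq> \<iota> ` carr n"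
    using assms unfolding kernel[symmetric] by (auto simp: continuous_map_def)
  then show ?thesis
    by (rule embedding_map_inv_into_continuous[OF embedding assms(1)])
qed

text \<open>It measures the failure of \<open>s\<close> to preserve brackets, pulled back along
  \<iota>. The default 0 is what membership in \<open>cochains\<close> demands off the pairs from
  the carrier.\<close>

definition factor_set :: "'g list \<Rightarrow> 'n" where
  "factor_set = (\<lambda>xs. if xs \<in> tuples 2 g
     then \<iota>_inv (lbr E (s (xs ! 0)) (s (xs ! 1)) - s (lbr g (xs ! 0) (xs ! 1))) else 0)"

lemma factor_set_eq:
  "\<lbrakk>x \<in> carr g; y \<in> carr g\<rbrakk> \<Longrightarrow> factor_set [x, y] = \<iota>_inv (lbr E (s x) (s y) - s (lbr g x y))"
  by (simp add: factor_set_def tuples_def)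

lemma factor_set_closed: "\<lbrakk>x \<in> carr g; y \<in> carr g\<rbrakk> \<Longrightarrow> factor_set [x, y] \<in> carr n"
  by (simp add: factor_set_eq \<iota>_inv_closed E.closed E.bracket_closed G.bracket_closed s_simps q_simps)

lemma \<iota>_factor_set:
  "\<lbrakk>x \<in> carr g; y \<in> carr g\<rbrakk> \<Longrightarrow> \<iota> (factor_set [x, y]) = lbr E (s x) (s y) - s (lbr g x y)"
  by (simp add: factor_set_eq \<iota>_\<iota>_inv E.closed E.bracket_closed G.bracket_closed s_simps q_simps)

text \<open>After applying the injective \<iota>, each algebraic identity becomes one between
  brackets in \<open>E\<close> and values of \<open>s\<close>.\<close>

lemma factor_set_cochain: "factor_set \<in> cochains 2 g n"
  unfolding cochains_2_iff
proof (intro conjI allI impI ballI)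
  show "factor_set xs = 0" if "xs \<notin> tuples 2 g" for xs
    using that by (simp add: factor_set_def)
  show "factor_set [x, x] = 0" if "x \<in> carr g" for x
    using that by (intro \<iota>_inj) (simp_all add: \<iota>_factor_set factor_set_closed E.bracket_self G.bracket_self s_simps \<iota>_simps N.closed)
  show "continuous_bilinear g g n (\<lambda>x y. factor_set [x, y])"
    unfolding continuous_bilinear_def
  proof (intro conjI ballI allI)
    note simps = \<iota>_factor_set factor_set_closed \<iota>_simps s_simps G.closed N.closed E.closed E.bracket_closed G.bracket_closed
    let ?P = "prod_topology (vtop g) (vtop g)"
    have s: "continuous_map (vtop g) (vtop E) s"
      by (rule continuous_linear_continuous[OF s_linear])
    have "continuous_map ?P (vtop n) (\<lambda>t. \<iota>_inv (lbr E (s (fst t)) (s (snd t)) - s (lbr g (fst t) (snd t))))"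
    proof (rule continuous_map_\<iota>_inv)
      show "continuous_map ?P (vtop E) (\<lambda>t. lbr E (s (fst t)) (s (snd t)) - s (lbr g (fst t) (snd t)))"
        by (intro E.continuous_map_minus E.continuous_map_bracket continuous_map_compose_fun[OF s]
            G.continuous_map_bracket continuous_map_fst continuous_map_snd)
      show "q (lbr E (s (fst t)) (s (snd t)) - s (lbr g (fst t) (snd t))) = 0" if "t \<in> topspace ?P" for t
        using that by (auto simp: q_simps simps)
    qed
    then show "continuous_map ?P (vtop n) (\<lambda>(x, y). factor_set [x, y])"
      by (rule continuous_map_eq) (auto simp: factor_set_eq)
    fix x x' y c assume "x \<in> carr g" "x' \<in> carr g" "y \<in> carr g"
    then show "factor_set [x + x', y] = factor_set [x, y] + factor_set [x', y]"
      "factor_set [y, x + x'] = factor_set [y, x] + factor_set [y, x']"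
      "factor_set [vscale g c x, y] = vscale n c (factor_set [x, y])"
      "factor_set [y, vscale g c x] = vscale n c (factor_set [y, x])"
      by (auto intro!: \<iota>_inj simp: simps E.bracket_linear G.bracket_linear E.bracket_scale_left E.bracket_scale_right
          G.bracket_scale_left G.bracket_scale_right E.scale_diff_right)
  qed
qed

text \<open>This is the Jacobi identity of \<open>E\<close> for s x, s y and \<iota> m.\<close>

lemma factor_set_curvature:
  assumes "x \<in> carr g" and "y \<in> carr g" and "m \<in> carr n"
  shows "S x (S y m) - S y (S x m) - S (lbr g x y) m = lbr n (factor_set [x, y]) m"
proof (rule \<iota>_inj)
  note closed = S_closed s_simps(1) \<iota>_simps(1) factor_set_closed G.bracket_closed N.bracket_closed E.bracket_closed
    N.closed E.closed assms
  have "lbr E (s x) (lbr E (s y) (\<iota> m)) + lbr E (s y) (lbr E (\<iota> m) (s x)) + lbr E (\<iota> m) (lbr E (s x) (s y)) = 0"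
    by (intro E.jacobi closed)
  then have "lbr E (lbr E (s x) (s y)) (\<iota> m) = lbr E (s x) (lbr E (s y) (\<iota> m)) - lbr E (s y) (lbr E (s x) (\<iota> m))"
    using E.bracket_swap[of "s x" "\<iota> m"] E.bracket_swap[of "lbr E (s x) (s y)" "\<iota> m"]
    by (simp add: closed E.bracket_minus_right algebra_simps eq_neg_iff_add_eq_0)
  then show "\<iota> (S x (S y m) - S y (S x m) - S (lbr g x y) m) = \<iota> (lbr n (factor_set [x, y]) m)"
    by (simp add: \<iota>_simps closed \<iota>_factor_set E.bracket_diff_left s_action)
qed (use assms in \<open>simp_all add: S_closed factor_set_closed G.bracket_closed N.bracket_closed N.closed\<close>)

text \<open>Under \<iota> the differential becomes the Jacobi sum of s x, s y, s z in
  \<open>E\<close>, plus s of the Jacobi sum of x, y, z up to sign; the brackets of s x with s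
  [y, z] and their analogues cancel in pairs.\<close>

lemma factor_set_flat: "ce_diff 2 g S factor_set = 0"
  unfolding ce_diff_2_eq_0_iff
proof (intro ballI)
  fix x y z assume xyz: "x \<in> carr g" "y \<in> carr g" "z \<in> carr g"
  note closed = S_closed s_simps(1) \<iota>_simps(1) factor_set_closed G.bracket_closed N.bracket_closed E.bracket_closed
    N.closed E.closed G.closed xyz
  have step: "\<iota> (S a (factor_set [b, c])) = lbr E (s a) (lbr E (s b) (s c)) - lbr E (s a) (s (lbr g b c))"
    if "a \<in> carr g" "b \<in> carr g" "c \<in> carr g" for a b c
    using that by (simp add: s_action[symmetric] \<iota>_factor_set closed E.bracket_diff_right)
  have "lbr E (s x) (lbr E (s y) (s z)) + lbr E (s y) (lbr E (s z) (s x)) + lbr E (s z) (lbr E (s x) (s y)) = 0"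
    by (intro E.jacobi closed)
  moreover have "lbr E (s y) (lbr E (s z) (s x)) = - lbr E (s y) (lbr E (s x) (s z))"
    using E.bracket_swap[of "s x" "s z"] by (simp add: closed E.bracket_minus_right)
  \<comment> \<open>The Jacobi identity of \<open>g\<close>, bracketed and signed as in the last
    three terms of the differential.\<close>
  moreover have "lbr g (lbr g x y) z - lbr g (lbr g x z) y + lbr g (lbr g y z) x = 0"
    using G.jacobi[OF xyz] G.bracket_swap[of x "lbr g y z"] G.bracket_swap[of y "lbr g x z"] G.bracket_swap[of z "lbr g x y"]
      G.bracket_swap[of x z]
    by (simp add: closed G.bracket_minus_right algebra_simps add_eq_0_iff)
  then have "s (lbr g (lbr g x y) z) - s (lbr g (lbr g x z) y) + s (lbr g (lbr g y z) x) = 0"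
    by (simp add: s_simps closed flip: s_simps(2,5))
  moreover have "lbr E (s (lbr g x y)) (s z) = - lbr E (s z) (s (lbr g x y))"
     "lbr E (s (lbr g x z)) (s y) = - lbr E (s y) (s (lbr g x z))"
     "lbr E (s (lbr g y z)) (s x) = - lbr E (s x) (s (lbr g y z))"
    by (intro E.bracket_swap closed)+
  ultimately have "\<iota> (ce_diff 2 g S factor_set [x, y, z]) = 0"
    by (simp add: ce_diff_2 \<iota>_simps closed step \<iota>_factor_set)
  then show "ce_diff 2 g S factor_set [x, y, z] = 0"
    using \<iota>_inj[of "ce_diff 2 g S factor_set [x, y, z]" 0] by (simp add: ce_diff_2 \<iota>_simps closed)
qed

lemma decomposition:
  "e \<in> carr E \<Longrightarrow> q (e - s (q e)) = 0"
  "e \<in> carr E \<Longrightarrow> \<iota>_inv (e - s (q e)) \<in> carr n"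
  "e \<in> carr E \<Longrightarrow> \<iota> (\<iota>_inv (e - s (q e))) + s (q e) = e"
proof -
  assume e: "e \<in> carr E"
  then show *: "q (e - s (q e)) = 0"
    by (simp add: q_simps s_simps)
  then show "\<iota>_inv (e - s (q e)) \<in> carr n" "\<iota> (\<iota>_inv (e - s (q e))) + s (q e) = e"
    using e by (simp_all add: \<iota>_inv_closed \<iota>_\<iota>_inv E.closed q_simps s_simps)
qed

text \<open>Every element of \<open>E\<close> is \<iota> m + s x for unique m and x. The bracket is
  verified for this parametrisation \<open>?K\<close>, where the bracket of \<iota> m with s x
  accounts for the term -S x m.\<close>

lemma lie_iso_crossed_sum:
  "lie_iso E (crossed_sum n g S factor_set) (\<lambda>e. (\<iota>_inv (e - s (q e)), q e))"
proof (rule lie_iso_inverse)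
  let ?C = "crossed_sum n g S factor_set" and ?K = "\<lambda>(m, x). \<iota> m + s x"
  note closed = S_closed s_simps(1) \<iota>_simps(1) factor_set_closed G.bracket_closed N.bracket_closed E.bracket_closed
    N.closed E.closed G.closed
  have "continuous_map (vtop ?C) (vtop E) (\<lambda>t. \<iota> (fst t) + s (snd t))"
    by (auto intro!: E.continuous_map_plus continuous_map_compose_fun[OF continuous_linear_continuous[OF \<iota>_linear]]
        continuous_map_compose_fun[OF continuous_linear_continuous[OF s_linear]] continuous_map_fst continuous_map_snd)
  moreover have "lbr E (\<iota> m) (s x) = - \<iota> (S x m)" if "m \<in> carr n" "x \<in> carr g" for m x
    using that E.bracket_swap[of "s x" "\<iota> m"] by (simp add: closed s_action)
  ultimately show "lie_hom ?C E ?K"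
    by (auto simp: lie_hom_def continuous_linear_def case_prod_unfold \<iota>_simps s_simps closed E.scale_add_right
        E.bracket_linear s_action \<iota>_factor_set add_ac)
  show "continuous_map (vtop E) (vtop ?C) (\<lambda>e. (\<iota>_inv (e - s (q e)), q e))"
  proof (simp, intro continuous_map_pairedI continuous_map_\<iota>_inv E.continuous_map_minus)
    show "continuous_map (vtop E) (vtop E) (\<lambda>e. e)"
      by (simp add: id_def[symmetric])
  qed (use continuous_linear_continuous[OF q_linear] continuous_linear_continuous[OF continuous_linear_compose[OF s_linear q_linear]]
      decomposition(1) in auto)
  show "(\<iota>_inv (?K t - s (q (?K t))), q (?K t)) = t" if "t \<in> carr ?C" for t
    using that by (auto simp: q_simps q_\<iota> closed \<iota>_inv_\<iota>)
  show "?K (\<iota>_inv (e - s (q e)), q e) = e" if "e \<in> carr E" for e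
    using that by (simp add: decomposition)
qed (auto simp: N.closed G.closed N.bracket_closed G.bracket_closed S_closed factor_set_closed)

end

section \<open>The center and the obstruction class\<close>

lemma center_tvs_simps [simp]:
  "vtop (center_tvs n) = subtopology (vtop n) (center n)"
  "vscale (center_tvs n) = vscale n"
  by (simp_all add: center_tvs_def)

context topological_lie_algebra
begin

lemma center_subset: "z \<in> center L \<Longrightarrow> z \<in> carr L"
  by (simp add: center_def)

lemma bracket_center_left: "\<lbrakk>z \<in> center L; x \<in> carr L\<rbrakk> \<Longrightarrow> lbr L z x = 0"
  by (simp add: center_def)

lemma bracket_center_right: "\<lbrakk>z \<in> center L; x \<in> carr L\<rbrakk> \<Longrightarrow> lbr L x z = 0"
  using bracket_swap[of z x] by (simp add: center_def)

lemma center_closed: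
  "0 \<in> center L"
  "\<lbrakk>z \<in> center L; w \<in> center L\<rbrakk> \<Longrightarrow> z + w \<in> center L"
  "z \<in> center L \<Longrightarrow> vscale L c z \<in> center L"
  "z \<in> center L \<Longrightarrow> - z \<in> center L"
  "\<lbrakk>z \<in> center L; w \<in> center L\<rbrakk> \<Longrightarrow> z - w \<in> center L"
  by (auto simp: center_def closed bracket_linear bracket_scale_left scale_zero_right)

lemma topspace_center [simp]: "carr L \<inter> center L = center L"
  using center_subset by blast

lemma center_tvs: "topological_vector_space (center_tvs L)"
proof -
  let ?Z = "subtopology (vtop L) (center L)"
  have "continuous_map (prod_topology ?Z ?Z) (vtop L) (\<lambda>t. fst t + snd t)"
    by (intro continuous_map_plus continuous_map_into_fulltopology[OF continuous_map_fst]
        continuous_map_into_fulltopology[OF continuous_map_snd])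
  then have add: "continuous_map (prod_topology ?Z ?Z) ?Z (\<lambda>(x, y). x + y)"
    by (auto simp: continuous_map_in_subtopology case_prod_unfold center_closed)
  have "continuous_map (prod_topology euclidean ?Z) (vtop L) (\<lambda>t. vscale L (fst t) (snd t))"
    by (intro continuous_map_vscale continuous_map_fst continuous_map_into_fulltopology[OF continuous_map_snd])
  then have scale: "continuous_map (prod_topology euclidean ?Z) ?Z (\<lambda>(c, x). vscale L c x)"
    by (auto simp: continuous_map_in_subtopology case_prod_unfold center_closed)
  show ?thesis
    by unfold_locales
      (use add scale in \<open>simp_all add: center_closed center_subset scale_add_right scale_add_left scale_scale scale_one
        Hausdorff Hausdorff_space_subtopology\<close>)
qed

text \<open>Since \<open>ad\<close> is 0 off the carrier, equality of functions says no more than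
  equality on \<open>L\<close>. This is what lets maps stand for cosets of the center.\<close>

lemma ad_eq_iff: "\<lbrakk>x \<in> carr L; y \<in> carr L\<rbrakk> \<Longrightarrow> ad L x = ad L y \<longleftrightarrow> x - y \<in> center L"
  by (auto simp: ad_def fun_eq_iff center_def diff_closed bracket_diff_left)

lemma ad_zero: "ad L 0 = 0"
  by (auto simp: ad_def fun_eq_iff bracket_zero_left)

lemma ad_add: "\<lbrakk>x \<in> carr L; y \<in> carr L\<rbrakk> \<Longrightarrow> ad L (x + y) = ad L x + ad L y"
  by (auto simp: ad_def fun_eq_iff bracket_add_left)

lemma ad_diff: "\<lbrakk>x \<in> carr L; y \<in> carr L\<rbrakk> \<Longrightarrow> ad L (x - y) = ad L x - ad L y"
  by (auto simp: ad_def fun_eq_iff bracket_diff_left)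

lemma ad_scale: "x \<in> carr L \<Longrightarrow> ad L (vscale L c x) = (\<lambda>y. vscale L c (ad L x y))"
  by (auto simp: ad_def fun_eq_iff bracket_scale_left scale_zero_right)

lemma ad_center: "z \<in> center L \<Longrightarrow> ad L z = 0"
  by (auto simp: ad_def fun_eq_iff center_def)

lemma ad_eq_0: "\<lbrakk>x \<in> carr L; ad L x = 0\<rbrakk> \<Longrightarrow> x \<in> center L"
  using ad_eq_iff[of x 0] by (simp add: ad_zero closed)

end

section \<open>The vector space of 2-cochains\<close>

lemma cochains_2_diff:
  assumes V: "topological_vector_space V" and \<alpha>: "\<alpha> \<in> cochains 2 L V" and \<beta>: "\<beta> \<in> cochains 2 L V"
  shows "\<alpha> - \<beta> \<in> cochains 2 L V"
proof -
  interpret V: topological_vector_space V by (rule V)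
  let ?P = "prod_topology (vtop L) (vtop L)"
  have \<alpha>2: "continuous_bilinear L L V (\<lambda>x y. \<alpha> [x, y])" and \<beta>2: "continuous_bilinear L L V (\<lambda>x y. \<beta> [x, y])"
    using \<alpha> \<beta> by (auto simp: cochains_2_iff)
  have "continuous_map ?P (vtop V) (\<lambda>t. (\<lambda>(x, y). \<alpha> [x, y]) t - (\<lambda>(x, y). \<beta> [x, y]) t)"
    by (intro V.continuous_map_minus continuous_bilinear_continuous \<alpha>2 \<beta>2)
  then have "continuous_bilinear L L V (\<lambda>x y. (\<alpha> - \<beta>) [x, y])"
    using \<alpha>2 \<beta>2 continuous_bilinear_closed[OF \<alpha>2] continuous_bilinear_closed[OF \<beta>2]
    unfolding continuous_bilinear_def by (simp add: case_prod_unfold V.scale_diff_right)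
  then show ?thesis
    using \<alpha> \<beta> by (simp add: cochains_2_iff)
qed

lemma cochains_2_scale:
  assumes V: "topological_vector_space V" and \<alpha>: "\<alpha> \<in> cochains 2 L V"
  shows "(\<lambda>xs. vscale V c (\<alpha> xs)) \<in> cochains 2 L V"
proof -
  interpret V: topological_vector_space V by (rule V)
  let ?P = "prod_topology (vtop L) (vtop L)"
  have \<alpha>2: "continuous_bilinear L L V (\<lambda>x y. \<alpha> [x, y])"
    using \<alpha> by (auto simp: cochains_2_iff)
  have "continuous_map ?P (vtop V) (\<lambda>t. vscale V c ((\<lambda>(x, y). \<alpha> [x, y]) t))"
    by (intro V.continuous_map_vscale continuous_bilinear_continuous \<alpha>2) simp
  then have "continuous_bilinear L L V (\<lambda>x y. vscale V c (\<alpha> [x, y]))"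
    using \<alpha>2 continuous_bilinear_closed[OF \<alpha>2]
    unfolding continuous_bilinear_def by (simp add: case_prod_unfold V.scale_add_right V.scale_scale mult.commute)
  then show ?thesis
    using \<alpha> by (simp add: cochains_2_iff V.scale_zero_right)
qed

lemma zero_cochain_2:
  assumes V: "topological_vector_space V"
  shows "0 \<in> cochains 2 L V"
proof -
  interpret V: topological_vector_space V by (rule V)
  show ?thesis
    by (auto simp: cochains_2_iff continuous_bilinear_def case_prod_unfold V.closed V.scale_zero_right)
qed

lemma cochains_2_add:
  assumes V: "topological_vector_space V" and \<alpha>: "\<alpha> \<in> cochains 2 L V" and \<beta>: "\<beta> \<in> cochains 2 L V"
  shows "\<alpha> + \<beta> \<in> cochains 2 L V"
  using cochains_2_diff[OF V \<alpha> cochains_2_diff[OF V zero_cochain_2[OF V] \<beta>]] by simp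

context outer_action
begin

lemma S_center: "\<lbrakk>x \<in> carr g; z \<in> center n\<rbrakk> \<Longrightarrow> S x z \<in> center n"
proof -
  assume x: "x \<in> carr g" and z: "z \<in> center n"
  have "lbr n (S x z) m = 0" if m: "m \<in> carr n" for m
  proof -
    have "S x (lbr n z m) = lbr n (S x z) m + lbr n z (S x m)"
      using x z m by (simp add: S_bracket N.center_subset)
    then show ?thesis
      using x z m by (simp add: N.bracket_center_left S_zero_right S_closed)
  qed
  then show ?thesis
    using x z by (simp add: center_def S_closed)
qed

text \<open>The center has the subspace topology and the scaling of \<open>n\<close>, so
  computations with central cochains can be carried out in \<open>n\<close>.\<close>

lemma cochains_center_iff:
  "\<alpha> \<in> cochains 2 g (center_tvs n) \<longleftrightarrow>
     \<alpha> \<in> cochains 2 g n \<and> (\<forall>x\<in>carr g. \<forall>y\<in>carr g. \<alpha> [x, y] \<in> center n)"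
  by (auto simp: cochains_2_iff continuous_bilinear_def continuous_map_in_subtopology Pi_iff)

lemma ce_diff_2_diff:
  assumes "\<alpha> \<in> cochains 2 g n" and "\<beta> \<in> cochains 2 g n"
  shows "ce_diff 2 g S (\<alpha> - \<beta>) = ce_diff 2 g S \<alpha> - ce_diff 2 g S \<beta>"
proof
  have c: "\<alpha> [x, y] \<in> carr n" "\<beta> [x, y] \<in> carr n" if "x \<in> carr g" "y \<in> carr g" for x y
    using assms that by (auto simp: cochains_2_iff intro: continuous_bilinear_closed)
  fix xs show "ce_diff 2 g S (\<alpha> - \<beta>) xs = (ce_diff 2 g S \<alpha> - ce_diff 2 g S \<beta>) xs"
  proof (cases "xs \<in> tuples 3 g")
    case True
    then show ?thesis
      unfolding tuples_3 by (auto simp: ce_diff_2 S_diff_right c algebra_simps)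
  next
    case False
    then show ?thesis
      by (simp add: ce_diff_2_outside)
  qed
qed

lemma ce_diff_2_zero: "ce_diff 2 g S 0 = 0"
  using ce_diff_2_diff[OF \<omega>_cochain \<omega>_cochain] by simp

lemma ce_diff_2_scale:
  assumes "\<alpha> \<in> cochains 2 g n"
  shows "ce_diff 2 g S (\<lambda>xs. vscale n c (\<alpha> xs)) = (\<lambda>xs. vscale n c (ce_diff 2 g S \<alpha> xs))"
proof
  have c: "\<alpha> [x, y] \<in> carr n" if "x \<in> carr g" "y \<in> carr g" for x y
    using assms that by (auto simp: cochains_2_iff intro: continuous_bilinear_closed)
  fix xs show "ce_diff 2 g S (\<lambda>xs. vscale n c (\<alpha> xs)) xs = vscale n c (ce_diff 2 g S \<alpha> xs)"
  proof (cases "xs \<in> tuples 3 g")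
    case True
    then show ?thesis
      unfolding tuples_3 by (auto simp: ce_diff_2 S_scale_right c S_closed G.bracket_closed N.closed
          N.scale_add_right N.scale_diff_right)
  next
    case False
    then show ?thesis
      by (simp add: ce_diff_2_outside N.scale_zero_right)
  qed
qed

lemma curvature_form_diff_center:
  assumes "curvature_form g n S \<omega>'"
  shows "\<omega> - \<omega>' \<in> cochains 2 g (center_tvs n)"
proof -
  have "\<omega>' \<in> cochains 2 g n"
    using assms by (simp add: curvature_form_def)
  moreover have "(\<omega> - \<omega>') [x, y] \<in> center n" if xy: "x \<in> carr g" "y \<in> carr g" for x y
  proof -
    have "ad n (\<omega> [x, y]) = ad n (\<omega>' [x, y])"
      using assms curvature_form xy by (simp add: curvature_form_def)
    moreover have "\<omega>' [x, y] \<in> carr n"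
      using calculation assms xy
      by (auto simp: curvature_form_def cochains_2_iff intro: continuous_bilinear_closed)
    ultimately show ?thesis
      using xy by (simp add: N.ad_eq_iff \<omega>_closed)
  qed
  ultimately show ?thesis
    by (simp add: cochains_center_iff cochains_2_diff[OF N.topological_vector_space_axioms \<omega>_cochain])
qed

lemma curvature_form_minus_center:
  assumes "\<eta> \<in> cochains 2 g (center_tvs n)"
  shows "curvature_form g n S (\<omega> - \<eta>)"
  using assms curvature_form
  by (simp add: curvature_form_def cochains_center_iff cochains_2_diff[OF N.topological_vector_space_axioms]
      N.ad_diff N.ad_center N.center_subset \<omega>_closed)

text \<open>
  Whether the classes agree does not depend on \<open>d\<^sub>S \<omega>\<close> being a cocycle: equality gives that the
  cocycle 0 differs from \<open>d\<^sub>S \<omega>\<close> by a coboundary.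
\<close>

lemma obstruction_class_zero_iff:
  "obstruction_class g n S \<omega> = cohom_class 3 g (center_tvs n) S 0 \<longleftrightarrow>
     (\<exists>\<omega>'. curvature_form g n S \<omega>' \<and> ce_diff 2 g S \<omega>' = 0)"
proof -
  let ?C = "cochains 2 g (center_tvs n)"
  let ?B = "ce_diff 2 g S ` ?C"
  have B: "coboundaries 3 g (center_tvs n) S = ?B"
    by (simp add: coboundaries_def)
  have C: "\<alpha> - \<beta> \<in> ?C" if "\<alpha> \<in> ?C" "\<beta> \<in> ?C" for \<alpha> \<beta>
    using that by (rule cochains_2_diff[OF N.center_tvs])
  have sub: "\<alpha> - \<beta> \<in> ?B" if "\<alpha> \<in> ?B" "\<beta> \<in> ?B" for \<alpha> \<beta>
  proof -
    obtain \<alpha>' \<beta>' where ab: "\<alpha>' \<in> ?C" "\<beta>' \<in> ?C" "\<alpha> = ce_diff 2 g S \<alpha>'" "\<beta> = ce_diff 2 g S \<beta>'"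
      using \<open>\<alpha> \<in> ?B\<close> \<open>\<beta> \<in> ?B\<close> by blast
    then have "\<alpha> - \<beta> = ce_diff 2 g S (\<alpha>' - \<beta>')"
      by (simp add: cochains_center_iff ce_diff_2_diff)
    then show ?thesis
      using C[OF ab(1,2)] by (rule image_eqI)
  qed
  have zero: "0 \<in> ?C"
    by (rule zero_cochain_2[OF N.center_tvs])
  then have zeroB: "0 \<in> ?B"
    using imageI[OF zero, of "ce_diff 2 g S"] by (simp only: ce_diff_2_zero)
  \<comment> \<open>Classes are sets of cocycles. To extract a coboundary from an equality of
    classes, 0 must be an element of its own class, hence a cocycle.\<close>
  have "0 \<in> cocycles 3 g (center_tvs n) S"
  proof -
    have "0 \<in> cochains 3 g (center_tvs n)"
      using N.center_closed(1) by (auto simp: cochains_def N.scale_zero_right N.closed)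
    moreover have "ce_diff 3 g S 0 = 0"
    proof
      fix xs
      have "S (xs ! j) 0 = 0" if "xs \<in> tuples 4 g" "j \<le> 3" for j
      proof -
        have "xs ! j \<in> carr g"
          using that by (auto simp: tuples_def subset_iff)
        then show ?thesis
          by (rule S_zero_right)
      qed
      note S0 = this
      have "(\<Sum>j\<le>3. signed j (S (xs ! j) 0)) = 0" if "xs \<in> tuples 4 g"
        by (rule sum.neutral) (use that S0 in \<open>auto simp: signed_def\<close>)
      moreover have "(\<Sum>(i, j)\<in>A. signed (i + j) (0::'n)) = 0" for A
        by (rule sum.neutral) (auto simp: signed_def)
      ultimately show "ce_diff 3 g S 0 xs = 0 xs"
        by (simp add: ce_diff_def)
    qed
    ultimately show ?thesis
      by (simp add: cocycles_def)
  qed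
  note zeroZ = this
  have "obstruction_class g n S \<omega> = cohom_class 3 g (center_tvs n) S 0 \<longleftrightarrow> ce_diff 2 g S \<omega> \<in> ?B"
  proof
    assume "obstruction_class g n S \<omega> = cohom_class 3 g (center_tvs n) S 0"
    moreover have "0 \<in> cohom_class 3 g (center_tvs n) S 0"
      using zeroZ zeroB unfolding cohom_class_def B by simp
    ultimately have "0 - ce_diff 2 g S \<omega> \<in> ?B"
      unfolding obstruction_class_def cohom_class_def B by blast
    from sub[OF zeroB this] show "ce_diff 2 g S \<omega> \<in> ?B"
      by simp
  next
    assume d: "ce_diff 2 g S \<omega> \<in> ?B"
    \<comment> \<open>Only closure under differences is at hand, so d_S \<omega> is added by
      subtracting 0 - d_S \<omega>.\<close>
    have "\<beta> - ce_diff 2 g S \<omega> \<in> ?B \<longleftrightarrow> \<beta> - 0 \<in> ?B" for \<beta>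
      using sub[OF _ sub[OF zeroB d], of "\<beta> - ce_diff 2 g S \<omega>"] sub[OF _ d, of \<beta>] by auto
    then show "obstruction_class g n S \<omega> = cohom_class 3 g (center_tvs n) S 0"
      unfolding obstruction_class_def cohom_class_def B by blast
  qed
  also have "\<dots> \<longleftrightarrow> (\<exists>\<omega>'. curvature_form g n S \<omega>' \<and> ce_diff 2 g S \<omega>' = 0)"
  proof
    assume "ce_diff 2 g S \<omega> \<in> ?B"
    then obtain \<eta> where \<eta>: "\<eta> \<in> ?C" "ce_diff 2 g S \<omega> = ce_diff 2 g S \<eta>"
      by blast
    then have "ce_diff 2 g S (\<omega> - \<eta>) = 0"
      by (simp add: ce_diff_2_diff \<omega>_cochain cochains_center_iff)
    then show "\<exists>\<omega>'. curvature_form g n S \<omega>' \<and> ce_diff 2 g S \<omega>' = 0"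
      using curvature_form_minus_center[OF \<eta>(1)] by blast
  next
    assume "\<exists>\<omega>'. curvature_form g n S \<omega>' \<and> ce_diff 2 g S \<omega>' = 0"
    then obtain \<omega>' where \<omega>': "curvature_form g n S \<omega>'" "ce_diff 2 g S \<omega>' = 0"
      by blast
    then have "ce_diff 2 g S (\<omega> - \<omega>') = ce_diff 2 g S \<omega>"
      by (simp add: ce_diff_2_diff \<omega>_cochain curvature_form_def)
    then show "ce_diff 2 g S \<omega> \<in> ?B"
      using imageI[OF curvature_form_diff_center[OF \<omega>'(1)], of "ce_diff 2 g S"] by (simp only:)
  qed
  finally show ?thesis .
qed

section \<open>From an extension to a flat curvature form\<close>

lemma outer_equiv_refl: "outer_equiv g n S S"
proof -
  have "continuous_linear g n (\<lambda>_. 0)"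
    by (auto simp: continuous_linear_def N.closed N.scale_zero_right)
  moreover have "ad n 0 m = 0" for m
    by (simp add: N.ad_zero)
  ultimately show ?thesis
    unfolding outer_equiv_def by (intro exI[of _ "\<lambda>_. 0"]) simp
qed

text \<open>\<open>S\<close> lies in its own kernel class, hence in that of the action induced by
  the given section \<sigma>. So the two actions differ by ad \<circ> \<gamma>, and \<sigma> +
  \<iota> \<circ> \<gamma> is a section that induces \<open>S\<close> itself.\<close>

lemma extension_sectioned:
  assumes "(E, \<iota>, q) \<in> extensions g n S"
  obtains s where "sectioned_extension n g E S \<iota> q s"
proof -
  have ext: "split_extension g n (E, \<iota>, q)" and cor: "corresponds_to g n S (E, \<iota>, q)"
    using assms by (simp_all add: extensions_def)
  interpret E: topological_lie_algebra E
    using ext by (simp add: split_extension_def)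
  have \<iota>: "lie_hom n E \<iota>" "embedding_map (vtop n) (vtop E) \<iota>" and q: "lie_hom E g q"
    and ker: "{e \<in> carr E. q e = 0} = \<iota> ` carr n"
    using ext by (simp_all add: split_extension_def)
  obtain \<sigma> where \<sigma>: "continuous_linear g E \<sigma>" "\<And>x. x \<in> carr g \<Longrightarrow> q (\<sigma> x) = x"
    and k: "kernel_class g n (induced_outer_action n (E, \<iota>, q) \<sigma>) = kernel_class g n S"
    using cor by (auto simp: corresponds_to_def)
  have "S \<in> kernel_class g n S"
    using outer outer_equiv_refl by (simp add: kernel_class_def)
  then have "outer_equiv g n S (induced_outer_action n (E, \<iota>, q) \<sigma>)"
    using k by (auto simp: kernel_class_def)
  then obtain \<gamma> where \<gamma>: "continuous_linear g n \<gamma>"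
    and S_\<gamma>: "\<And>x m. \<lbrakk>x \<in> carr g; m \<in> carr n\<rbrakk> \<Longrightarrow> S x m = induced_outer_action n (E, \<iota>, q) \<sigma> x m + ad n (\<gamma> x) m"
    by (auto simp: outer_equiv_def)
  note \<iota>_lin = lie_hom_linear[OF \<iota>(1)]
  note cl = continuous_linear_closed[OF \<gamma>] continuous_linear_closed[OF \<sigma>(1)] continuous_linear_closed[OF \<iota>_lin]
  have \<gamma>': "continuous_linear g E (\<lambda>x. \<iota> (\<gamma> x))"
    by (rule continuous_linear_compose[OF \<iota>_lin \<gamma>])
  have q\<iota>: "q (\<iota> m) = 0" if "m \<in> carr n" for m
    using ker that by blast
  show ?thesis
  proof
    show "sectioned_extension n g E S \<iota> q (\<lambda>x. \<sigma> x + \<iota> (\<gamma> x))"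
    proof
      show "continuous_linear g E (\<lambda>x. \<sigma> x + \<iota> (\<gamma> x))"
        using \<sigma>(1) \<gamma>' cl by (simp add: continuous_linear_def E.continuous_map_plus E.scale_add_right)
      show "q (\<sigma> x + \<iota> (\<gamma> x)) = x" if "x \<in> carr g" for x
        using that by (simp add: continuous_linear_add[OF lie_hom_linear[OF q]] cl \<sigma>(2) q\<iota>)
      show "lbr E (\<sigma> x + \<iota> (\<gamma> x)) (\<iota> m) = \<iota> (S x m)" if xm: "x \<in> carr g" "m \<in> carr n" for x m
      proof -
        \<comment> \<open>The bracket therefore lies in the image of \<iota>, and the
          \<open>inv_into\<close> in \<open>induced_outer_action\<close> is a true preimage.\<close>
        have "q (lbr E (\<sigma> x) (\<iota> m)) = 0"
          using xm by (simp add: lie_hom_bracket[OF q] cl q\<iota> \<sigma>(2) G.bracket_zero_right)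
        then have "lbr E (\<sigma> x) (\<iota> m) \<in> \<iota> ` carr n"
          using xm ker by (auto simp: E.bracket_closed cl)
        then have "\<iota> (induced_outer_action n (E, \<iota>, q) \<sigma> x m) = lbr E (\<sigma> x) (\<iota> m)"
          and "induced_outer_action n (E, \<iota>, q) \<sigma> x m \<in> carr n"
          by (simp_all add: induced_outer_action_def f_inv_into_f inv_into_into)
        then show ?thesis
          using xm by (simp add: S_\<gamma> ad_def continuous_linear_add[OF \<iota>_lin] lie_hom_bracket[OF \<iota>(1)] N.bracket_closed
              cl E.bracket_add_left)
      qed
    qed (use \<iota> q ker S_closed in simp_all)
  qed
qed

lemma extension_equivalent_crossed_sum:
  assumes "X \<in> extensions g n S"
  obtains \<omega>' where "curvature_form g n S \<omega>'" and "ce_diff 2 g S \<omega>' = 0"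
    and "ext_equivalent n X (crossed_sum n g S \<omega>', \<lambda>m. (m, 0), snd)"
proof -
  obtain E \<iota> q where X: "X = (E, \<iota>, q)"
    by (metis surj_pair)
  obtain s where "sectioned_extension n g E S \<iota> q s"
    using assms extension_sectioned unfolding X by blast
  then interpret E: sectioned_extension n g E S \<iota> q s .
  show ?thesis
  proof
    show "curvature_form g n S E.factor_set"
      using E.factor_set_cochain E.factor_set_curvature
      by (auto simp: curvature_form_def curvature_def commutator_def ad_def fun_eq_iff)
    show "ce_diff 2 g S E.factor_set = 0"
      by (rule E.factor_set_flat)
    show "ext_equivalent n X (crossed_sum n g S E.factor_set, \<lambda>m. (m, 0), snd)"
      unfolding ext_equivalent_def X prod.case
      using E.lie_iso_crossed_sum
      by (rule exI[of _ "\<lambda>e. (E.\<iota>_inv (e - s (q e)), q e)", OF conjI])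
         (simp add: E.q_\<iota> E.s_simps E.\<iota>_inv_\<iota>)
  qed
qed

end

section \<open>The Lie algebra \<open>\<gg>\<^sup>S\<close>\<close>

lemma n_ad_simps [simp]:
  "vtop (n_ad n) = quot_topology (vtop n) (ad n)"
  "vscale (n_ad n) c a = (\<lambda>y. vscale n c (a y))"
  "lbr (n_ad n) = commutator n"
  by (simp_all add: n_ad_def)

lemma g_S_simps [simp]:
  "vtop (g_S g n S \<omega>) = prod_topology (quot_topology (vtop n) (ad n)) (vtop g)"
  "vscale (g_S g n S \<omega>) c (a, x) = ((\<lambda>y. vscale n c (a y)), vscale g c x)"
  by (simp_all add: g_S_def)

lemma twisted_sum_simps [simp]:
  "vtop (twisted_sum A L \<rho> f) = prod_topology (vtop A) (vtop L)"
  "vscale (twisted_sum A L \<rho> f) c (a, x) = (vscale A c a, vscale L c x)"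
  "lbr (twisted_sum A L \<rho> f) (a, x) (a', x') = (\<rho> x a' - \<rho> x' a + f [x, x'], lbr L x x')"
  by (simp_all add: twisted_sum_def)

lemma g_S_action_pair [simp]: "g_S_action S (a, x) m = a m + S x m"
  by (simp add: g_S_action_def)

lemma ad_apply: "y \<in> carr n \<Longrightarrow> ad n x y = lbr n x y"
  by (simp add: ad_def)

locale central_outer_action = outer_action n g S \<omega>
  for n :: "('k :: topological_field, 'n :: ab_group_add) tla" and g :: "('k, 'g :: ab_group_add) tla"
    and S :: "'g \<Rightarrow> 'n \<Rightarrow> 'n" and \<omega> :: "'g list \<Rightarrow> 'n" +
  fixes f :: "('n \<Rightarrow> 'n) list \<Rightarrow> 'n" and \<Psi> :: "'n \<times> ('n \<Rightarrow> 'n) \<Rightarrow> 'n"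
    and \<theta> :: "('n \<Rightarrow> 'n) \<times> 'g \<Rightarrow> ('n \<Rightarrow> 'n) \<Rightarrow> 'n"
  assumes central_identification: "central_identification n f \<Psi>"
    and describes_action: "describes_action g n S \<omega> \<Psi> \<theta>"
begin

abbreviation gS :: "('k, ('n \<Rightarrow> 'n) \<times> 'g) tla" where
  "gS \<equiv> g_S g n S \<omega>"

abbreviation T :: "('n \<Rightarrow> 'n) \<times> 'g \<Rightarrow> 'n \<Rightarrow> 'n" where
  "T \<equiv> g_S_action S"

abbreviation lift :: "('n \<Rightarrow> 'n) \<Rightarrow> 'n" where
  "lift a \<equiv> \<Psi> (0, a)"

lemma zero_n_ad: "0 \<in> ad n ` carr n"
  using N.closed(1) N.ad_zero by (metis imageI)

lemma \<Psi>_hom: "lie_hom (twisted_sum (center_tvs n) (n_ad n) (\<lambda>_ _. 0) f) n \<Psi>"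
  using central_identification by (simp add: central_identification_def lie_iso_def)

lemma \<Psi>_add:
  "\<lbrakk>z \<in> center n; w \<in> center n; a \<in> ad n ` carr n; b \<in> ad n ` carr n\<rbrakk> \<Longrightarrow> \<Psi> (z + w, a + b) = \<Psi> (z, a) + \<Psi> (w, b)"
  using continuous_linear_add[OF lie_hom_linear[OF \<Psi>_hom], of "(z, a)" "(w, b)"] by simp

lemma \<Psi>_center: "z \<in> center n \<Longrightarrow> \<Psi> (z, 0) = z"
  using central_identification by (simp add: central_identification_def)

lemma ad_\<Psi>: "\<lbrakk>z \<in> center n; a \<in> ad n ` carr n\<rbrakk> \<Longrightarrow> ad n (\<Psi> (z, a)) = a"
  using central_identification by (auto simp: central_identification_def)

lemma \<Psi>_eq: "\<lbrakk>z \<in> center n; a \<in> ad n ` carr n\<rbrakk> \<Longrightarrow> \<Psi> (z, a) = z + lift a"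
  using \<Psi>_add[of z 0 0 a] by (simp add: zero_n_ad \<Psi>_center N.center_closed)

lemma ad_lift: "a \<in> ad n ` carr n \<Longrightarrow> ad n (lift a) = a"
  by (simp add: ad_\<Psi> N.center_closed)

text \<open>The bracket of g^S is defined with representatives picked by \<open>inv_into\<close>,
  which say nothing about continuity. The restriction of \<Psi> to the second factor is a continuous
  choice of representatives and takes their place in every continuity argument.\<close>

lemma lift_linear: "continuous_linear (n_ad n) n lift"
proof -
  have "continuous_linear (n_ad n) (twisted_sum (center_tvs n) (n_ad n) (\<lambda>_ _. 0) f) (\<lambda>a. (0, a))"
    by (auto simp: continuous_linear_def continuous_map_paired id_def[symmetric] N.center_closed N.scale_zero_right)
  then show ?thesis
    by (rule continuous_linear_compose[OF lie_hom_linear[OF \<Psi>_hom]])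
qed

lemma lift_closed: "a \<in> ad n ` carr n \<Longrightarrow> lift a \<in> carr n"
  using continuous_linear_closed[OF lift_linear] by simp

lemma \<Psi>_inj:
  "\<lbrakk>\<Psi> (z, a) = \<Psi> (w, b); z \<in> center n; w \<in> center n; a \<in> ad n ` carr n; b \<in> ad n ` carr n\<rbrakk> \<Longrightarrow> z = w \<and> a = b"
  by (metis \<Psi>_eq ad_\<Psi> add_right_cancel)

lemma continuous_ad: "continuous_map (vtop n) (vtop (n_ad n)) (ad n)"
  by (simp add: continuous_map_to_quot_topology)

lemma \<Psi>_surj:
  assumes "m \<in> carr n"
  obtains z a where "z \<in> center n" and "a \<in> ad n ` carr n" and "m = \<Psi> (z, a)"
proof
  show "m - lift (ad n m) \<in> center n"
    using assms N.ad_eq_iff[of m "lift (ad n m)"] by (simp add: ad_lift lift_closed)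
  then show "m = \<Psi> (m - lift (ad n m), ad n m)"
    using assms by (simp add: \<Psi>_eq)
qed (use assms in simp)

lemma n_ad_closed:
  "\<lbrakk>a \<in> ad n ` carr n; b \<in> ad n ` carr n\<rbrakk> \<Longrightarrow> a + b \<in> ad n ` carr n"
  "a \<in> ad n ` carr n \<Longrightarrow> (\<lambda>y. vscale n c (a y)) \<in> ad n ` carr n"
  by (auto simp: N.ad_add[symmetric] N.ad_scale[symmetric] N.closed)

lemma n_ad_apply_closed: "\<lbrakk>a \<in> ad n ` carr n; m \<in> carr n\<rbrakk> \<Longrightarrow> a m \<in> carr n"
  by (auto simp: ad_def N.bracket_closed)

lemma n_ad_apply_lift: "\<lbrakk>a \<in> ad n ` carr n; m \<in> carr n\<rbrakk> \<Longrightarrow> a m = lbr n (lift a) m"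
  using fun_cong[OF ad_lift[of a], of m] by (simp add: ad_def)

lemma n_ad_apply_outside: "\<lbrakk>a \<in> ad n ` carr n; m \<notin> carr n\<rbrakk> \<Longrightarrow> a m = 0"
  by (auto simp: ad_def)

lemma n_ad_apply_center: "\<lbrakk>a \<in> ad n ` carr n; z \<in> center n\<rbrakk> \<Longrightarrow> a z = 0"
  by (auto simp: ad_def N.bracket_center_right)

text \<open>Sums and multiples are computed on lifts and sent back by \<open>ad\<close>, hence
  continuous. The lift is a continuous injection into the Hausdorff space \<open>n\<close>, which
  makes \<open>n_ad\<close> Hausdorff.\<close>

lemma n_ad_tvs: "topological_vector_space (n_ad n)"
proof -
  let ?A = "vtop (n_ad n)"
  note lift = continuous_linear_continuous[OF lift_linear]
  have "continuous_map (prod_topology ?A ?A) ?A (\<lambda>t. ad n (lift (fst t) + lift (snd t)))"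
    by (intro continuous_map_compose_fun[OF continuous_ad] N.continuous_map_plus continuous_map_compose_fun[OF lift]
        continuous_map_fst continuous_map_snd)
  then have add: "continuous_map (prod_topology ?A ?A) ?A (\<lambda>(x, y). x + y)"
    by (rule continuous_map_eq) (auto simp: N.ad_add lift_closed ad_lift)
  have "continuous_map (prod_topology euclidean ?A) ?A (\<lambda>t. ad n (vscale n (fst t) (lift (snd t))))"
    by (intro continuous_map_compose_fun[OF continuous_ad] N.continuous_map_vscale continuous_map_compose_fun[OF lift]
        continuous_map_fst continuous_map_snd)
  then have scale: "continuous_map (prod_topology euclidean ?A) ?A (\<lambda>(c, x). vscale (n_ad n) c x)"
    by (rule continuous_map_eq) (auto simp: N.ad_scale lift_closed ad_lift)
  have "inj_on lift (topspace ?A)"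
    by (rule inj_on_inverseI[of _ "ad n"]) (simp add: ad_lift)
  then have haus: "Hausdorff_space ?A"
    using Hausdorff_space_injective_preimage[OF N.Hausdorff lift] by simp
  show ?thesis
  proof
    fix x y c d
    assume "x \<in> topspace ?A"
    then obtain m where m: "m \<in> carr n" "x = ad n m"
      by auto
    show "vscale (n_ad n) (c + d) x = vscale (n_ad n) c x + vscale (n_ad n) d x"
      "vscale (n_ad n) c (vscale (n_ad n) d x) = vscale (n_ad n) (c * d) x"
      "vscale (n_ad n) 1 x = x" "vscale (n_ad n) c x \<in> topspace ?A"
      using m by (simp_all add: N.ad_scale[symmetric] N.ad_add[symmetric] N.scale_add_left N.scale_scale N.scale_one N.closed)
    assume "y \<in> topspace ?A"
    then obtain k where k: "k \<in> carr n" "y = ad n k"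
      by auto
    show "vscale (n_ad n) c (x + y) = vscale (n_ad n) c x + vscale (n_ad n) c y" "x + y \<in> topspace ?A"
      using m k by (simp_all add: N.ad_scale[symmetric] N.ad_add[symmetric] N.scale_add_right N.closed)
  next
    show "0 \<in> topspace ?A"
      using zero_n_ad by simp
  qed (rule add scale haus)+
qed

lemma gS_tvs: "topological_vector_space gS"
  by (rule topological_vector_space_prod[OF n_ad_tvs G.topological_vector_space_axioms]) (simp_all add: g_S_def)

section \<open>The representation of g^S on \<open>n\<close> and the bracket of g^S\<close>

lemma T_closed: "\<lbrakk>u \<in> carr gS; m \<in> carr n\<rbrakk> \<Longrightarrow> T u m \<in> carr n"
  by (cases u) (simp add: n_ad_apply_closed S_closed N.closed)

lemma T_add_left: "\<lbrakk>u \<in> carr gS; v \<in> carr gS; m \<in> carr n\<rbrakk> \<Longrightarrow> T (u + v) m = T u m + T v m"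
  by (cases u; cases v) (simp add: S_add_left)

lemma T_lift: "\<lbrakk>a \<in> ad n ` carr n; m \<in> carr n\<rbrakk> \<Longrightarrow> T (a, x) m = lbr n (lift a) m + S x m"
  by (simp add: n_ad_apply_lift)

lemma T_linear: "u \<in> carr gS \<Longrightarrow> continuous_linear n n (T u)"
proof (cases u)
  fix a x assume u: "u \<in> carr gS" "u = (a, x)"
  have "continuous_map (vtop n) (vtop n) (\<lambda>m. lbr n (lift a) m + S x m)"
    using u by (intro N.continuous_map_plus N.continuous_map_bracket continuous_linear_continuous[OF S_linear])
      (auto simp: lift_closed id_def[symmetric])
  then have "continuous_map (vtop n) (vtop n) (T u)"
    by (rule continuous_map_eq) (use u in \<open>simp add: T_lift del: g_S_action_pair\<close>)
  then show ?thesis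
    using u by (simp add: continuous_linear_def T_lift N.closed lift_closed N.bracket_add_right N.bracket_closed
        N.bracket_scale_right S_add_right S_scale_right S_closed N.scale_add_right del: g_S_action_pair)
qed

lemmas T_diff_right = N.continuous_linear_diff[OF T_linear]
  and T_zero_right = N.continuous_linear_zero[OF T_linear]

lemma T_center: "\<lbrakk>u \<in> carr gS; z \<in> center n\<rbrakk> \<Longrightarrow> T u z = S (snd u) z"
  by (cases u) (simp add: n_ad_apply_center)

text \<open>Elements of \<open>n_ad\<close> are maps on \<open>n\<close>: once the components in
  \<open>g\<close> agree, the \<open>S\<close>-terms cancel and the actions determine the remaining
  components on the carrier, off which both are 0.\<close>

lemma T_inj:
  assumes "u \<in> carr gS" and "v \<in> carr gS" and "snd u = snd v" and "\<And>m. m \<in> carr n \<Longrightarrow> T u m = T v m"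
  shows "u = v"
proof -
  have "fst u m = fst v m" for m
    using assms(1,2) assms(4)[of m] by (cases "m \<in> carr n"; cases u; cases v)
      (use assms(3) in \<open>simp_all add: n_ad_apply_outside\<close>)
  then show ?thesis
    using assms(3) by (auto simp: prod_eq_iff)
qed

text \<open>
  Since \<open>\<omega>\<close> is determined modulo the center, any curvature form describes the bracket of \<open>\<gg>\<^sup>S\<close>.
\<close>

lemma gS_bracket:
  assumes m: "m \<in> carr n" "m' \<in> carr n" and x: "x \<in> carr g" "x' \<in> carr g" and \<omega>': "curvature_form g n S \<omega>'"
  shows "lbr gS (ad n m, x) (ad n m', x') = (ad n (lbr n m m' + S x m' - S x' m + \<omega>' [x, x']), lbr g x x')"
proof -
  \<comment> \<open>k and k' are the representatives that \<open>g_S\<close> picks; all that follows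
    compares them with the given m and m', from which they differ by central elements.\<close>
  define k where "k = inv_into (carr n) (ad n) (ad n m)"
  define k' where "k' = inv_into (carr n) (ad n) (ad n m')"
  have k: "k \<in> carr n" "ad n k = ad n m" and k': "k' \<in> carr n" "ad n k' = ad n m'"
    using m by (simp_all add: k_def k'_def inv_into_into f_inv_into_f)
  have diff: "k - m \<in> center n" "k' - m' \<in> center n"
    using k k' m N.ad_eq_iff by blast+
  interpret \<omega>': outer_action n g S \<omega>'
    by standard (use outer \<omega>' in simp_all)
  have "\<omega> [x, x'] - \<omega>' [x, x'] \<in> center n"
    using curvature_form_diff_center[OF \<omega>'] x by (simp add: cochains_center_iff)
  moreover have "lbr n k k' = lbr n m m'"
  proof -
    have "lbr n k k' - lbr n m m' = lbr n (k - m) k' + lbr n m (k' - m')"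
      using k k' m by (simp add: N.bracket_diff_left N.bracket_diff_right)
    then show ?thesis
      using diff k' m by (simp add: N.bracket_center_left N.bracket_center_right)
  qed
  moreover have "S x k' - S x m' \<in> center n" "S x' k - S x' m \<in> center n"
    using S_center[OF x(1) diff(2)] S_center[OF x(2) diff(1)] x k k' m by (simp_all add: S_diff_right)
  ultimately have "(S x k' - S x m') - (S x' k - S x' m) + (\<omega> [x, x'] - \<omega>' [x, x']) \<in> center n"
    by (blast intro: N.center_closed(2,5))
  then have "ad n (lbr n k k' + S x k' - S x' k + \<omega> [x, x']) = ad n (lbr n m m' + S x m' - S x' m + \<omega>' [x, x'])"
    using \<open>lbr n k k' = lbr n m m'\<close> k k' m x
    by (subst N.ad_eq_iff) (simp_all add: N.closed N.bracket_closed S_closed \<omega>_closed \<omega>'.\<omega>_closed algebra_simps)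
  then show ?thesis
    by (simp add: g_S_def Let_def flip: k_def k'_def)
qed

lemma gS_cases:
  assumes "u \<in> carr gS"
  obtains m x where "m \<in> carr n" and "x \<in> carr g" and "u = (ad n m, x)"
  using assms by auto

lemma gS_bracket_closed: "\<lbrakk>u \<in> carr gS; v \<in> carr gS\<rbrakk> \<Longrightarrow> lbr gS u v \<in> carr gS"
  by (elim gS_cases) (simp add: gS_bracket[OF _ _ _ _ curvature_form] N.closed N.bracket_closed S_closed \<omega>_closed G.bracket_closed)

lemma snd_gS_bracket: "\<lbrakk>u \<in> carr gS; v \<in> carr gS\<rbrakk> \<Longrightarrow> snd (lbr gS u v) = lbr g (snd u) (snd v)"
  by (elim gS_cases) (simp add: gS_bracket[OF _ _ _ _ curvature_form])

text \<open>On g^S the outer action becomes a genuine representation: the defect ad(\<omega>(x, y))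
  of \<open>S\<close> is exactly compensated by the \<omega>-term in the bracket.\<close>

lemma T_bracket:
  assumes "u \<in> carr gS" and "v \<in> carr gS" and k: "k \<in> carr n"
  shows "T (lbr gS u v) k = T u (T v k) - T v (T u k)"
proof -
  obtain m x where u: "m \<in> carr n" "x \<in> carr g" "u = (ad n m, x)"
    using assms(1) by (rule gS_cases)
  obtain m' y where v: "m' \<in> carr n" "y \<in> carr g" "v = (ad n m', y)"
    using assms(2) by (rule gS_cases)
  have "lbr n m (lbr n m' k) + lbr n m' (lbr n k m) + lbr n k (lbr n m m') = 0"
    by (rule N.jacobi[OF u(1) v(1) k])
  then have "lbr n (lbr n m m') k = lbr n m (lbr n m' k) - lbr n m' (lbr n m k)"
    using N.bracket_swap[of k "lbr n m m'"] N.bracket_swap[of m k] u v k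
    by (simp add: N.bracket_closed N.bracket_minus_right algebra_simps add_eq_0_iff)
  then show ?thesis
    using u v k
    by (simp add: gS_bracket[OF _ _ _ _ curvature_form] ad_apply N.closed N.bracket_closed S_closed \<omega>_closed
        N.bracket_linear S_add_right S_diff_right S_bracket S_curvature)
qed

text \<open>Evaluating \<open>T_bracket\<close> at (b, 0) gives the commutator, since
  \<open>S 0\<close> vanishes. This matches the bracket of g^S with the commutator that occurs in
  \<open>describes_action\<close>.\<close>

lemma gS_bracket_n_ad:
  assumes u: "u \<in> carr gS" and b: "b \<in> ad n ` carr n"
  shows "lbr gS u (b, 0) = (commutator n (T u) b, 0)"
proof -
  have b0: "(b, 0) \<in> carr gS"
    using b by (simp add: G.closed)
  obtain c where c: "lbr gS u (b, 0) = (c, 0)" "c \<in> ad n ` carr n"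
    using gS_bracket_closed[OF u b0] snd_gS_bracket[OF u b0] u
    by (cases "lbr gS u (b, 0)") (auto simp: G.bracket_zero_right)
  have "c m = commutator n (T u) b m" for m
  proof (cases "m \<in> carr n")
    case True
    then show ?thesis
      using T_bracket[OF u b0 True] b u T_closed[OF u True]
      by (simp add: c S_zero_left n_ad_apply_closed commutator_def)
  qed (use c in \<open>simp_all add: n_ad_apply_outside commutator_def\<close>)
  then show ?thesis
    using c by auto
qed

lemma gS_tla: "topological_lie_algebra gS"
proof -
  interpret L: topological_vector_space gS
    by (rule gS_tvs)
  let ?A = "vtop (n_ad n)"
  let ?P = "prod_topology ?A (vtop g)"
  note lift = continuous_linear_continuous[OF lift_linear]
  have p: "continuous_map (prod_topology ?P ?P) (vtop n) (\<lambda>t. lift (fst (fst t)))"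
    "continuous_map (prod_topology ?P ?P) (vtop g) (\<lambda>t. snd (fst t))"
    "continuous_map (prod_topology ?P ?P) (vtop n) (\<lambda>t. lift (fst (snd t)))"
    "continuous_map (prod_topology ?P ?P) (vtop g) (\<lambda>t. snd (snd t))"
    by (rule continuous_map_compose_fun[OF lift continuous_map_compose_fun[OF continuous_map_fst continuous_map_fst]]
        continuous_map_compose_fun[OF continuous_map_snd continuous_map_fst]
        continuous_map_compose_fun[OF lift continuous_map_compose_fun[OF continuous_map_fst continuous_map_snd]]
        continuous_map_compose_fun[OF continuous_map_snd continuous_map_snd])+
  \<comment> \<open>The bracket formula with the continuous lifts as representatives;
    \<open>gS_bracket\<close> identifies it with the bracket defined through
    \<open>inv_into\<close>.\<close>
  have "continuous_map (prod_topology ?P ?P) ?P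
      (\<lambda>t. (ad n (lbr n (lift (fst (fst t))) (lift (fst (snd t))) + S (snd (fst t)) (lift (fst (snd t)))
        - S (snd (snd t)) (lift (fst (fst t))) + \<omega> [snd (fst t), snd (snd t)]), lbr g (snd (fst t)) (snd (snd t))))"
    by (intro continuous_map_pairedI continuous_map_compose_fun[OF continuous_ad] N.continuous_map_plus
        N.continuous_map_minus N.continuous_map_bracket G.continuous_map_bracket p
        continuous_map_compose_pair[OF continuous_bilinear_continuous[OF S_bilinear]]
        continuous_map_compose_pair[OF continuous_bilinear_continuous[OF \<omega>_bilinear]])
  then have cont: "continuous_map (prod_topology ?P ?P) ?P (\<lambda>(u, v). lbr gS u v)"
  proof (rule continuous_map_eq)
    fix t assume "t \<in> topspace (prod_topology ?P ?P)"
    then obtain a x b y where t: "t = ((a, x), (b, y))" "a \<in> ad n ` carr n" "b \<in> ad n ` carr n" "x \<in> carr g" "y \<in> carr g"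
      by auto
    then show "(ad n (lbr n (lift (fst (fst t))) (lift (fst (snd t))) + S (snd (fst t)) (lift (fst (snd t)))
        - S (snd (snd t)) (lift (fst (fst t))) + \<omega> [snd (fst t), snd (snd t)]), lbr g (snd (fst t)) (snd (snd t)))
      = (\<lambda>(u, v). lbr gS u v) t"
      using gS_bracket[of "lift a" "lift b" x y, OF _ _ _ _ curvature_form] by (simp add: lift_closed ad_lift)
  qed
  note simps = gS_bracket[OF _ _ _ _ curvature_form] N.closed N.bracket_closed S_closed \<omega>_closed G.bracket_closed G.closed
  show ?thesis
  proof
    fix u v w c
    {
      assume uv: "u \<in> carr gS" "v \<in> carr gS"
      then show "lbr gS u v \<in> carr gS"
        by (rule gS_bracket_closed)
      obtain m x m' y where u: "m \<in> carr n" "x \<in> carr g" "u = (ad n m, x)" and v: "m' \<in> carr n" "y \<in> carr g" "v = (ad n m', y)"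
        using uv by (elim gS_cases)
      show "lbr gS (vscale gS c u) v = vscale gS c (lbr gS u v)"
        using u v by (simp add: N.ad_scale[symmetric] simps N.bracket_scale_left G.bracket_scale_left S_scale_left
            S_scale_right \<omega>_scale_left N.scale_add_right[symmetric] N.scale_diff_right[symmetric])
      show "lbr gS u (vscale gS c v) = vscale gS c (lbr gS u v)"
        using u v by (simp add: N.ad_scale[symmetric] simps N.bracket_scale_right G.bracket_scale_right S_scale_left
            S_scale_right \<omega>_scale_right N.scale_add_right[symmetric] N.scale_diff_right[symmetric])
      assume w: "w \<in> carr gS"
      obtain m'' z where w': "m'' \<in> carr n" "z \<in> carr g" "w = (ad n m'', z)"
        using w by (rule gS_cases)
      show "lbr gS (u + v) w = lbr gS u w + lbr gS v w"
        using u v w' by (simp add: N.ad_add[symmetric] simps N.bracket_add_left G.bracket_add_left S_add_left S_add_right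
            \<omega>_add_left) (simp add: algebra_simps)
      show "lbr gS u (v + w) = lbr gS u v + lbr gS u w"
        using u v w' by (simp add: N.ad_add[symmetric] simps N.bracket_add_right G.bracket_add_right S_add_left S_add_right
            \<omega>_add_right) (simp add: algebra_simps)
      note closed = uv w gS_bracket_closed L.closed
      show "lbr gS u (lbr gS v w) + lbr gS v (lbr gS w u) + lbr gS w (lbr gS u v) = 0"
      \<comment> \<open>The component in \<open>g\<close> vanishes by the Jacobi identity of
        \<open>g\<close>. On \<open>n\<close> the sum acts as the Jacobi sum of commutators of
        operators, which is 0. The form \<omega> need not be flat here: d_S \<omega> is central and
        killed by \<open>ad\<close>.\<close>
      proof (rule T_inj)
        show "snd (lbr gS u (lbr gS v w) + lbr gS v (lbr gS w u) + lbr gS w (lbr gS u v)) = snd (0 :: ('n \<Rightarrow> 'n) \<times> 'g)"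
          using u(2) v(2) w'(2) by (simp add: snd_gS_bracket closed del: g_S_simps) (simp add: u(3) v(3) w'(3) G.jacobi)
        show "T (lbr gS u (lbr gS v w) + lbr gS v (lbr gS w u) + lbr gS w (lbr gS u v)) k = T 0 k" if k: "k \<in> carr n" for k
          using k by (simp add: T_add_left T_bracket T_diff_right T_closed closed N.closed S_zero_left zero_prod_def
              del: g_S_simps)
      qed (intro closed)+
    }
    show "lbr gS u u = 0" if "u \<in> carr gS"
      using that by (elim gS_cases) (simp add: simps N.bracket_self G.bracket_self \<omega>_self N.ad_zero zero_prod_def)
    show "continuous_map (prod_topology (vtop gS) (vtop gS)) (vtop gS) (\<lambda>(x, y). lbr gS x y)"
      using cont by simp
  qed
qed

end

section \<open>Extensions from cocycles on \<open>\<gg>\<^sup>S\<close>\<close>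

text \<open>\<open>center_tvs\<close> has no bracket field; with the zero bracket the center becomes
  a Lie algebra, and \<open>twisted_sum\<close> turns into an instance of
  \<open>crossed_sum\<close>.\<close>

definition abelian_tla :: "('k, 'a :: ab_group_add) tvs \<Rightarrow> ('k, 'a) tla" where
  "abelian_tla V = \<lparr>vtop = vtop V, vscale = vscale V, lbr = (\<lambda>_ _. 0)\<rparr>"

lemma abelian_tla_simps [simp]:
  "vtop (abelian_tla V) = vtop V" "vscale (abelian_tla V) = vscale V" "lbr (abelian_tla V) x y = 0"
  by (simp_all add: abelian_tla_def)

lemma abelian_tla:
  assumes "topological_vector_space V"
  shows "topological_lie_algebra (abelian_tla V)"
proof -
  interpret V: topological_vector_space V by (rule assms)
  show ?thesis
    by unfold_locales
      (use V.continuous_add V.continuous_scale in \<open>simp_all add: V.closed V.scale_add_right V.scale_add_left V.scale_scale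
        V.scale_one V.Hausdorff V.scale_zero_right case_prod_unfold\<close>)
qed

lemma cochains_abelian_tla [simp]: "cochains p L (abelian_tla V) = cochains p L V"
  by (simp add: cochains_def)

lemma twisted_sum_eq_crossed_sum: "twisted_sum A L \<rho> f = crossed_sum (abelian_tla A) L \<rho> f"
  by (simp add: twisted_sum_def crossed_sum_def fun_eq_iff)

lemma ad_abelian_tla: "ad (abelian_tla V) x = (\<lambda>_. 0)"
  by (auto simp: ad_def)

context outer_action
begin

lemma ce_diff_2_add:
  assumes "\<alpha> \<in> cochains 2 g n" and "\<beta> \<in> cochains 2 g n"
  shows "ce_diff 2 g S (\<alpha> + \<beta>) = ce_diff 2 g S \<alpha> + ce_diff 2 g S \<beta>"
  using ce_diff_2_diff[OF cochains_2_add[OF N.topological_vector_space_axioms assms] assms(2)] by simp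

end

context central_outer_action
begin

abbreviation Z :: "('k, 'n) tla" where
  "Z \<equiv> abelian_tla (center_tvs n)"

lemma T_in_center: "\<lbrakk>u \<in> carr gS; z \<in> center n\<rbrakk> \<Longrightarrow> T u z \<in> center n"
  by (cases u) (simp add: n_ad_apply_center S_center)

text \<open>By \<open>T_bracket\<close> the action on the center has curvature 0, and
  \<open>ad\<close> of an abelian algebra is 0. So the curvature equation reads 0 = 0 and any
  2-cochain may play the part of \<omega>.\<close>

lemma center_outer_action:
  assumes "h \<in> cochains 2 gS (center_tvs n)"
  shows "outer_action Z gS T h"
proof -
  have form: "curvature_form gS Z T h"
    using assms unfolding curvature_form_def
    by (auto simp: curvature_def commutator_def ad_abelian_tla fun_eq_iff T_bracket N.center_subset simp del: g_S_simps(1))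
  have "continuous_outer_action gS Z T"
    unfolding continuous_outer_action_def
  proof (intro conjI ballI allI)
    show "T u \<in> derivations Z" if u: "u \<in> carr gS" for u
    proof -
      have "continuous_map (vtop Z) (vtop Z) (T u)"
        using continuous_linear_continuous[OF T_linear[OF u]] T_in_center[OF u]
        by (auto simp: continuous_map_in_subtopology intro: continuous_map_from_subtopology)
      then show ?thesis
        using u N.center_subset T_linear[OF u] T_zero_right[OF u]
        by (simp add: derivations_def continuous_linear_def del: g_S_simps(1))
    qed
    show "T (u + v) m = T u m + T v m" if "u \<in> carr gS" "v \<in> carr gS" "m \<in> carr Z" for u v m
      using that by (simp add: T_add_left N.center_subset del: g_S_simps(1))
    show "T (vscale gS c u) m = vscale Z c (T u m)" if "u \<in> carr gS" "m \<in> carr Z" for c u m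
      using that by (cases u) (simp add: N.center_subset n_ad_apply_center N.scale_zero_right S_scale_left)
    \<comment> \<open>On the center, T (a, x) is S x, so joint continuity is inherited from
      \<open>S\<close>.\<close>
    have "continuous_map (prod_topology (vtop gS) (vtop Z)) (vtop n) (\<lambda>t. S (snd (fst t)) (snd t))"
      by (intro continuous_map_compose_pair[OF continuous_bilinear_continuous[OF S_bilinear]])
         (auto intro: continuous_map_compose_fun[OF continuous_map_snd continuous_map_fst]
          continuous_map_into_fulltopology[OF continuous_map_snd])
    then have "continuous_map (prod_topology (vtop gS) (vtop Z)) (vtop Z) (\<lambda>t. S (snd (fst t)) (snd t))"
      by (auto simp: continuous_map_in_subtopology S_center)
    then show "continuous_map (prod_topology (vtop gS) (vtop Z)) (vtop Z) (\<lambda>(x, m). T x m)"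
      by (rule continuous_map_eq) (auto simp: n_ad_apply_center)
    show "\<exists>\<omega>. curvature_form gS Z T \<omega>"
      using form by blast
  qed
  then show ?thesis
    using form by (intro outer_action.intro outer_action_axioms.intro abelian_tla N.center_tvs gS_tla)
qed

lemma cocycles_thetaD:
  assumes "h \<in> cocycles_theta g n S \<omega> \<theta>"
  shows "h \<in> cochains 2 gS (center_tvs n)" and "ce_diff 2 gS T h = 0"
    and "\<lbrakk>u \<in> carr gS; b \<in> ad n ` carr n\<rbrakk> \<Longrightarrow> h [u, (b, 0)] = \<theta> u b"
  using assms by (auto simp: cocycles_theta_def cocycles_def)

lemma cocycles_thetaI:
  assumes "h \<in> cochains 2 gS (center_tvs n)" and "ce_diff 2 gS T h = 0"
    and "\<And>u b. \<lbrakk>u \<in> carr gS; b \<in> ad n ` carr n\<rbrakk> \<Longrightarrow> h [u, (b, 0)] = \<theta> u b"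
  shows "h \<in> cocycles_theta g n S \<omega> \<theta>"
  using assms by (simp add: cocycles_theta_def cocycles_def del: g_S_simps(1))

text \<open>\<open>describes_action\<close> with its commutator rewritten as a bracket of g^S, which
  is the form in which \<theta> meets the brackets of the extensions.\<close>

lemma T_\<Psi>:
  assumes "u \<in> carr gS" and "z \<in> center n" and "b \<in> ad n ` carr n"
  shows "T u (\<Psi> (z, b)) = \<Psi> (S (snd u) z + \<theta> u b, fst (lbr gS u (b, 0)))"
  using describes_action assms gS_bracket_n_ad[OF assms(1,3)]
  by (cases u) (auto simp: describes_action_def simp del: g_S_action_pair)

lemma \<theta>_closed: "\<lbrakk>u \<in> carr gS; b \<in> ad n ` carr n\<rbrakk> \<Longrightarrow> \<theta> u b \<in> center n"
proof -
  assume u: "u \<in> carr gS" and b: "b \<in> ad n ` carr n"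
  have "continuous_bilinear gS (n_ad n) (center_tvs n) \<theta>"
    using describes_action by (simp add: describes_action_def)
  from continuous_bilinear_closed[OF this u] b show ?thesis
    by simp
qed

definition incl :: "'n \<Rightarrow> 'n \<times> (('n \<Rightarrow> 'n) \<times> 'g)" where
  "incl m = (let (z, a) = inv_into (center n \<times> carr (n_ad n)) \<Psi> m in (z, (a, 0)))"

lemma incl_\<Psi>:
  assumes "z \<in> center n" and "a \<in> ad n ` carr n"
  shows "incl (\<Psi> (z, a)) = (z, (a, 0))"
proof -
  have "inj_on \<Psi> (center n \<times> carr (n_ad n))"
  proof (rule inj_onI)
    fix t t' assume "t \<in> center n \<times> carr (n_ad n)" "t' \<in> center n \<times> carr (n_ad n)" "\<Psi> t = \<Psi> t'"
    then show "t = t'"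
      using \<Psi>_inj[of "fst t" "snd t" "fst t'" "snd t'"] by (simp add: mem_Times_iff prod_eq_iff)
  qed
  then show ?thesis
    using assms by (simp add: incl_def inv_into_f_f)
qed

lemma cocycle_extension_eq:
  "cocycle_extension g n S \<omega> \<Psi> h = (twisted_sum (center_tvs n) gS T h, incl, \<lambda>(z, u). snd u)"
  by (simp add: cocycle_extension_def incl_def[abs_def])

text \<open>The projection (m, x) \<mapsto> (ad m, x) is a homomorphism onto g^S for every curvature
  form \<omega>', since g^S sees it only modulo the center; its kernel is the center. The lift gives
  a section, and h is the resulting factor set.\<close>

lemma crossed_sum_equivalent_cocycle_extension:
  assumes \<omega>': "curvature_form g n S \<omega>'" and flat: "ce_diff 2 g S \<omega>' = 0"
  obtains h where "h \<in> cocycles_theta g n S \<omega> \<theta>"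
    and "ext_equivalent n (crossed_sum n g S \<omega>', \<lambda>m. (m, 0), snd) (cocycle_extension g n S \<omega> \<Psi> h)"
proof -
  interpret \<omega>': outer_action n g S \<omega>'
    by standard (use outer \<omega>' in simp_all)
  let ?C = "crossed_sum n g S \<omega>'"
  let ?\<iota> = "\<lambda>z. (z, 0)" and ?p = "\<lambda>(m, x). (ad n m, x)" and ?s = "\<lambda>(a, x). (lift a, x)"
  note simps = N.center_closed N.center_subset G.closed N.closed lift_closed ad_lift
  interpret X: sectioned_extension Z gS ?C T ?\<iota> ?p ?s
  proof (intro sectioned_extension.intro sectioned_extension_axioms.intro)
    show "topological_lie_algebra Z"
      by (intro abelian_tla N.center_tvs)
    show "topological_lie_algebra gS"
      by (rule gS_tla)
    show "topological_lie_algebra ?C"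
      by (rule \<omega>'.crossed_sum_tla[OF flat])
    have c\<iota>: "continuous_map (vtop Z) (vtop ?C) ?\<iota>"
      by (auto simp: continuous_map_paired G.closed intro: continuous_map_from_subtopology simp flip: id_def)
    then show "lie_hom Z ?C ?\<iota>"
      by (auto simp: lie_hom_def continuous_linear_def simps G.scale_zero_right S_zero_left \<omega>'.\<omega>_self
          G.bracket_zero_right N.bracket_center_left)
    show "embedding_map (vtop Z) (vtop ?C) ?\<iota>"
    proof -
      \<comment> \<open>The inclusion is the graph of the constant map 0, hence an embedding into
        z(n) \<times> g, which is a subspace of n \<times> g.\<close>
      have "embedding_map (vtop Z) (prod_topology (vtop Z) (vtop g)) (\<lambda>z. (z, 0))"
        by (subst embedding_map_graph) (simp add: G.closed)
      moreover have "prod_topology (vtop Z) (vtop g) = subtopology (vtop ?C) (center n \<times> UNIV)"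
        by (simp add: subtopology_Times)
      ultimately show ?thesis
        by (simp only: embedding_map_in_subtopology)
    qed
    have "continuous_map (vtop ?C) (vtop gS) (\<lambda>t. (ad n (fst t), snd t))"
      unfolding crossed_sum_simps g_S_simps
      by (intro continuous_map_pairedI continuous_map_compose_fun[OF continuous_map_to_quot_topology[of "vtop n" "ad n"]]
          continuous_map_fst continuous_map_snd)
    then show "lie_hom ?C gS ?p"
      by (auto simp: lie_hom_def continuous_linear_def case_prod_unfold N.ad_add N.ad_scale gS_bracket[OF _ _ _ _ \<omega>'])
    show "{e \<in> carr ?C. ?p e = 0} = ?\<iota> ` carr Z"
    proof -
      have "m \<in> carr n \<and> ad n m = 0 \<longleftrightarrow> m \<in> center n" for m
        using N.ad_eq_0 N.ad_center N.center_subset by blast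
      then show ?thesis
        by (auto simp: zero_prod_def G.closed)
    qed
    have lift_c: "continuous_map (quot_topology (vtop n) (ad n)) (vtop n) lift"
      using continuous_linear_continuous[OF lift_linear] by simp
    have "continuous_map (vtop gS) (vtop ?C) (\<lambda>t. (lift (fst t), snd t))"
      unfolding crossed_sum_simps g_S_simps
      by (intro continuous_map_pairedI continuous_map_compose_fun[OF lift_c] continuous_map_fst continuous_map_snd)
    then show "continuous_linear gS ?C ?s"
      using lift_linear by (auto simp: continuous_linear_def case_prod_unfold)
    show "?p (?s x) = x" if "x \<in> carr gS" for x
      using that by (auto simp: ad_lift)
    show "T u m \<in> carr Z" if "u \<in> carr gS" "m \<in> carr Z" for u m
      using that by (simp add: T_in_center del: g_S_simps(1))
    show "lbr ?C (?s u) (?\<iota> m) = ?\<iota> (T u m)" if "u \<in> carr gS" "m \<in> carr Z" for u m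
      using that by (cases u) (simp add: lift_closed N.bracket_center_right S_zero_left \<omega>'.\<omega>_zero_right G.bracket_zero_right
          n_ad_apply_center N.center_subset)
  qed
  define h where "h = X.factor_set"
  have h_cochain: "h \<in> cochains 2 gS (center_tvs n)"
    using X.factor_set_cochain by (simp add: h_def)
  have h_\<theta>: "h [u, (b, 0)] = \<theta> u b" if u: "u \<in> carr gS" and b: "b \<in> ad n ` carr n" for u b
  proof -
    obtain a x where ax: "u = (a, x)" "a \<in> ad n ` carr n" "x \<in> carr g"
      using u by (cases u) auto
    have b0: "(b, 0) \<in> carr gS"
      using b by (simp add: G.closed)
    define c where "c = fst (lbr gS u (b, 0))"
    have c: "lbr gS u (b, 0) = (c, 0)" "c \<in> ad n ` carr n"
      using gS_bracket_closed[OF u b0] by (simp_all add: c_def gS_bracket_n_ad[OF u b])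
    \<comment> \<open>The bracket contributes T u (lift b), which \<Psi> splits into the central
      part \<theta> u b and the lift of c; subtracting the section at (c, 0) leaves \<theta> u
      b.\<close>
    have "(h [u, (b, 0)], 0) = lbr ?C (?s u) (?s (b, 0)) - ?s (lbr gS u (b, 0))"
      unfolding h_def using X.\<iota>_factor_set[OF u b0] .
    also have "\<dots> = (T u (lift b) - lift c, 0)"
      unfolding c using ax b by (simp add: T_lift lift_closed S_zero_left \<omega>'.\<omega>_zero_right G.bracket_zero_right del: g_S_action_pair)
    also have "T u (lift b) = \<theta> u b + lift c"
    proof -
      have "snd u \<in> carr g"
        using ax by simp
      then show ?thesis
        using T_\<Psi>[OF u N.center_closed(1) b] by (simp add: c S_zero_right \<Psi>_eq[OF \<theta>_closed[OF u b] c(2)])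
    qed
    finally show ?thesis
      by simp
  qed
  show ?thesis
  proof
    show "h \<in> cocycles_theta g n S \<omega> \<theta>"
      using h_cochain X.factor_set_flat h_\<theta> by (intro cocycles_thetaI) (simp_all add: h_def)
    let ?\<Phi> = "\<lambda>e. (X.\<iota>_inv (e - ?s (?p e)), ?p e)"
    have "lie_iso ?C (twisted_sum (center_tvs n) gS T h) ?\<Phi>"
      using X.lie_iso_crossed_sum by (simp add: twisted_sum_eq_crossed_sum h_def)
    moreover have "?\<Phi> (m, 0) = incl m" if m: "m \<in> carr n" for m
    proof -
      obtain z a where z: "z \<in> center n" and a: "a \<in> ad n ` carr n" and mza: "m = \<Psi> (z, a)"
        using m by (rule \<Psi>_surj)
      \<comment> \<open>For m = z + lift a the section at (ad m, 0) is (lift a, 0), so the central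
        part z of m remains, as in \<open>incl\<close>.\<close>
      have "(m, 0) - ?s (?p (m, 0)) = (z, 0 :: 'g)"
      proof -
        have "ad n m = a" "m = z + lift a"
          using ad_\<Psi>[OF z a] \<Psi>_eq[OF z a] by (simp_all only: mza)
        then show ?thesis
          by simp
      qed
      then have "X.\<iota>_inv ((m, 0) - ?s (?p (m, 0 :: 'g))) = z"
        using X.\<iota>_inv_\<iota>[of z] z by simp
      then show ?thesis
        using z a by (simp add: mza incl_\<Psi> ad_\<Psi>)
    qed
    moreover have "(\<lambda>(z, u). snd u) (?\<Phi> e) = snd e" for e
      by (cases e) simp
    ultimately show "ext_equivalent n (?C, \<lambda>m. (m, 0), snd) (cocycle_extension g n S \<omega> \<Psi> h)"
      unfolding ext_equivalent_def cocycle_extension_eq prod.case by (intro exI[of _ ?\<Phi>] conjI ballI) (simp_all split: prod.split)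
  qed
qed

lemma twisted_sum_tla:
  assumes "h \<in> cocycles_theta g n S \<omega> \<theta>"
  shows "topological_lie_algebra (twisted_sum (center_tvs n) gS T h)"
proof -
  interpret H: outer_action Z gS T h
    by (rule center_outer_action[OF cocycles_thetaD(1)[OF assms]])
  show ?thesis
    unfolding twisted_sum_eq_crossed_sum by (rule H.crossed_sum_tla[OF cocycles_thetaD(2)[OF assms]])
qed

text \<open>In the bracket with (z, (b, 0)) the cocycle enters through h((0, x), (b, 0)), which the
  \<theta>-condition fixes; hence the section x \<mapsto> (0, (0, x)) induces \<open>S\<close>
  itself for every admissible h.\<close>

lemma section_action:
  assumes h: "h \<in> cocycles_theta g n S \<omega> \<theta>" and x: "x \<in> carr g" and m: "m \<in> carr n"
  shows "lbr (twisted_sum (center_tvs n) gS T h) (0, (0, x)) (incl m) = incl (S x m)"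
proof -
  obtain z b where z: "z \<in> center n" and b: "b \<in> ad n ` carr n" and mzb: "m = \<Psi> (z, b)"
    using m by (rule \<Psi>_surj)
  have u: "(0, x) \<in> carr gS"
    using x zero_n_ad by simp
  have b0: "(b, 0) \<in> carr gS"
    using b by (simp add: G.closed)
  have "S x m = \<Psi> (S x z + \<theta> (0, x) b, fst (lbr gS (0, x) (b, 0)))"
    using T_\<Psi>[OF u z b] by (simp add: mzb)
  moreover have "fst (lbr gS (0, x) (b, 0)) \<in> ad n ` carr n"
    using gS_bracket_closed[OF u b0] by (cases "lbr gS (0, x) (b, 0)") simp
  moreover have "snd (lbr gS (0, x) (b, 0)) = 0"
    using snd_gS_bracket[OF u b0] x by (simp add: G.bracket_zero_right)
  moreover have "T (b, 0) 0 = 0"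
    using T_zero_right[OF b0] .
  moreover have "T (0, x) z = S x z"
    by simp
  ultimately show ?thesis
    using z b x u
    by (simp add: mzb incl_\<Psi> cocycles_thetaD(3)[OF h u b] \<theta>_closed S_center N.center_closed prod_eq_iff
        del: g_S_simps(1) g_S_action_pair)
qed

text \<open>Continuity comes from the inverse of \<Psi>. For brackets, \<open>n\<close> acts on
  itself through \<open>n_ad\<close> inside g^S, so \<theta> already describes the bracket of
  \<open>n\<close>, and h agrees with \<theta> there.\<close>

lemma incl_hom:
  assumes h: "h \<in> cocycles_theta g n S \<omega> \<theta>"
  shows "lie_hom n (twisted_sum (center_tvs n) gS T h) incl"
proof -
  let ?W = "twisted_sum (center_tvs n) (n_ad n) (\<lambda>_ _. 0) f" and ?E = "twisted_sum (center_tvs n) gS T h"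
  have iso: "lie_iso ?W n \<Psi>"
    using central_identification by (simp add: central_identification_def)
  have "continuous_map (vtop n) (vtop ?W) (inv_into (carr ?W) \<Psi>)"
    by (rule lie_iso_inv_into_continuous[OF iso])
  moreover have "continuous_map (vtop ?W) (vtop ?E) (\<lambda>t. (fst t, (snd t, 0)))"
    unfolding twisted_sum_simps g_S_simps n_ad_simps
    by (intro continuous_map_pairedI continuous_map_fst continuous_map_snd) (simp add: G.closed)
  ultimately have "continuous_map (vtop n) (vtop ?E) (\<lambda>m. (\<lambda>t. (fst t, (snd t, 0))) (inv_into (carr ?W) \<Psi> m))"
    by (rule continuous_map_compose_fun[rotated])
  then have cont: "continuous_map (vtop n) (vtop ?E) incl"
    by (simp add: incl_def[abs_def] case_prod_unfold Let_def)
  have add: "incl (m + m') = incl m + incl m'" if "m \<in> carr n" "m' \<in> carr n" for m m'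
    using that by (elim \<Psi>_surj) (simp add: \<Psi>_add[symmetric] incl_\<Psi> N.center_closed n_ad_closed)
  have scale: "incl (vscale n c m) = vscale ?E c (incl m)" if m: "m \<in> carr n" for c m
  proof -
    obtain z a where z: "z \<in> center n" and a: "a \<in> ad n ` carr n" and mza: "m = \<Psi> (z, a)"
      using m by (rule \<Psi>_surj)
    have "vscale n c (\<Psi> (z, a)) = \<Psi> (vscale n c z, (\<lambda>y. vscale n c (a y)))"
      using continuous_linear_scale[OF lie_hom_linear[OF \<Psi>_hom], of "(z, a)" c] z a by simp
    then show ?thesis
      using z a by (simp add: mza incl_\<Psi> N.center_closed n_ad_closed G.scale_zero_right)
  qed
  have "incl (lbr n m m') = lbr ?E (incl m) (incl m')" if m: "m \<in> carr n" and m': "m' \<in> carr n" for m m'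
  proof -
    obtain z a where z: "z \<in> center n" and a: "a \<in> ad n ` carr n" and mza: "m = \<Psi> (z, a)"
      using m by (rule \<Psi>_surj)
    obtain w b where w: "w \<in> center n" and b: "b \<in> ad n ` carr n" and mwb: "m' = \<Psi> (w, b)"
      using m' by (rule \<Psi>_surj)
    have u: "(a, 0) \<in> carr gS" and v: "(b, 0) \<in> carr gS"
      using a b by (simp_all add: G.closed)
    \<comment> \<open>Reading the bracket as the action of (ad m, 0) in g^S brings in the
      description by \<theta>.\<close>
    have "lbr n m m' = ad n m m'"
      using m' by (simp add: ad_apply)
    also have "\<dots> = T (a, 0) m'"
      using z a m' by (simp add: mza ad_\<Psi> S_zero_left)
    also have "\<dots> = \<Psi> (\<theta> (a, 0) b, fst (lbr gS (a, 0) (b, 0)))"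
      using T_\<Psi>[OF u w b] w by (simp add: mwb S_zero_left N.center_subset)
    finally have "incl (lbr n m m') = (\<theta> (a, 0) b, (fst (lbr gS (a, 0) (b, 0)), 0))"
      using gS_bracket_closed[OF u v] u b \<theta>_closed[OF u b]
      by (cases "lbr gS (a, 0) (b, 0)") (simp add: incl_\<Psi>)
    moreover have "snd (lbr gS (a, 0) (b, 0)) = 0"
      using snd_gS_bracket[OF u v] by (simp add: G.bracket_self G.closed)
    ultimately show ?thesis
      using z w a b by (simp add: mza mwb incl_\<Psi> cocycles_thetaD(3)[OF h u b] n_ad_apply_center S_zero_left
          N.center_subset prod_eq_iff)
  qed
  then show ?thesis
    using cont add scale by (simp add: lie_hom_def continuous_linear_def)
qed

text \<open>The two maps required are the left inverse (z, (a, x)) \<mapsto> \<Psi> (z, a) of the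
  inclusion and the section x \<mapsto> (0, (0, x)).\<close>

lemma cocycle_extension_in_extensions:
  assumes h: "h \<in> cocycles_theta g n S \<omega> \<theta>"
  shows "cocycle_extension g n S \<omega> \<Psi> h \<in> extensions g n S"
  unfolding cocycle_extension_eq
proof (rule sectioned_extension_in_extensions)
  let ?E = "twisted_sum (center_tvs n) gS T h"
  show "topological_lie_algebra ?E"
    by (rule twisted_sum_tla[OF h])
  show "lie_hom n ?E incl"
    by (rule incl_hom[OF h])
  let ?W = "twisted_sum (center_tvs n) (n_ad n) (\<lambda>_ _. 0) f"
  have \<Psi>: "continuous_map (vtop ?W) (vtop n) \<Psi>"
    by (rule continuous_linear_continuous[OF lie_hom_linear[OF \<Psi>_hom]])
  show "continuous_map (vtop ?E) (vtop n) (\<lambda>t. \<Psi> (fst t, fst (snd t)))"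
    by (rule continuous_map_compose_fun[OF \<Psi>])
       (unfold twisted_sum_simps g_S_simps n_ad_simps,
        intro continuous_map_pairedI continuous_map_fst continuous_map_compose_fun[OF continuous_map_fst continuous_map_snd])
  show "\<Psi> (fst (incl m), fst (snd (incl m))) = m" if "m \<in> carr n" for m
    using that by (elim \<Psi>_surj) (simp add: incl_\<Psi>)
  have "continuous_map (vtop ?E) (vtop g) (\<lambda>t. snd (snd t))"
    unfolding twisted_sum_simps g_S_simps
    by (rule continuous_map_compose_fun[OF continuous_map_snd continuous_map_snd])
  then show "lie_hom ?E g (\<lambda>(z, u). snd u)"
    by (auto simp: lie_hom_def continuous_linear_def case_prod_unfold snd_gS_bracket)
  show "continuous_linear g ?E (\<lambda>x. (0, (0, x)))"
    by (auto simp: continuous_linear_def continuous_map_paired zero_n_ad N.center_closed N.scale_zero_right fun_eq_iff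
        simp flip: id_def)
  show "{e \<in> carr ?E. (\<lambda>(z, u). snd u) e = 0} = incl ` carr n"
  proof (intro equalityI subsetI)
    fix e assume "e \<in> {e \<in> carr ?E. (\<lambda>(z, u). snd u) e = 0}"
    then obtain z a where "z \<in> center n" "a \<in> ad n ` carr n" "e = (z, (a, 0))"
      by auto
    then show "e \<in> incl ` carr n"
      using incl_\<Psi>[of z a] lift_closed[of a]
      by (intro image_eqI[of _ _ "\<Psi> (z, a)"]) (simp_all add: \<Psi>_eq N.closed N.center_subset)
  next
    fix e assume "e \<in> incl ` carr n"
    then obtain m where "m \<in> carr n" "e = incl m"
      by blast
    then obtain z a where "z \<in> center n" "a \<in> ad n ` carr n" "e = incl (\<Psi> (z, a))"
      by (metis \<Psi>_surj)
    then show "e \<in> {e \<in> carr ?E. (\<lambda>(z, u). snd u) e = 0}"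
      by (simp add: incl_\<Psi> G.closed)
  qed
  show "lbr ?E (0, (0, x)) (incl m) = incl (S x m)" if "x \<in> carr g" "m \<in> carr n" for x m
    using h that by (rule section_action)
qed (use N.topological_lie_algebra_axioms G.topological_lie_algebra_axioms S_closed in auto)

end

section \<open>The affine structure and equivalence\<close>

context central_outer_action
begin

abbreviation q_pull :: "('g list \<Rightarrow> 'n) \<Rightarrow> (('n \<Rightarrow> 'n) \<times> 'g) list \<Rightarrow> 'n" where
  "q_pull \<equiv> pullback gS snd"

lemma q_pull_2: "\<lbrakk>u \<in> carr gS; v \<in> carr gS\<rbrakk> \<Longrightarrow> q_pull \<eta> [u, v] = \<eta> [snd u, snd v]"
  by (simp add: pullback_def)

lemma snd_closed: "u \<in> carr gS \<Longrightarrow> snd u \<in> carr g"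
  by auto

lemma section_in_gS: "x \<in> carr g \<Longrightarrow> (0, x) \<in> carr gS"
  using zero_n_ad by simp

lemma q_pull_cochain:
  assumes \<eta>: "\<eta> \<in> cochains 2 g (center_tvs n)"
  shows "q_pull \<eta> \<in> cochains 2 gS (center_tvs n)"
  unfolding cochains_2_iff
proof (intro conjI allI impI ballI)
  interpret gS: topological_vector_space gS
    by (rule gS_tvs)
  have bil: "continuous_bilinear g g (center_tvs n) (\<lambda>x y. \<eta> [x, y])"
    and self: "\<And>x. x \<in> carr g \<Longrightarrow> \<eta> [x, x] = 0"
    using \<eta> by (simp_all add: cochains_2_iff)
  show "q_pull \<eta> xs = 0" if "xs \<notin> tuples 2 gS" for xs
  proof (cases "set xs \<subseteq> carr gS")
    case True
    then have "map snd xs \<notin> tuples 2 g"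
      using that by (simp add: tuples_def)
    then show ?thesis
      using cochains_2_outside[OF \<eta>] by (simp add: pullback_def)
  qed (simp add: pullback_def)
  show "q_pull \<eta> [u, u] = 0" if "u \<in> carr gS" for u
    using that by (simp add: q_pull_2 self snd_closed del: g_S_simps(1))
  show "continuous_bilinear gS gS (center_tvs n) (\<lambda>u v. q_pull \<eta> [u, v])"
    unfolding continuous_bilinear_def
  proof (intro conjI ballI allI)
    have snd: "continuous_map (vtop gS) (vtop g) snd"
      by (simp add: continuous_map_snd)
    have "continuous_map (prod_topology (vtop gS) (vtop gS)) (vtop (center_tvs n)) (\<lambda>t. \<eta> [snd (fst t), snd (snd t)])"
      by (rule continuous_map_compose_pair[OF continuous_bilinear_continuous[OF bil]
            continuous_map_compose_fun[OF snd continuous_map_fst] continuous_map_compose_fun[OF snd continuous_map_snd]])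
    then show "continuous_map (prod_topology (vtop gS) (vtop gS)) (vtop (center_tvs n)) (\<lambda>(u, v). q_pull \<eta> [u, v])"
      by (rule continuous_map_eq) (auto simp: q_pull_2 simp del: g_S_simps(1))
    fix u u' v c assume uv: "u \<in> carr gS" "u' \<in> carr gS" "v \<in> carr gS"
    have scale: "snd (vscale gS c u) = vscale g c (snd u)"
      by (cases u) simp
    note simps = q_pull_2 gS.closed uv snd_closed scale
    show "q_pull \<eta> [u + u', v] = q_pull \<eta> [u, v] + q_pull \<eta> [u', v]"
      "q_pull \<eta> [v, u + u'] = q_pull \<eta> [v, u] + q_pull \<eta> [v, u']"
      "q_pull \<eta> [vscale gS c u, v] = vscale (center_tvs n) c (q_pull \<eta> [u, v])"
      "q_pull \<eta> [v, vscale gS c u] = vscale (center_tvs n) c (q_pull \<eta> [v, u])"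
      using continuous_bilinear_add_left[OF bil, of "snd u" "snd u'" "snd v"]
        continuous_bilinear_add_right[OF bil, of "snd v" "snd u" "snd u'"]
        continuous_bilinear_scale_left[OF bil, of "snd u" "snd v" c]
        continuous_bilinear_scale_right[OF bil, of "snd v" "snd u" c]
      by (simp_all add: simps del: g_S_simps)
  qed
qed

text \<open>Pullback commutes with the differential because \<open>snd\<close> preserves brackets
  and the action on central values factors through it.\<close>

lemma ce_diff_q_pull:
  assumes \<eta>: "\<eta> \<in> cochains 2 g (center_tvs n)" and uvw: "u \<in> carr gS" "v \<in> carr gS" "w \<in> carr gS"
  shows "ce_diff 2 gS T (q_pull \<eta>) [u, v, w] = ce_diff 2 g S \<eta> [snd u, snd v, snd w]"
proof -
  have "\<eta> [snd a, snd b] \<in> center n" if "a \<in> carr gS" "b \<in> carr gS" for a b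
    using \<eta> that snd_closed by (simp add: cochains_center_iff del: g_S_simps(1))
  then show ?thesis
    using uvw by (simp add: ce_diff_2 q_pull_2 snd_closed snd_gS_bracket gS_bracket_closed T_center del: g_S_simps(1))
qed

text \<open>Evaluation at pairs (0, x), (0, y) recovers the form on \<open>g\<close>; off the pairs
  both cochains vanish by convention.\<close>

lemma q_pull_inj:
  assumes "\<eta> \<in> cochains 2 g (center_tvs n)" and "\<zeta> \<in> cochains 2 g (center_tvs n)" and eq: "q_pull \<eta> = q_pull \<zeta>"
  shows "\<eta> = \<zeta>"
proof
  fix xs show "\<eta> xs = \<zeta> xs"
  proof (cases "xs \<in> tuples 2 g")
    case True
    then obtain x y where "x \<in> carr g" "y \<in> carr g" "xs = [x, y]"
      unfolding tuples_2 by blast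
    then show ?thesis
      using fun_cong[OF eq, of "[(0, x), (0, y)]"] q_pull_2[OF section_in_gS section_in_gS, of x y] by simp
  qed (simp add: cochains_2_outside[OF assms(1)] cochains_2_outside[OF assms(2)])
qed

text \<open>The pulled-back form vanishes when an argument comes from \<open>n_ad\<close>, because
  its component in \<open>g\<close> is 0; the \<theta>-condition is therefore untouched.\<close>

lemma cocycles_theta_translate:
  assumes \<eta>: "\<eta> \<in> cocycles 2 g (center_tvs n) S" and h: "h \<in> cocycles_theta g n S \<omega> \<theta>"
  shows "h + q_pull \<eta> \<in> cocycles_theta g n S \<omega> \<theta>"
proof (rule cocycles_thetaI)
  note hD = cocycles_thetaD[OF h]
  have \<eta>D: "\<eta> \<in> cochains 2 g (center_tvs n)" "ce_diff 2 g S \<eta> = 0"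
    using \<eta> by (simp_all add: cocycles_def)
  show "h + q_pull \<eta> \<in> cochains 2 gS (center_tvs n)"
    by (rule cochains_2_add[OF N.center_tvs hD(1) q_pull_cochain[OF \<eta>D(1)]])
  interpret H: outer_action Z gS T h
    by (rule center_outer_action[OF hD(1)])
  have "ce_diff 2 gS T (q_pull \<eta>) = 0"
    unfolding ce_diff_2_eq_0_iff by (simp add: ce_diff_q_pull[OF \<eta>D(1)] \<eta>D(2) del: g_S_simps(1))
  then show "ce_diff 2 gS T (h + q_pull \<eta>) = 0"
    using H.ce_diff_2_add[of h "q_pull \<eta>"] hD(1,2) q_pull_cochain[OF \<eta>D(1)] by simp
  show "(h + q_pull \<eta>) [u, (b, 0)] = \<theta> u b" if u: "u \<in> carr gS" and b: "b \<in> ad n ` carr n" for u b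
  proof -
    have b0: "(b, 0) \<in> carr gS"
      using b by (simp add: G.closed)
    have bil: "continuous_bilinear g g (center_tvs n) (\<lambda>x y. \<eta> [x, y])"
      using \<eta>D by (simp add: cochains_2_iff)
    have "\<eta> [snd u, 0] = 0"
      using continuous_bilinear_add_right[OF bil snd_closed[OF u] G.closed(1) G.closed(1)] by simp
    then show ?thesis
      using hD(3)[OF u b] q_pull_2[OF u b0, of \<eta>] by simp
  qed
qed

text \<open>Both cocycles equal \<theta> when the second argument is in \<open>n_ad\<close>, so
  their difference vanishes there, and by antisymmetry also for first arguments in
  \<open>n_ad\<close>. It thus descends to \<open>g\<close>, where \<eta> is its restriction along
  the linear section x \<mapsto> (0, x).\<close>

lemma cocycles_theta_difference:
  assumes h1: "h1 \<in> cocycles_theta g n S \<omega> \<theta>" and h2: "h2 \<in> cocycles_theta g n S \<omega> \<theta>"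
  obtains \<eta> where "\<eta> \<in> cocycles 2 g (center_tvs n) S" and "h2 = h1 + q_pull \<eta>"
proof
  define d where "d = h2 - h1"
  define \<eta> where "\<eta> = (\<lambda>xs. if xs \<in> tuples 2 g then d [(0, xs ! 0), (0, xs ! 1)] else 0)"
  have d: "d \<in> cochains 2 gS (center_tvs n)"
    unfolding d_def by (rule cochains_2_diff[OF N.center_tvs cocycles_thetaD(1)[OF h2] cocycles_thetaD(1)[OF h1]])
  interpret D: outer_action Z gS T d
    by (rule center_outer_action[OF d])
  have d_flat: "ce_diff 2 gS T d = 0"
    using D.ce_diff_2_diff[of h2 h1] cocycles_thetaD(1,2)[OF h1] cocycles_thetaD(1,2)[OF h2] by (simp add: d_def)
  have d_0: "d [u, (b, 0)] = 0" if "u \<in> carr gS" "b \<in> ad n ` carr n" for u b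
    using cocycles_thetaD(3)[OF h1 that] cocycles_thetaD(3)[OF h2 that] by (simp add: d_def)
  have \<eta>_eq: "\<eta> [x, y] = d [(0, x), (0, y)]" if "x \<in> carr g" "y \<in> carr g" for x y
    using that by (simp add: \<eta>_def tuples_def)
  have d_eq: "d [u, v] = \<eta> [snd u, snd v]" if u: "u \<in> carr gS" and v: "v \<in> carr gS" for u v
  proof -
    \<comment> \<open>Each argument is split into its components in \<open>n_ad\<close> and
      \<open>g\<close>; three of the four resulting values of d vanish.\<close>
    have parts: "(fst u, 0) \<in> carr gS" "(0, snd u) \<in> carr gS" "(fst v, 0) \<in> carr gS" "(0, snd v) \<in> carr gS"
      using u v zero_n_ad by (auto simp: G.closed)
    have split: "u = (fst u, 0) + (0, snd u)" "v = (fst v, 0) + (0, snd v)"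
      by (simp_all add: prod_eq_iff)
    have fst: "fst u \<in> ad n ` carr n" "fst v \<in> ad n ` carr n"
      using u v by auto
    have "d [u, v] = d [u, (fst v, 0)] + d [u, (0, snd v)]"
      using D.\<omega>_add_right[OF u parts(3,4)] by (simp only: split(2)[symmetric])
    moreover have "d [u, (0, snd v)] = d [(fst u, 0), (0, snd v)] + d [(0, snd u), (0, snd v)]"
      using D.\<omega>_add_left[OF parts(1,2,4)] by (simp only: split(1)[symmetric])
    moreover have "d [(fst u, 0), (0, snd v)] = 0"
      using D.\<omega>_swap[OF parts(4,1)] d_0[OF parts(4) fst(1)] by (simp only: minus_zero)
    ultimately have "d [u, v] = d [(0, snd u), (0, snd v)]"
      using d_0[OF u fst(2)] by (simp only: add_0_left)
    then show ?thesis
      by (simp only: \<eta>_eq[OF snd_closed[OF u] snd_closed[OF v]])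
  qed
  have "\<eta> \<in> cochains 2 g (center_tvs n)"
    unfolding cochains_2_iff
  proof (intro conjI allI impI ballI)
    show "\<eta> xs = 0" if "xs \<notin> tuples 2 g" for xs
      using that by (simp add: \<eta>_def)
    show "\<eta> [x, x] = 0" if "x \<in> carr g" for x
      using that by (simp add: \<eta>_eq D.\<omega>_self section_in_gS del: g_S_simps(1))
    show "continuous_bilinear g g (center_tvs n) (\<lambda>x y. \<eta> [x, y])"
      unfolding continuous_bilinear_def
    proof (intro conjI ballI allI)
      have s: "continuous_map (vtop g) (vtop gS) (\<lambda>x. (0, x))"
        unfolding g_S_simps
        by (intro continuous_map_pairedI) (use zero_n_ad in \<open>simp_all flip: id_def\<close>)
      have "continuous_map (prod_topology (vtop g) (vtop g)) (vtop (center_tvs n)) (\<lambda>t. d [(0, fst t), (0, snd t)])"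
        using continuous_map_compose_pair[OF continuous_bilinear_continuous[OF D.\<omega>_bilinear]
            continuous_map_compose_fun[OF s continuous_map_fst] continuous_map_compose_fun[OF s continuous_map_snd]]
        by simp
      then show "continuous_map (prod_topology (vtop g) (vtop g)) (vtop (center_tvs n)) (\<lambda>(x, y). \<eta> [x, y])"
        by (rule continuous_map_eq) (auto simp: \<eta>_eq)
      fix x x' y c assume xy: "x \<in> carr g" "x' \<in> carr g" "y \<in> carr g"
      note in_gS = xy[THEN section_in_gS]
      have 0: "(0, x + x') = (0 :: 'n \<Rightarrow> 'n, x) + (0, x')" "(0, vscale g c x) = vscale gS c (0, x)"
        by (simp_all add: N.scale_zero_right fun_eq_iff)
      show "\<eta> [x + x', y] = \<eta> [x, y] + \<eta> [x', y]"
        "\<eta> [y, x + x'] = \<eta> [y, x] + \<eta> [y, x']"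
        "\<eta> [vscale g c x, y] = vscale (center_tvs n) c (\<eta> [x, y])"
        "\<eta> [y, vscale g c x] = vscale (center_tvs n) c (\<eta> [y, x])"
        using D.\<omega>_add_left[OF in_gS] D.\<omega>_add_right[OF in_gS(3,1,2)] D.\<omega>_scale_left[OF in_gS(1,3), of c]
          D.\<omega>_scale_right[OF in_gS(3,1), of c]
        by (simp_all only: \<eta>_eq xy G.closed 0 abelian_tla_simps)
    qed
  qed
  note \<eta>_cochain = this
  have eq: "d = q_pull \<eta>"
  proof
    fix xs show "d xs = q_pull \<eta> xs"
    proof (cases "xs \<in> tuples 2 gS")
      case True
      then obtain u v where "u \<in> carr gS" "v \<in> carr gS" "xs = [u, v]"
        unfolding tuples_2 by blast
      then show ?thesis
        by (simp add: d_eq q_pull_2 del: g_S_simps(1))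
    qed (simp add: cochains_2_outside[OF d] cochains_2_outside[OF q_pull_cochain[OF \<eta>_cochain]])
  qed
  have "ce_diff 2 g S \<eta> = 0"
    unfolding ce_diff_2_eq_0_iff
  proof (intro ballI)
    fix x y z assume "x \<in> carr g" "y \<in> carr g" "z \<in> carr g"
    then show "ce_diff 2 g S \<eta> [x, y, z] = 0"
      using ce_diff_q_pull[OF \<eta>_cochain section_in_gS section_in_gS section_in_gS, of x y z] d_flat
      by (simp add: eq)
  qed
  then show "\<eta> \<in> cocycles 2 g (center_tvs n) S"
    using \<eta>_cochain by (simp add: cocycles_def)
  show "h2 = h1 + q_pull \<eta>"
    by (simp add: eq[symmetric] d_def)
qed

lemma simply_transitive_translation:
  "simply_transitive_action (\<lambda>c \<eta> xs. vscale n c (\<eta> xs)) (cocycles 2 g (center_tvs n) S)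
     (cocycles_theta g n S \<omega> \<theta>) (\<lambda>\<eta> h. h + q_pull \<eta>)"
  unfolding simply_transitive_action_def
proof (intro conjI ballI allI)
  let ?Z = "cocycles 2 g (center_tvs n) S"
  have Z: "\<eta> \<in> cochains 2 g (center_tvs n)" "\<eta> \<in> cochains 2 g n" "ce_diff 2 g S \<eta> = 0" if "\<eta> \<in> ?Z" for \<eta>
    using that by (simp_all add: cocycles_def cochains_center_iff)
  show "0 \<in> ?Z"
    by (simp add: cocycles_def ce_diff_2_zero zero_cochain_2[OF N.center_tvs])
  show "\<eta> + \<zeta> \<in> ?Z" if "\<eta> \<in> ?Z" "\<zeta> \<in> ?Z" for \<eta> \<zeta>
    using Z[OF that(1)] Z[OF that(2)] by (simp add: cocycles_def ce_diff_2_add cochains_2_add[OF N.center_tvs])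
  show "(\<lambda>xs. vscale n c (\<eta> xs)) \<in> ?Z" if "\<eta> \<in> ?Z" for c \<eta>
    using Z[OF that] cochains_2_scale[OF N.center_tvs, of \<eta> g c]
    by (simp add: cocycles_def ce_diff_2_scale fun_eq_iff N.scale_zero_right)
  show "h + q_pull \<eta> \<in> cocycles_theta g n S \<omega> \<theta>" if "\<eta> \<in> ?Z" "h \<in> cocycles_theta g n S \<omega> \<theta>" for \<eta> h
    using that by (rule cocycles_theta_translate)
  show "h + q_pull 0 = h" for h
    by (simp add: fun_eq_iff pullback_def)
  show "h + q_pull (\<eta> + \<zeta>) = h + q_pull \<zeta> + q_pull \<eta>" for h \<eta> \<zeta>
    by (simp add: fun_eq_iff pullback_def add_ac)
  show "\<exists>!\<eta>. \<eta> \<in> ?Z \<and> h + q_pull \<eta> = h'"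
    if h: "h \<in> cocycles_theta g n S \<omega> \<theta>" and h': "h' \<in> cocycles_theta g n S \<omega> \<theta>" for h h'
  proof -
    obtain \<eta> where \<eta>: "\<eta> \<in> ?Z" "h' = h + q_pull \<eta>"
      using cocycles_theta_difference[OF h h'] by blast
    show ?thesis
    proof (rule ex1I[of _ \<eta>])
      show "\<eta> \<in> ?Z \<and> h + q_pull \<eta> = h'"
        using \<eta> by simp
      fix \<zeta> assume "\<zeta> \<in> ?Z \<and> h + q_pull \<zeta> = h'"
      then have "\<zeta> \<in> ?Z" "q_pull \<zeta> = q_pull \<eta>"
        using \<eta>(2) by (auto dest: add_left_imp_eq)
      then show "\<zeta> = \<eta>"
        using q_pull_inj Z(1) \<eta>(1) by blast
    qed
  qed
qed

section \<open>Equivalences as shears along the center\<close>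

lemma shear_equivalence:
  assumes h1: "h1 \<in> cocycles_theta g n S \<omega> \<theta>" and h2: "h2 \<in> cocycles_theta g n S \<omega> \<theta>"
    and \<beta>: "\<beta> \<in> cochains 1 g (center_tvs n)" and diff: "h2 - h1 = q_pull (ce_diff 1 g S \<beta>)"
  shows "ext_equivalent n (cocycle_extension g n S \<omega> \<Psi> h1) (cocycle_extension g n S \<omega> \<Psi> h2)"
proof -
  let ?E1 = "twisted_sum (center_tvs n) gS T h1" and ?E2 = "twisted_sum (center_tvs n) gS T h2"
  \<comment> \<open>The minus sign matches h2 - h1 = q_S^* d\<beta>: preservation of brackets says
    that h1 - \<beta>([x, y]) equals h2 - x.\<beta>(y) + y.\<beta>(x). The copy of \<open>n\<close>
    is fixed since \<beta>(0) = 0.\<close>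
  let ?\<Phi> = "\<lambda>(z, u). (z - \<beta> [snd u], u)"
  interpret Z: topological_vector_space "center_tvs n"
    by (rule N.center_tvs)
  have \<beta>_lin: "continuous_linear g (center_tvs n) (\<lambda>x. \<beta> [x])"
    using \<beta> by (simp only: cochains_1_iff)
  have \<beta>_closed: "\<beta> [x] \<in> center n" if "x \<in> carr g" for x
    using continuous_linear_closed[OF \<beta>_lin that] by simp
  have c: "continuous_map (prod_topology (vtop (center_tvs n)) (vtop gS)) (vtop (center_tvs n)) (\<lambda>t. \<beta> [snd (snd t)])"
    unfolding g_S_simps
    by (rule continuous_map_compose_fun[OF continuous_linear_continuous[OF \<beta>_lin]
          continuous_map_compose_fun[OF continuous_map_snd continuous_map_snd]])
  have c\<Phi>: "continuous_map (vtop ?E1) (vtop ?E2) (\<lambda>t. (fst t - \<beta> [snd (snd t)], snd t))"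
    "continuous_map (vtop ?E2) (vtop ?E1) (\<lambda>t. (fst t + \<beta> [snd (snd t)], snd t))"
    unfolding twisted_sum_simps
    by (intro continuous_map_pairedI Z.continuous_map_minus Z.continuous_map_plus continuous_map_fst continuous_map_snd c)+
  have bracket: "?\<Phi> (lbr ?E1 (z, u) (w, v)) = lbr ?E2 (?\<Phi> (z, u)) (?\<Phi> (w, v))"
    if z: "z \<in> center n" "w \<in> center n" and uv: "u \<in> carr gS" "v \<in> carr gS" for z w u v
  proof -
    have "h2 [u, v] - h1 [u, v] = S (snd u) (\<beta> [snd v]) - S (snd v) (\<beta> [snd u]) - \<beta> [lbr g (snd u) (snd v)]"
      using fun_cong[OF diff, of "[u, v]"] uv by (simp add: q_pull_2 ce_diff_1[simplified] snd_closed del: g_S_simps(1))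
    then have h2_eq: "h2 [u, v] = h1 [u, v] + (S (snd u) (\<beta> [snd v]) - S (snd v) (\<beta> [snd u]) - \<beta> [lbr g (snd u) (snd v)])"
      by (simp add: algebra_simps)
    have T_eq: "T u (w - \<beta> [snd v]) = T u w - S (snd u) (\<beta> [snd v])" "T v (z - \<beta> [snd u]) = T v z - S (snd v) (\<beta> [snd u])"
      using z uv by (simp_all add: T_diff_right N.center_subset \<beta>_closed snd_closed T_center S_diff_right N.center_closed
          del: g_S_simps(1))
    show ?thesis
      using uv by (simp add: snd_gS_bracket h2_eq T_eq del: g_S_simps(1))
  qed
  have "lie_iso ?E1 ?E2 ?\<Phi>"
  proof (rule lie_isoI)
    show "lie_hom ?E1 ?E2 ?\<Phi>"
      unfolding lie_hom_def continuous_linear_def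
    proof (intro conjI ballI allI)
      show "continuous_map (vtop ?E1) (vtop ?E2) ?\<Phi>"
        using c\<Phi>(1) by (simp add: case_prod_unfold)
      fix t t' c assume t: "t \<in> carr ?E1" and t': "t' \<in> carr ?E1"
      obtain z u where zu: "t = (z, u)" "z \<in> center n" "u \<in> carr gS"
        using t by (cases t) auto
      obtain w v where wv: "t' = (w, v)" "w \<in> center n" "v \<in> carr gS"
        using t' by (cases t') auto
      show "?\<Phi> (t + t') = ?\<Phi> t + ?\<Phi> t'"
        using zu wv by (simp add: continuous_linear_add[OF \<beta>_lin] snd_closed del: g_S_simps(1))
      have "snd (vscale gS c u) = vscale g c (snd u)"
        by (cases u) simp
      then show "?\<Phi> (vscale ?E1 c t) = vscale ?E2 c (?\<Phi> t)"
        using zu by (simp add: continuous_linear_scale[OF \<beta>_lin] snd_closed N.scale_diff_right \<beta>_closed N.center_subset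
            del: g_S_simps)
      show "?\<Phi> (lbr ?E1 t t') = lbr ?E2 (?\<Phi> t) (?\<Phi> t')"
        using bracket zu wv by simp
    qed
    show "continuous_map (vtop ?E2) (vtop ?E1) (\<lambda>(z, u). (z + \<beta> [snd u], u))"
      using c\<Phi>(2) by (simp add: case_prod_unfold)
  qed auto
  moreover have "?\<Phi> (incl m) = incl m" if m: "m \<in> carr n" for m
  proof -
    have "\<beta> [0] = 0"
      using G.continuous_linear_zero[OF \<beta>_lin] .
    with m show ?thesis
      by (elim \<Psi>_surj) (simp add: incl_\<Psi>)
  qed
  ultimately show ?thesis
    unfolding ext_equivalent_def cocycle_extension_eq prod.case
    by (intro exI[of _ ?\<Phi>] conjI ballI) (simp_all split: prod.split)
qed

text \<open>An equivalence is determined by its values on the section x \<mapsto> (0, (0, x)). It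
  moves such a point by an element of \<open>n\<close> that must centralise \<open>n\<close>, that
  is, by some \<gamma>(x) in the center.\<close>

lemma equivalence_difference:
  assumes h1: "h1 \<in> cocycles_theta g n S \<omega> \<theta>" and h2: "h2 \<in> cocycles_theta g n S \<omega> \<theta>"
    and equiv: "ext_equivalent n (cocycle_extension g n S \<omega> \<Psi> h1) (cocycle_extension g n S \<omega> \<Psi> h2)"
  obtains \<beta> where "\<beta> \<in> cochains 1 g (center_tvs n)" and "h2 - h1 = q_pull (ce_diff 1 g S \<beta>)"
proof -
  let ?E1 = "twisted_sum (center_tvs n) gS T h1" and ?E2 = "twisted_sum (center_tvs n) gS T h2"
  interpret E1: topological_lie_algebra ?E1 by (rule twisted_sum_tla[OF h1])
  interpret E2: topological_lie_algebra ?E2 by (rule twisted_sum_tla[OF h2])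
  obtain \<Phi> where iso: "lie_iso ?E1 ?E2 \<Phi>" and \<Phi>_incl: "\<And>m. m \<in> carr n \<Longrightarrow> \<Phi> (incl m) = incl m"
    and q\<Phi>: "\<And>e. e \<in> carr ?E1 \<Longrightarrow> snd (snd (\<Phi> e)) = snd (snd e)"
    using equiv unfolding ext_equivalent_def cocycle_extension_eq case_prod_unfold fst_conv snd_conv by blast
  have hom: "lie_hom ?E1 ?E2 \<Phi>"
    using iso by (simp add: lie_iso_def)
  note lin = lie_hom_linear[OF hom]
  note incl = lie_hom_linear[OF incl_hom[OF h2]] 
  have incl_closed: "incl m \<in> carr ?E1" "incl m \<in> carr ?E2" if "m \<in> carr n" for m
    using continuous_linear_closed[OF incl that] by simp_all
  have s_closed: "(0, (0, x)) \<in> carr ?E1" "(0, (0, x)) \<in> carr ?E2" if "x \<in> carr g" for x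
    using that zero_n_ad by (simp_all add: N.center_closed)
  define \<gamma> where "\<gamma> x = fst (\<Phi> (0, (0, x)))" for x
  have \<Phi>_s: "\<Phi> (0, (0, x)) = (\<gamma> x, (0, x)) \<and> \<gamma> x \<in> center n" if x: "x \<in> carr g" for x
  proof -
    define a where "a = fst (snd (\<Phi> (0, (0, x))))"
    have \<Phi>x: "\<Phi> (0, (0, x)) = (\<gamma> x, (a, x))"
      using q\<Phi>[OF s_closed(1)[OF x]] by (simp add: prod_eq_iff \<gamma>_def a_def)
    have "\<Phi> (0, (0, x)) \<in> carr ?E2"
      by (rule continuous_linear_closed[OF lin s_closed(1)[OF x]])
    then have \<gamma>a: "\<gamma> x \<in> center n" "a \<in> ad n ` carr n"
      by (simp_all add: \<Phi>x)
    have k: "\<Psi> (\<gamma> x, a) \<in> carr n"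
      using \<gamma>a by (simp add: \<Psi>_eq N.closed N.center_subset lift_closed)
    have "lbr n (\<Psi> (\<gamma> x, a)) m = 0" if m: "m \<in> carr n" for m
    proof -
      \<comment> \<open>Both points act on \<open>incl m\<close> as \<open>S x\<close>: the second
        by \<open>section_action\<close>, the first because \<Phi> preserves brackets and fixes
        \<open>incl\<close>. Their difference lies in \<open>n\<close> and so has zero bracket with
        all of \<open>n\<close>.\<close>
      have "\<Phi> (0, (0, x)) - (0, (0, x)) = incl (\<Psi> (\<gamma> x, a))"
        using \<gamma>a by (simp add: \<Phi>x incl_\<Psi>)
      then have "incl (lbr n (\<Psi> (\<gamma> x, a)) m) = lbr ?E2 (\<Phi> (0, (0, x)) - (0, (0, x))) (incl m)"
        by (simp only: lie_hom_bracket[OF incl_hom[OF h2] k m])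
      moreover have "lbr ?E2 (\<Phi> (0, (0, x)) - (0, (0, x))) (incl m)
          = lbr ?E2 (\<Phi> (0, (0, x))) (incl m) - lbr ?E2 (0, (0, x)) (incl m)"
        by (intro E2.bracket_diff_left continuous_linear_closed[OF lin] s_closed incl_closed x m)
      moreover have "lbr ?E2 (\<Phi> (0, (0, x))) (incl m) = \<Phi> (lbr ?E1 (0, (0, x)) (incl m))"
        by (simp only: lie_hom_bracket[OF hom s_closed(1)[OF x] incl_closed(1)[OF m]] \<Phi>_incl[OF m])
      moreover have "\<Phi> (lbr ?E1 (0, (0, x)) (incl m)) = lbr ?E2 (0, (0, x)) (incl m)"
        using x m by (simp only: section_action[OF h1] section_action[OF h2] \<Phi>_incl S_closed)
      ultimately have "incl (lbr n (\<Psi> (\<gamma> x, a)) m) = incl 0"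
        by (simp only: diff_self N.continuous_linear_zero[OF incl])
      moreover have "inj_on incl (carr n)"
        using cocycle_extension_in_extensions[OF h2] unfolding cocycle_extension_eq
        by (simp add: extensions_def split_extension_def embedding_map_def homeomorphic_map_def)
      ultimately show ?thesis
        using k m by (simp add: inj_on_eq_iff N.bracket_closed N.closed)
    qed
    then have "\<Psi> (\<gamma> x, a) \<in> center n"
      using k by (simp add: center_def)
    then have "a = 0"
      using ad_\<Psi>[OF \<gamma>a] N.ad_center by metis
    then show ?thesis
      using \<Phi>x \<gamma>a by simp
  qed
  have s_lin: "continuous_linear g ?E1 (\<lambda>x. (0, (0, x)))"
    by (auto simp: continuous_linear_def continuous_map_paired zero_n_ad N.center_closed N.scale_zero_right fun_eq_iff
        simp flip: id_def)
  have \<gamma>_lin: "continuous_linear g (center_tvs n) \<gamma>"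
  proof -
    have "continuous_linear g ?E2 (\<lambda>x. \<Phi> (0, (0, x)))"
      by (rule continuous_linear_compose[OF lin s_lin])
    moreover have "continuous_linear ?E2 (center_tvs n) fst"
      by (auto simp: continuous_linear_def continuous_map_fst)
    ultimately show ?thesis
      unfolding \<gamma>_def[abs_def] by (rule continuous_linear_compose[rotated])
  qed
  have \<Phi>_eq: "\<Phi> (z, u) = (z + \<gamma> (snd u), u)" if z: "z \<in> center n" and u: "u \<in> carr gS" for z u
  proof -
    have a: "fst u \<in> ad n ` carr n" and x: "snd u \<in> carr g"
      using u by auto
    \<comment> \<open>Decomposition into a point of \<open>n\<close>, which \<Phi> fixes, and a
      point of the section, where \<Phi> is known.\<close>
    have "(z, u) = incl (\<Psi> (z, fst u)) + (0, (0, snd u))"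
      using z a by (simp add: incl_\<Psi>)
    moreover have "\<Psi> (z, fst u) \<in> carr n"
      using z a by (simp add: \<Psi>_eq N.closed N.center_subset lift_closed)
    ultimately have "\<Phi> (z, u) = incl (\<Psi> (z, fst u)) + \<Phi> (0, (0, snd u))"
      using continuous_linear_add[OF lin incl_closed(1) s_closed(1)[OF x]] \<Phi>_incl by simp
    then show ?thesis
      using z a \<Phi>_s[OF x] by (simp add: incl_\<Psi>)
  qed
  \<comment> \<open>The shear adds \<gamma>, whereas h2 - h1 = q_S^* d\<beta> corresponds to
    subtracting \<beta>; hence the sign.\<close>
  define \<beta> where "\<beta> = (\<lambda>xs. if xs \<in> tuples 1 g then - \<gamma> (hd xs) else 0)"
  have \<beta>_eq: "\<beta> [x] = - \<gamma> x" if "x \<in> carr g" for x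
    using that by (simp add: \<beta>_def tuples_def)
  interpret Z: topological_vector_space "center_tvs n"
    by (rule N.center_tvs)
  show ?thesis
  proof
    have \<gamma>_closed: "\<gamma> x \<in> center n" if "x \<in> carr g" for x
      using \<Phi>_s[OF that] by simp
    have "continuous_map (vtop g) (vtop (center_tvs n)) (\<lambda>x. - \<gamma> x)"
      by (rule Z.continuous_map_uminus[OF continuous_linear_continuous[OF \<gamma>_lin]])
    then have "continuous_map (vtop g) (vtop (center_tvs n)) (\<lambda>x. \<beta> [x])"
      by (rule continuous_map_eq) (simp add: \<beta>_eq)
    then have "continuous_linear g (center_tvs n) (\<lambda>x. \<beta> [x])"
      using \<gamma>_closed continuous_linear_add[OF \<gamma>_lin] continuous_linear_scale[OF \<gamma>_lin]
      by (simp add: continuous_linear_def \<beta>_eq G.closed N.scale_minus_right N.center_subset)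
    then show "\<beta> \<in> cochains 1 g (center_tvs n)"
      unfolding cochains_1_iff by (simp add: \<beta>_def)
    show "h2 - h1 = q_pull (ce_diff 1 g S \<beta>)"
    proof
      fix us show "(h2 - h1) us = q_pull (ce_diff 1 g S \<beta>) us"
      proof (cases "us \<in> tuples 2 gS")
        case True
        then obtain u v where u: "u \<in> carr gS" and v: "v \<in> carr gS" and us: "us = [u, v]"
          unfolding tuples_2 by blast
        \<comment> \<open>With zero central parts this compares the cocycles alone: h1 +
          \<gamma>([x, y]) = x.\<gamma>(y) - y.\<gamma>(x) + h2, that is, h2 - h1 is the pullback of
          d(-\<gamma>).\<close>
        have "\<Phi> (lbr ?E1 (0, u) (0, v)) = lbr ?E2 (\<Phi> (0, u)) (\<Phi> (0, v))"
          using u v by (intro lie_hom_bracket[OF hom]) (simp_all add: N.center_closed)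
        moreover have "h1 [u, v] \<in> center n"
        proof -
          have "continuous_bilinear gS gS (center_tvs n) (\<lambda>x y. h1 [x, y])"
            using cocycles_thetaD(1)[OF h1] by (simp only: cochains_2_iff)
          from continuous_bilinear_closed[OF this u v] show ?thesis
            by simp
        qed
        ultimately have "h1 [u, v] + \<gamma> (lbr g (snd u) (snd v)) =
            S (snd u) (\<gamma> (snd v)) - S (snd v) (\<gamma> (snd u)) + h2 [u, v]"
          using u v by (simp add: \<Phi>_eq N.center_closed S_zero_right gS_bracket_closed snd_gS_bracket T_center \<gamma>_closed
              snd_closed del: g_S_simps(1))
        then show ?thesis
          using u v by (simp add: us q_pull_2 ce_diff_1[simplified] \<beta>_eq snd_closed G.bracket_closed S_minus_right \<gamma>_closed
              N.center_subset algebra_simps del: g_S_simps(1))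
      next
        case False
        then have "h1 us = 0" "h2 us = 0"
          using cocycles_thetaD(1)[OF h1] cocycles_thetaD(1)[OF h2] cochains_2_outside by blast+
        moreover have "q_pull (ce_diff 1 g S \<beta>) us = 0"
        proof (cases "set us \<subseteq> carr gS")
          case True
          then have "map snd us \<notin> tuples (Suc 1) g"
            using False by (simp add: tuples_def)
          then show ?thesis
            by (simp add: pullback_def ce_diff_outside)
        qed (simp add: pullback_def)
        ultimately show ?thesis
          by simp
      qed
    qed
  qed
qed

end

text \<open>\<open>Ext\<close> is formed inside one carrier type. The crossed sum gives existence in
  the type \<open>'n \<times> 'g\<close>, while the factor-set argument runs in any type; this is
  why one implication and the normal form are stated for a further type \<open>'e\<close>.\<close>

theorem mainTheorem3:
  fixes g :: "('k :: {topological_field, field_char_0}, 'g :: ab_group_add) tla"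
    and n :: "('k, 'n :: ab_group_add) tla"
    and S :: "'g \<Rightarrow> 'n \<Rightarrow> 'n"
    and \<omega> :: "'g list \<Rightarrow> 'n"
    and f :: "('n \<Rightarrow> 'n) list \<Rightarrow> 'n"
    and \<Psi> :: "'n \<times> ('n \<Rightarrow> 'n) \<Rightarrow> 'n"
    and \<theta> :: "('n \<Rightarrow> 'n) \<times> 'g \<Rightarrow> ('n \<Rightarrow> 'n) \<Rightarrow> 'n"
  assumes "topological_lie_algebra g"
    and "topological_lie_algebra n"
    and "continuous_outer_action g n S"
    and "curvature_form g n S \<omega>"
    and "topologically_split n (center n)"
    and "central_identification n f \<Psi>"
    and "describes_action g n S \<omega> \<Psi> \<theta>"
  defines "H3_zero \<equiv> cohom_class 3 g (center_tvs n) S 0"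
    and "Z2 \<equiv> cocycles 2 g (center_tvs n) S"
    and "B2 \<equiv> coboundaries 2 g (center_tvs n) S"
    and "Z2\<theta> \<equiv> cocycles_theta g n S \<omega> \<theta>"
    and "q_pull \<equiv> pullback (g_S g n S \<omega>) snd"
  shows
    "(obstruction_class g n S \<omega> = H3_zero \<longleftrightarrow>
        (Ext g n S :: ('k, 'g, 'n, 'n \<times> 'g) extension set set) \<noteq> {}) \<and>
     ((Ext g n S :: ('k, 'g, 'n, 'e :: ab_group_add) extension set set) \<noteq> {} \<longrightarrow>
        obstruction_class g n S \<omega> = H3_zero) \<and>
     (obstruction_class g n S \<omega> = H3_zero \<longrightarrow>
        (\<forall>X \<in> (extensions g n S :: ('k, 'g, 'n, 'e) extension set).
           \<exists>h\<in>Z2\<theta>. ext_equivalent n X (cocycle_extension g n S \<omega> \<Psi> h)) \<and>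
        Z2\<theta> \<noteq> {}) \<and>
     (\<forall>h\<in>Z2\<theta>. cocycle_extension g n S \<omega> \<Psi> h \<in> extensions g n S) \<and>
     simply_transitive_action (\<lambda>c \<eta> xs. vscale n c (\<eta> xs)) Z2 Z2\<theta> (\<lambda>\<eta> h. h + q_pull \<eta>) \<and>
     (\<forall>h1\<in>Z2\<theta>. \<forall>h2\<in>Z2\<theta>.
        ext_equivalent n (cocycle_extension g n S \<omega> \<Psi> h1) (cocycle_extension g n S \<omega> \<Psi> h2) \<longleftrightarrow>
        h2 - h1 \<in> q_pull ` B2)"
proof -
  interpret outer_action n g S \<omega>
    using assms(1-4) by (intro outer_action.intro outer_action_axioms.intro)
  interpret C: central_outer_action n g S \<omega> f \<Psi> \<theta>
    using assms(6,7) by unfold_locales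
  let ?flat = "\<exists>\<omega>'. curvature_form g n S \<omega>' \<and> ce_diff 2 g S \<omega>' = 0"
  have zero_iff: "obstruction_class g n S \<omega> = H3_zero \<longleftrightarrow> ?flat"
    unfolding H3_zero_def by (rule obstruction_class_zero_iff)
  \<comment> \<open>The type variable \<open>'x\<close> is generalised here and in the facts below,
    which are then used both for \<open>'e\<close> and for \<open>'n \<times> 'g\<close>.\<close>
  have Ext_iff: "(Ext g n S :: ('k, 'g, 'n, 'x :: ab_group_add) extension set set) \<noteq> {} \<longleftrightarrow>
      (\<exists>X :: ('k, 'g, 'n, 'x) extension. X \<in> extensions g n S)"
    by (auto simp: Ext_def quotient_def)
  have flat: ?flat if "X \<in> extensions g n S" for X :: "('k, 'g, 'n, 'x :: ab_group_add) extension"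
    using extension_equivalent_crossed_sum[OF that] by blast
  have ext: "\<exists>X :: ('k, 'g, 'n, 'n \<times> 'g) extension. X \<in> extensions g n S" if flat: ?flat
  proof -
    obtain \<omega>' where \<omega>': "curvature_form g n S \<omega>'" "ce_diff 2 g S \<omega>' = 0"
      using flat by blast
    interpret W: outer_action n g S \<omega>'
      using assms(1-3) \<omega>'(1) by (intro outer_action.intro outer_action_axioms.intro)
    show ?thesis
      using W.crossed_sum_extension[OF \<omega>'(2)] by blast
  qed
  have equiv: "\<exists>h\<in>Z2\<theta>. ext_equivalent n X (cocycle_extension g n S \<omega> \<Psi> h)"
    if X: "X \<in> extensions g n S" for X :: "('k, 'g, 'n, 'x :: ab_group_add) extension"
  proof -
    obtain \<omega>' where \<omega>': "curvature_form g n S \<omega>'" "ce_diff 2 g S \<omega>' = 0"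
      "ext_equivalent n X (crossed_sum n g S \<omega>', \<lambda>m. (m, 0), snd)"
      using extension_equivalent_crossed_sum[OF X] by blast
    obtain h where "h \<in> Z2\<theta>"
      "ext_equivalent n (crossed_sum n g S \<omega>', \<lambda>m. (m, 0), snd) (cocycle_extension g n S \<omega> \<Psi> h)"
      using C.crossed_sum_equivalent_cocycle_extension[OF \<omega>'(1,2)] unfolding Z2\<theta>_def by blast
    then show ?thesis
      using ext_equivalent_trans[OF \<omega>'(3)] by blast
  qed
  have B2_eq: "B2 = ce_diff 1 g S ` cochains 1 g (center_tvs n)"
    by (simp add: B2_def coboundaries_def)
  show ?thesis
  proof (intro conjI impI ballI)
    show "obstruction_class g n S \<omega> = H3_zero \<longleftrightarrow> (Ext g n S :: ('k, 'g, 'n, 'n \<times> 'g) extension set set) \<noteq> {}"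
      unfolding zero_iff Ext_iff using ext flat by blast
    show "obstruction_class g n S \<omega> = H3_zero"
      if "(Ext g n S :: ('k, 'g, 'n, 'e) extension set set) \<noteq> {}"
      using that unfolding zero_iff Ext_iff by (blast intro: flat)
    show "\<exists>h\<in>Z2\<theta>. ext_equivalent n X (cocycle_extension g n S \<omega> \<Psi> h)"
      if "X \<in> extensions g n S" for X :: "('k, 'g, 'n, 'e) extension"
      using that by (rule equiv)
    \<comment> \<open>A cocycle is obtained by bringing the crossed sum of a flat form into the
      normal form, so the affine space is nonempty exactly because some extension exists.\<close>
    show "Z2\<theta> \<noteq> {}" if "obstruction_class g n S \<omega> = H3_zero"
    proof -
      obtain X :: "('k, 'g, 'n, 'n \<times> 'g) extension" where "X \<in> extensions g n S"
        using ext \<open>obstruction_class g n S \<omega> = H3_zero\<close> unfolding zero_iff by blast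
      from equiv[OF this] show ?thesis
        by blast
    qed
    show "cocycle_extension g n S \<omega> \<Psi> h \<in> extensions g n S" if "h \<in> Z2\<theta>" for h
      using that unfolding Z2\<theta>_def by (rule C.cocycle_extension_in_extensions)
    show "simply_transitive_action (\<lambda>c \<eta> xs. vscale n c (\<eta> xs)) Z2 Z2\<theta> (\<lambda>\<eta> h. h + q_pull \<eta>)"
      unfolding Z2_def Z2\<theta>_def q_pull_def by (rule C.simply_transitive_translation)
    fix h1 h2 assume h: "h1 \<in> Z2\<theta>" "h2 \<in> Z2\<theta>"
    show "ext_equivalent n (cocycle_extension g n S \<omega> \<Psi> h1) (cocycle_extension g n S \<omega> \<Psi> h2) \<longleftrightarrow> h2 - h1 \<in> q_pull ` B2"
    proof
      assume "ext_equivalent n (cocycle_extension g n S \<omega> \<Psi> h1) (cocycle_extension g n S \<omega> \<Psi> h2)"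
      then obtain \<beta> where "\<beta> \<in> cochains 1 g (center_tvs n)" "h2 - h1 = q_pull (ce_diff 1 g S \<beta>)"
        using C.equivalence_difference[of h1 h2] h unfolding Z2\<theta>_def q_pull_def by blast
      then show "h2 - h1 \<in> q_pull ` B2"
        unfolding B2_eq by (simp only: imageI)
    next
      assume "h2 - h1 \<in> q_pull ` B2"
      then obtain \<beta> where "\<beta> \<in> cochains 1 g (center_tvs n)" "h2 - h1 = q_pull (ce_diff 1 g S \<beta>)"
        unfolding B2_eq by blast
      then show "ext_equivalent n (cocycle_extension g n S \<omega> \<Psi> h1) (cocycle_extension g n S \<omega> \<Psi> h2)"
        using C.shear_equivalence h unfolding Z2\<theta>_def q_pull_def by blast
    qed
  qed
qed

end
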